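(* Let $U, V, W \in L^\infty(\mathbb{R})$ be real-valued compactly supported functions with $W \ge 0$, and for $\varepsilon>0$ let $$\mathcal{H}_\varepsilon = -\frac{d^2}{dx^2} + W(x) + \varepsilon^{-1} U(\varepsilon^{-1}x) + \varepsilon^{-2} V(\varepsilon^{-1}x), \qquad \operatorname{dom}\mathcal{H}_\varepsilon = W_2^2(\mathbb{R}).$$ Assume that the Schrödinger operator $T_1 = -\frac{d^2}{dx^2}+V$ with $\operatorname{dom} T_1 = W_2^2(\mathbb{R})$ has $n$ eigenvalues $-\omega_1^2 < -\omega_2^2 < \dots < -\omega_n^2 < 0$ (with $\omega_k>0$) with eigenfunctions $v_1, v_2, \dots, v_n$. Then the operator family $\mathcal{H}_\varepsilon$ has $n$ low-lying eigenvalues $\lambda_1^\varepsilon < \lambda_2^\varepsilon < \dots < \lambda_n^\varepsilon$ with asymptotics $$\lambda_k^\varepsilon = -\varepsilon^{-2}\left(\omega_k - \varepsilon\,\frac{\int_{\mathbb{R}} U|v_k|^2\,dx}{2\omega_k\|v_k\|^2}\right)^2 + O(1),\qquad \text{as } \varepsilon\to +0.$$ The corresponding $L^2(\mathbb{R})$-normalized eigenfunctions $v_{k,\varepsilon}$ converge to zero in the weak topology of $L^2(\mathbb{R})$ as $\varepsilon\to+0$.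
   Context: $W_2^2(\mathbb{R})$ is the $L^2$-based Sobolev space of order 2; operators act in $L^2(\mathbb{R})$ and $\|\cdot\|$ is the $L^2(\mathbb{R})$ norm. A low-lying eigenvalue of the family $\mathcal{H}_\varepsilon$ is an eigenvalue $\lambda_\varepsilon$ of $\mathcal{H}_\varepsilon$ (defined for all sufficiently small $\varepsilon>0$) that diverges to $-\infty$ as $\varepsilon\to 0$. *)

theory Defs
  imports "HOL-Analysis.Analysis" "HOL-Library.Landau_Symbols"
begin

(* Elements of L^2 and L^infinity are represented by Borel functions (every Lebesgue class
   contains one); all notions below are invariant under modification on a null set. *)

definition L2 :: "(real \<Rightarrow> complex) set" where
  "L2 = {u \<in> borel_measurable lborel. integrable lborel (\<lambda>x. (cmod (u x))\<^sup>2)}"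

definition l2_inner :: "(real \<Rightarrow> complex) \<Rightarrow> (real \<Rightarrow> complex) \<Rightarrow> complex" where
  "l2_inner u v = (\<integral>x. u x * cnj (v x) \<partial>lborel)"

definition l2_norm :: "(real \<Rightarrow> complex) \<Rightarrow> real" where
  "l2_norm u = sqrt (\<integral>x. (cmod (u x))\<^sup>2 \<partial>lborel)"

definition l2_weak_tendsto ::
    "('i \<Rightarrow> real \<Rightarrow> complex) \<Rightarrow> (real \<Rightarrow> complex) \<Rightarrow> 'i filter \<Rightarrow> bool" where
  "l2_weak_tendsto u v F \<longleftrightarrow>
     (\<forall>h\<in>L2. ((\<lambda>i. l2_inner (u i) h) \<longlongrightarrow> l2_inner v h) F)"

definition Linfty :: "(real \<Rightarrow> real) set" where
  "Linfty = {f \<in> borel_measurable lborel. \<exists>C. AE x in lborel. \<bar>f x\<bar> \<le> C}"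

(* The essential support is compact. *)
definition compactly_supported :: "(real \<Rightarrow> real) \<Rightarrow> bool" where
  "compactly_supported f \<longleftrightarrow> (\<exists>K. compact K \<and> (AE x in lborel. x \<notin> K \<longrightarrow> f x = 0))"

definition test_functions :: "(real \<Rightarrow> real) set" where
  "test_functions = {\<phi>. (\<forall>k. (deriv ^^ k) \<phi> differentiable_on UNIV) \<and>
                         compact (closure {x. \<phi> x \<noteq> 0})}"

definition weak_deriv :: "nat \<Rightarrow> (real \<Rightarrow> complex) \<Rightarrow> (real \<Rightarrow> complex) \<Rightarrow> bool" where
  "weak_deriv k u g \<longleftrightarrow>
     (\<forall>\<phi>\<in>test_functions.
        (\<integral>x. u x * of_real ((deriv ^^ k) \<phi> x) \<partial>lborel) =
        (-1) ^ k * (\<integral>x. g x * of_real (\<phi> x) \<partial>lborel))"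

definition sobolev_W2 :: "nat \<Rightarrow> (real \<Rightarrow> complex) set" where
  "sobolev_W2 m = {u \<in> L2. \<forall>k\<le>m. \<exists>g\<in>L2. weak_deriv k u g}"

(* An unbounded operator in L^2 is represented by its graph: T u f means that
   u lies in the domain of T and T u = f almost everywhere. *)
type_synonym l2_operator = "(real \<Rightarrow> complex) \<Rightarrow> (real \<Rightarrow> complex) \<Rightarrow> bool"

(* - d^2/dx^2 + q with domain W_2^2 *)
definition schroedinger :: "(real \<Rightarrow> real) \<Rightarrow> l2_operator" where
  "schroedinger q u f \<longleftrightarrow>
     u \<in> sobolev_W2 2 \<and> f \<in> L2 \<and>
     (\<exists>u2\<in>L2. weak_deriv 2 u u2 \<and>
        (AE x in lborel. f x = - u2 x + of_real (q x) * u x))"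

definition eigenfunction :: "l2_operator \<Rightarrow> complex \<Rightarrow> (real \<Rightarrow> complex) \<Rightarrow> bool" where
  "eigenfunction T z u \<longleftrightarrow> T u (\<lambda>x. z * u x) \<and> \<not> (AE x in lborel. u x = 0)"

definition eigenvalues :: "l2_operator \<Rightarrow> complex set" where
  "eigenvalues T = {z. \<exists>u. eigenfunction T z u}"

definition low_lying_eigenvalue :: "(real \<Rightarrow> l2_operator) \<Rightarrow> (real \<Rightarrow> real) \<Rightarrow> bool" where
  "low_lying_eigenvalue H lam \<longleftrightarrow>
     (\<forall>\<^sub>F \<epsilon> in at_right 0. of_real (lam \<epsilon>) \<in> eigenvalues (H \<epsilon>)) \<and>
     filterlim lam at_bot (at_right 0)"

definition hamiltonian ::
    "(real \<Rightarrow> real) \<Rightarrow> (real \<Rightarrow> real) \<Rightarrow> (real \<Rightarrow> real) \<Rightarrow> real \<Rightarrow> l2_operator" where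
  "hamiltonian U V W \<epsilon> =
     schroedinger (\<lambda>x. W x + inverse \<epsilon> * U (inverse \<epsilon> * x) + inverse (\<epsilon>\<^sup>2) * V (inverse \<epsilon> * x))"

end

theory Submission
  imports Defs
begin

text \<open>The stretching \<open>x = \<epsilon> y\<close> turns \<open>H\<^sub>\<epsilon> + (\<kappa> / \<epsilon>)\<^sup>2\<close> into \<open>\<epsilon>\<close> to the power \<open>-2\<close> times
\<open>- d\<^sup>2/dy\<^sup>2 + q\<^sub>\<epsilon> + \<kappa>\<^sup>2\<close> with \<open>q\<^sub>\<epsilon>(y) = V(y) + \<epsilon> U(y) + \<epsilon>\<^sup>2 W(\<epsilon> y)\<close>. An eigenvalue \<open>- (\<kappa> / \<epsilon>)\<^sup>2\<close> of \<open>H\<^sub>\<epsilon>\<close>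
is therefore an eigenvalue \<open>- \<kappa>\<^sup>2\<close> of a small perturbation of \<open>T\<^sub>1\<close>: on the common support \<open>[-R, R]\<close> of \<open>U\<close>
and \<open>V\<close> the perturbation has size \<open>\<epsilon>\<close>, and outside it is nonnegative of size \<open>\<epsilon>\<^sup>2\<close>, although its support
\<open>[-R / \<epsilon>, R / \<epsilon>]\<close> grows. The claim becomes: the roots \<open>\<kappa>\<close> are \<open>\<omega>\<^sub>k - \<epsilon> a\<^sub>k + O(\<epsilon>\<^sup>2)\<close>, one for each \<open>k\<close>, where
\<open>a\<^sub>k = (\<integral> U v\<^sub>k\<^sup>2) / (2 \<omega>\<^sub>k \<parallel>v\<^sub>k\<parallel>\<^sup>2)\<close>, and apart from them there are only roots with \<open>\<kappa> = O(\<epsilon>)\<close>, which give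
eigenvalues that stay bounded.

Eigenvalues are found by shooting. The potentials have compact support, so \<open>- \<kappa>\<^sup>2\<close> is an eigenvalue exactly if the
solution that equals a multiple of \<open>exp (\<kappa> y)\<close> far to the left decays on the right, that is, if the function
\<open>evans\<close> vanishes at \<open>\<kappa>\<close>. To have estimates that are uniform although the support grows, both decaying solutions are
normalised at the ends of \<open>[-R, R]\<close>. There the outer potential enters only through the logarithmic slopes of these
solutions, and comparison (\<open>left_positive\<close>) puts the slopes into \<open>[\<kappa>, \<kappa> + O(\<epsilon>)]\<close>, and even into
\<open>[\<kappa>, \<kappa> + O(\<epsilon>\<^sup>2)]\<close> if \<open>\<kappa>\<close> stays away from \<open>0\<close>; this is where \<open>W \<ge> 0\<close> enters.

Let \<open>\<kappa>\<^sub>0 \<ge> 0\<close> be a root of the unperturbed problem with solution \<open>v\<close>. Green's identity on \<open>[-R, R]\<close> between \<open>v\<close> and the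
perturbed solution at \<open>\<kappa>\<close> shows (\<open>expansion\<close>) that the perturbed shooting function, up to a nonzero factor, is
\<open>(\<kappa> - \<kappa>\<^sub>0) b + \<epsilon> \<integral> U v\<^sup>2\<close> with an error of second order, where \<open>b = 1 + v(R)\<^sup>2 + 2 \<kappa>\<^sub>0 \<integral> v\<^sup>2 \<ge> 1\<close>. By this
formula the shooting function changes sign near \<open>\<omega>\<^sub>k\<close>, so a root exists, and the root has the stated expansion because
\<open>b = 2 \<omega>\<^sub>k \<parallel>v\<^sub>k\<parallel>\<^sup>2\<close>. If \<open>\<kappa>\<^sub>0 = 0\<close> is a root (a resonance at the threshold), then \<open>b \<ge> 1\<close> still holds and forces
\<open>\<kappa> = O(\<epsilon>)\<close>. Two roots near the same \<open>\<omega>\<^sub>k\<close> would have orthogonal eigenfunctions that are both close to \<open>v\<^sub>k\<close>, which is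
absurd. Compactness excludes roots elsewhere. The result is \<open>evans_roots\<close>.

The link to the operators is \<open>scaled_eigenfunction_iff_evans_zero\<close>. It rests on a regularity theorem for weak
solutions, which is the lemma of du Bois-Reymond applied to the first and the second weak derivative. Finally, the
eigenfunctions decay like \<open>exp (- \<kappa> \<bar>x\<bar> / \<epsilon>)\<close> away from the origin, so their mass concentrates at a point and they
tend weakly to \<open>0\<close>.\<close>

section \<open>Primitives of locally bounded functions\<close>

text \<open>Measurability is part of the notion: it makes products of such functions integrable on compact intervals.\<close>
definition locally_bounded :: "(real \<Rightarrow> real) \<Rightarrow> bool" where
  "locally_bounded f \<longleftrightarrow> f \<in> borel_measurable borel \<and> (\<forall>a b. \<exists>M. \<forall>x\<in>{a..b}. \<bar>f x\<bar> \<le> M)"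

text \<open>The calculus of absolutely continuous functions with locally bounded derivative. Only integrals of \<open>f\<close> occur, so
nothing has to be said about points where \<open>F\<close> is differentiable.\<close>
definition primitive :: "(real \<Rightarrow> real) \<Rightarrow> (real \<Rightarrow> real) \<Rightarrow> bool" where
  "primitive f F \<longleftrightarrow> locally_bounded f \<and> (\<forall>a b. a \<le> b \<longrightarrow> (f has_integral (F b - F a)) {a..b})"

lemma locally_bounded_bound: "locally_bounded f \<Longrightarrow> \<exists>M\<ge>0. \<forall>x\<in>{a..b}. \<bar>f x\<bar> \<le> M"
proof -
  assume "locally_bounded f"
  then obtain M where "\<forall>x\<in>{a..b}. \<bar>f x\<bar> \<le> M" unfolding locally_bounded_def by blast
  then show ?thesis by (intro exI[of _ "max M 0"]) (auto simp: le_max_iff_disj)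
qed

lemma locally_bounded_continuous: assumes "continuous_on UNIV f" shows "locally_bounded f"
  unfolding locally_bounded_def
proof (intro conjI allI)
  show "f \<in> borel_measurable borel" using assms by (rule borel_measurable_continuous_onI)
  fix a b :: real
  have "bounded (f ` {a..b})"
    by (intro compact_imp_bounded compact_continuous_image continuous_on_subset[OF assms]) auto
  then show "\<exists>M. \<forall>x\<in>{a..b}. \<bar>f x\<bar> \<le> M" unfolding bounded_iff by auto
qed

lemma locally_bounded_bounded: "f \<in> borel_measurable borel \<Longrightarrow> (\<And>x. \<bar>f x\<bar> \<le> M) \<Longrightarrow> locally_bounded f"
  unfolding locally_bounded_def by auto

lemma locally_bounded_add: assumes "locally_bounded f" "locally_bounded g" shows "locally_bounded (\<lambda>x. f x + g x)"
  unfolding locally_bounded_def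
proof (intro conjI allI)
  show "(\<lambda>x. f x + g x) \<in> borel_measurable borel" using assms by (auto simp: locally_bounded_def)
  fix a b
  obtain M N where "\<forall>x\<in>{a..b}. \<bar>f x\<bar> \<le> M" "\<forall>x\<in>{a..b}. \<bar>g x\<bar> \<le> N"
    using locally_bounded_bound[OF assms(1)] locally_bounded_bound[OF assms(2)] by meson
  then show "\<exists>M. \<forall>x\<in>{a..b}. \<bar>f x + g x\<bar> \<le> M"
    by (intro exI[of _ "M + N"]) (force intro: order_trans[OF abs_triangle_ineq])
qed

lemma locally_bounded_mult: assumes "locally_bounded f" "locally_bounded g" shows "locally_bounded (\<lambda>x. f x * g x)"
  unfolding locally_bounded_def
proof (intro conjI allI)
  show "(\<lambda>x. f x * g x) \<in> borel_measurable borel" using assms by (auto simp: locally_bounded_def)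
  fix a b
  obtain M N where "M \<ge> 0" "\<forall>x\<in>{a..b}. \<bar>f x\<bar> \<le> M" "\<forall>x\<in>{a..b}. \<bar>g x\<bar> \<le> N"
    using locally_bounded_bound[OF assms(1)] locally_bounded_bound[OF assms(2)] by meson
  then show "\<exists>M. \<forall>x\<in>{a..b}. \<bar>f x * g x\<bar> \<le> M"
    by (intro exI[of _ "M * N"]) (auto simp: abs_mult intro!: mult_mono)
qed

lemma locally_bounded_const: "locally_bounded (\<lambda>x. c)"
  by (intro locally_bounded_continuous continuous_intros)

lemma locally_bounded_diff: "locally_bounded f \<Longrightarrow> locally_bounded g \<Longrightarrow> locally_bounded (\<lambda>x. f x - g x)"
  using locally_bounded_add[of f "\<lambda>x. (-1) * g x"] locally_bounded_mult[OF locally_bounded_const[of "-1"], of g] by simp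

lemma locally_bounded_affine: assumes "locally_bounded f" shows "locally_bounded (\<lambda>x. f (c * x + d))"
  unfolding locally_bounded_def
proof (intro conjI allI)
  have "f \<in> borel_measurable borel" using assms by (auto simp: locally_bounded_def)
  then show "(\<lambda>x. f (c * x + d)) \<in> borel_measurable borel" by measurable
  fix a b
  obtain M where M: "\<forall>x\<in>{min (c*a+d) (c*b+d)..max (c*a+d) (c*b+d)}. \<bar>f x\<bar> \<le> M"
    using locally_bounded_bound[OF assms] by meson
  have "c * x + d \<in> {min (c*a+d) (c*b+d)..max (c*a+d) (c*b+d)}" if "x \<in> {a..b}" for x
    using that by (cases "c \<ge> 0") (auto simp: min_le_iff_disj le_max_iff_disj mult_left_mono mult_left_mono_neg)
  then show "\<exists>M. \<forall>x\<in>{a..b}. \<bar>f (c*x+d)\<bar> \<le> M" using M by blast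
qed

lemma locally_bounded_integrable:
  assumes "locally_bounded f" shows "f integrable_on {a..b}"
proof -
  obtain M where M: "\<forall>x\<in>{a..b}. \<bar>f x\<bar> \<le> M" using locally_bounded_bound[OF assms] by meson
  have "f \<in> borel_measurable (lebesgue_on {a..b})"
    using assms by (auto simp: locally_bounded_def intro!: measurable_restrict_space1 measurable_completion)
  then show ?thesis
    by (rule measurable_bounded_by_integrable_imp_integrable[where g="\<lambda>x. M"])
       (use M in auto)
qed

lemma primitive_bound:
  assumes "primitive f F" "a \<le> b" "\<And>x. x \<in> {a..b} \<Longrightarrow> \<bar>f x\<bar> \<le> M"
  shows "\<bar>F b - F a\<bar> \<le> M * (b - a)"
proof -
  have "0 \<le> M" using assms(2) assms(3)[of a] by auto
  then show ?thesis
  using has_integral_bound_spike_finite[of M "{}" f "F b - F a" a b] assms by (auto simp: primitive_def)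
qed

lemma primitive_locally_bounded: "primitive f F \<Longrightarrow> locally_bounded f" by (simp add: primitive_def)

lemma primitive_continuous:
  assumes "primitive f F" shows "continuous_on S F"
proof -
  have "isCont F x" for x
  proof -
    obtain M where "M \<ge> 0" and M: "\<And>y. y \<in> {x-1..x+1} \<Longrightarrow> \<bar>f y\<bar> \<le> M"
      using locally_bounded_bound[OF primitive_locally_bounded[OF assms]] by meson
    have L: "\<bar>F y - F x\<bar> \<le> M * \<bar>y - x\<bar>" if "y \<in> {x-1..x+1}" for y
    proof (cases "x \<le> y")
      case True
      then show ?thesis using primitive_bound[OF assms, of x y M] M that by auto
    next
      case False
      then show ?thesis using primitive_bound[OF assms, of y x M] M that by auto
    qed
    have "((\<lambda>y. F y - F x) \<longlongrightarrow> 0) (at x)"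
    proof (rule Lim_null_comparison)
      show "\<forall>\<^sub>F y in at x. norm (F y - F x) \<le> M * \<bar>y - x\<bar>"
        unfolding eventually_at by (intro exI[of _ 1]) (auto simp: dist_real_def intro!: L)
      show "((\<lambda>y. M * \<bar>y - x\<bar>) \<longlongrightarrow> 0) (at x)" by (auto intro!: tendsto_eq_intros)
    qed
    then show ?thesis unfolding isCont_def by (simp add: Lim_null[symmetric] LIM_zero_iff)
  qed
  then show ?thesis by (simp add: continuous_at_imp_continuous_on)
qed

lemma primitive_locally_bounded': "primitive f F \<Longrightarrow> locally_bounded F"
  by (intro locally_bounded_continuous primitive_continuous)

lemma primitive_const: "primitive (\<lambda>x. 0) (\<lambda>x. c)"
  by (auto simp: primitive_def locally_bounded_const)

lemma primitive_add:
  assumes "primitive f F" "primitive g G" shows "primitive (\<lambda>x. f x + g x) (\<lambda>x. F x + G x)"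
  unfolding primitive_def
proof (intro conjI allI impI)
  show "locally_bounded (\<lambda>x. f x + g x)" using assms by (intro locally_bounded_add primitive_locally_bounded)
  fix a b :: real assume "a \<le> b"
  then show "((\<lambda>x. f x + g x) has_integral F b + G b - (F a + G a)) {a..b}"
    using has_integral_add[of f "F b - F a" "{a..b}" g "G b - G a"] assms
    by (simp add: primitive_def algebra_simps)
qed

lemma primitive_cmult: "primitive f F \<Longrightarrow> primitive (\<lambda>x. c * f x) (\<lambda>x. c * F x)"
  unfolding primitive_def
  by (auto intro!: locally_bounded_mult locally_bounded_const has_integral_mult_right simp flip: right_diff_distrib)

lemma primitive_diff: "primitive f F \<Longrightarrow> primitive g G \<Longrightarrow> primitive (\<lambda>x. f x - g x) (\<lambda>x. F x - G x)"
  using primitive_add[of f F "\<lambda>x. (-1) * g x" "\<lambda>x. (-1) * G x"] primitive_cmult[of g G "-1"] by simp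

lemma primitive_deriv:
  assumes "\<And>x. (F has_real_derivative f x) (at x)" "locally_bounded f"
  shows "primitive f F"
  unfolding primitive_def
proof (intro conjI allI impI)
  fix a b :: real assume ab: "a \<le> b"
  show "(f has_integral (F b - F a)) {a..b}"
  proof (rule fundamental_theorem_of_calculus[OF ab])
    fix x show "(F has_vector_derivative f x) (at x within {a..b})"
      using has_field_derivative_at_within[OF assms(1)[of x]]
      by (simp add: has_real_derivative_iff_has_vector_derivative)
  qed
qed (rule assms)

lemma primitive_cong: "primitive f F \<Longrightarrow> (\<And>x. f x = g x) \<Longrightarrow> (\<And>x. F x = G x) \<Longrightarrow> primitive g G"
proof -
  assume a: "primitive f F" "\<And>x. f x = g x" "\<And>x. F x = G x"
  then have "f = g" "F = G" by auto
  then show ?thesis using a by simp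
qed

text \<open>Increments of second order give derivative zero at every point. In the product rule below this takes the place of
differentiation almost everywhere.\<close>
lemma quadratic_bound_imp_const:
  fixes \<Phi> :: "real \<Rightarrow> real"
  assumes ab: "a \<le> b" and q: "\<And>x y. a \<le> x \<Longrightarrow> x \<le> y \<Longrightarrow> y \<le> b \<Longrightarrow> \<bar>\<Phi> y - \<Phi> x\<bar> \<le> C * (y - x)\<^sup>2"
  shows "\<Phi> b = \<Phi> a"
proof (cases "a = b")
  case False
  then have ab: "a < b" using ab by simp
  have C: "0 \<le> C" using q[of a b] ab by (smt (verit) zero_le_mult_iff zero_less_power)
  have "(\<Phi> has_real_derivative 0) (at x within {a..b})" if x: "x \<in> {a..b}" for x
    unfolding has_field_derivative_iff
  proof (rule Lim_null_comparison)
    show "\<forall>\<^sub>F y in at x within {a..b}. norm ((\<Phi> y - \<Phi> x) / (y - x)) \<le> C * \<bar>y - x\<bar>"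
      unfolding eventually_at
    proof (intro exI[of _ 1] conjI ballI impI)
      fix y assume y: "y \<in> {a..b}" "y \<noteq> x \<and> dist y x < 1"
      have "\<bar>\<Phi> y - \<Phi> x\<bar> \<le> C * (y - x)\<^sup>2"
        using q[of x y] q[of y x] x y by (cases "x \<le> y") (auto simp: power2_commute abs_minus_commute)
      also have "\<dots> = C * \<bar>y - x\<bar> * \<bar>y - x\<bar>" by (simp add: power2_eq_square abs_mult_self_eq)
      finally show "norm ((\<Phi> y - \<Phi> x) / (y - x)) \<le> C * \<bar>y - x\<bar>"
        using y by (simp add: abs_divide field_simps)
    qed simp
    show "((\<lambda>y. C * \<bar>y - x\<bar>) \<longlongrightarrow> 0) (at x within {a..b})" by (auto intro!: tendsto_eq_intros)
  qed
  then obtain c where "\<And>x. x \<in> {a..b} \<Longrightarrow> \<Phi> x = c"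
    using has_field_derivative_zero_constant[of "{a..b}" \<Phi>] by auto
  then show ?thesis using ab by simp
qed simp

text \<open>Integration by parts. The defect \<open>\<Phi>\<close> of the formula satisfies
\<open>\<Phi> y - \<Phi> x = \<integral> f t (G y - G t) - (F t - F x) g t dt\<close> over \<open>[x, y]\<close>. Both differences are of size \<open>y - x\<close>, hence the
integral is of second order and \<open>\<Phi>\<close> is constant.\<close>
lemma primitive_mult:
  assumes f: "primitive f F" and g: "primitive g G"
  shows "primitive (\<lambda>x. f x * G x + F x * g x) (\<lambda>x. F x * G x)"
  unfolding primitive_def
proof (intro conjI allI impI)
  let ?h = "\<lambda>x. f x * G x + F x * g x"
  show lb: "locally_bounded ?h" using assms by (intro locally_bounded_add locally_bounded_mult) (auto intro: primitive_locally_bounded primitive_locally_bounded')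
  fix a b :: real assume ab: "a \<le> b"
  obtain M N where MN: "M \<ge> 0" "\<And>x. x \<in> {a..b} \<Longrightarrow> \<bar>f x\<bar> \<le> M" "N \<ge> 0" "\<And>x. x \<in> {a..b} \<Longrightarrow> \<bar>g x\<bar> \<le> N"
    using locally_bounded_bound[OF primitive_locally_bounded[OF f]] locally_bounded_bound[OF primitive_locally_bounded[OF g]] by meson
  define \<Phi> where "\<Phi> x = F x * G x - integral {a..x} ?h" for x
  have "\<bar>\<Phi> y - \<Phi> x\<bar> \<le> 2 * (M * N) * (y - x)\<^sup>2" if xy: "a \<le> x" "x \<le> y" "y \<le> b" for x y
  proof -
    have "integral {a..y} ?h = integral {a..x} ?h + integral {x..y} ?h"
      using xy by (intro Henstock_Kurzweil_Integration.integral_combine[symmetric] locally_bounded_integrable lb) auto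
    moreover have "((\<lambda>t. f t * G y + F x * g t) has_integral ((F y - F x) * G y + F x * (G y - G x))) {x..y}"
      using f g xy by (intro has_integral_add has_integral_mult_right has_integral_mult_left) (auto simp: primitive_def)
    moreover have "(?h has_integral integral {x..y} ?h) {x..y}"
      using locally_bounded_integrable[OF lb] by (simp add: has_integral_integral)
    ultimately have I: "((\<lambda>t. (f t * G y + F x * g t) - ?h t) has_integral (\<Phi> y - \<Phi> x)) {x..y}"
      using has_integral_diff[of "\<lambda>t. f t * G y + F x * g t" "(F y - F x) * G y + F x * (G y - G x)" "{x..y}"
          ?h "integral {x..y} ?h"]
      by (simp add: \<Phi>_def algebra_simps)
    have "norm (\<Phi> y - \<Phi> x) \<le> (2 * (M * N) * (y - x)) * measure lborel (cbox x y)"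
    proof (rule has_integral_bound_spike_finite[where S="{}"])
      show "0 \<le> 2 * (M * N) * (y - x)" using MN xy by auto
      show "((\<lambda>t. (f t * G y + F x * g t) - ?h t) has_integral (\<Phi> y - \<Phi> x)) (cbox x y)"
        using I by simp
      show "finite {}" by simp
      fix t assume "t \<in> cbox x y - {}"
      then have t: "x \<le> t" "t \<le> y" by auto
      have "\<bar>G y - G t\<bar> \<le> N * (y - t)" using t xy MN by (intro primitive_bound[OF g]) auto
      also have "\<dots> \<le> N * (y - x)" using t MN by (intro mult_left_mono) auto
      finally have 1: "\<bar>f t * (G y - G t)\<bar> \<le> M * (N * (y - x))"
        unfolding abs_mult using t xy MN by (intro mult_mono) auto
      have "\<bar>F t - F x\<bar> \<le> M * (t - x)" using t xy MN by (intro primitive_bound[OF f]) auto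
      also have "\<dots> \<le> M * (y - x)" using t MN by (intro mult_left_mono) auto
      finally have 2: "\<bar>(F t - F x) * g t\<bar> \<le> (M * (y - x)) * N"
        unfolding abs_mult using t xy MN by (intro mult_mono) auto
      have "(f t * G y + F x * g t) - ?h t = f t * (G y - G t) - (F t - F x) * g t"
        by (simp add: algebra_simps)
      then show "norm ((f t * G y + F x * g t) - ?h t) \<le> 2 * (M * N) * (y - x)"
        using 1 2 by (simp add: algebra_simps)
    qed
    then show ?thesis using xy by (simp add: power2_eq_square mult.assoc)
  qed
  then have "\<Phi> b = \<Phi> a" using ab by (intro quadratic_bound_imp_const) auto
  then have "integral {a..b} ?h = F b * G b - F a * G a" by (simp add: \<Phi>_def)
  then show "(?h has_integral F b * G b - F a * G a) {a..b}"
    using locally_bounded_integrable[OF lb, of a b] by (metis has_integral_integral)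
qed

lemma primitive_mono: "primitive f F \<Longrightarrow> a \<le> b \<Longrightarrow> (\<And>x. x \<in> {a..b} \<Longrightarrow> 0 \<le> f x) \<Longrightarrow> F a \<le> F b"
  using has_integral_nonneg[of f "F b - F a" "{a..b}"] by (auto simp: primitive_def)

lemma primitive_antimono: "primitive f F \<Longrightarrow> a \<le> b \<Longrightarrow> (\<And>x. x \<in> {a..b} \<Longrightarrow> f x \<le> 0) \<Longrightarrow> F b \<le> F a"
  using primitive_mono[OF primitive_cmult[of f F "-1"], of a b] by simp

lemma primitive_zero: "primitive f F \<Longrightarrow> a \<le> b \<Longrightarrow> (\<And>x. x \<in> {a..b} \<Longrightarrow> f x = 0) \<Longrightarrow> F b = F a"
  using primitive_mono[of f F a b] primitive_antimono[of f F a b] by simp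

lemma primitive_affine:
  assumes "primitive f F"
  shows "primitive (\<lambda>x. c * f (c * x + d)) (\<lambda>x. F (c * x + d))"
  unfolding primitive_def
proof (intro conjI allI impI)
  show "locally_bounded (\<lambda>x. c * f (c * x + d))" using assms by (intro locally_bounded_mult locally_bounded_const locally_bounded_affine primitive_locally_bounded)
  fix a b :: real assume ab: "a \<le> b"
  consider "c = 0" | "c > 0" | "c < 0" by linarith
  then show "((\<lambda>x. c * f (c * x + d)) has_integral F (c * b + d) - F (c * a + d)) {a..b}"
  proof cases
    case 2
    have "(f has_integral (F (c*b+d) - F (c*a+d))) (cbox (c*a+d) (c*b+d))"
      using assms 2 ab by (auto simp: primitive_def)
    moreover have "(\<lambda>x. (1 / c) *\<^sub>R x + - ((1 / c) *\<^sub>R d)) ` cbox (c*a+d) (c*b+d) = {a..b}"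
      using 2 ab image_affinity_atLeastAtMost[of "1/c" "-d/c" "c*a+d" "c*b+d"] by (auto simp: field_simps)
    ultimately have "((\<lambda>x. f (c * x + d)) has_integral (F (c*b+d) - F (c*a+d)) / c) {a..b}"
      using has_integral_affinity[of f "F (c*b+d) - F (c*a+d)" "c*a+d" "c*b+d" c d] 2 by simp
    from has_integral_mult_right[OF this, of c] 2 show ?thesis by simp
  next
    case 3
    have "(f has_integral (F (c*a+d) - F (c*b+d))) (cbox (c*b+d) (c*a+d))"
      using assms 3 ab by (auto simp: primitive_def)
    moreover have "(\<lambda>x. (1 / c) *\<^sub>R x + - ((1 / c) *\<^sub>R d)) ` cbox (c*b+d) (c*a+d) = {a..b}"
      using 3 ab image_affinity_atLeastAtMost[of "1/c" "-d/c" "c*b+d" "c*a+d"] by (auto simp: field_simps)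
    ultimately have "((\<lambda>x. f (c * x + d)) has_integral (F (c*a+d) - F (c*b+d)) / (-c)) {a..b}"
      using has_integral_affinity[of f "F (c*a+d) - F (c*b+d)" "c*b+d" "c*a+d" c d] 3 by simp
    from has_integral_mult_right[OF this, of c] 3 show ?thesis by (simp add: minus_divide_right[symmetric])
  qed auto
qed

text \<open>One of the two integrals vanishes, depending on the sign of \<open>x\<close>; the difference is the integral from \<open>0\<close> to \<open>x\<close>
with orientation.\<close>
definition antideriv :: "(real \<Rightarrow> real) \<Rightarrow> real \<Rightarrow> real" where
  "antideriv f x = integral {0..x} f - integral {x..0} f"

lemma antideriv_diff:
  assumes "\<And>a b. f integrable_on {a..b}" "a \<le> b"
  shows "antideriv f b - antideriv f a = integral {a..b} f"
proof -
  note I = Henstock_Kurzweil_Integration.integral_combine[OF _ _ assms(1)]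
  have n: "integral {x..y} f = 0" if "y \<le> x" for x y
    using that by (cases "x = y") auto
  consider "0 \<le> a" | "a < 0" "0 \<le> b" | "b < 0" by linarith
  then show ?thesis
  proof cases
    case 1
    then show ?thesis using I[of 0 a b] n[of 0 a] n[of 0 b] assms(2) by (auto simp: antideriv_def)
  next
    case 2
    then show ?thesis using I[of a 0 b] n[of a 0] n[of 0 b] n[of b 0] n[of 0 a] assms(2) by (auto simp: antideriv_def)
  next
    case 3
    then show ?thesis using I[of a b 0] n[of b 0] n[of a 0] n[of 0 a] n[of 0 b] assms(2) by (auto simp: antideriv_def)
  qed
qed

lemma antideriv_0 [simp]: "antideriv f 0 = 0" by (simp add: antideriv_def)

lemma primitive_antideriv: assumes "locally_bounded f" shows "primitive f (antideriv f)"
  unfolding primitive_def using assms antideriv_diff[OF locally_bounded_integrable[OF assms]] locally_bounded_integrable[OF assms]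
  by (simp add: has_integral_integral[symmetric])

section \<open>The equation y'' = q y with bounded measurable q\<close>

text \<open>Here \<open>p\<close> is the derivative of \<open>y\<close>: the pair is a Caratheodory solution of \<open>y'' = q y\<close>, for \<open>q\<close> merely measurable and
locally bounded.\<close>
definition solves :: "(real \<Rightarrow> real) \<Rightarrow> (real \<Rightarrow> real) \<Rightarrow> (real \<Rightarrow> real) \<Rightarrow> bool" where
  "solves q y p \<longleftrightarrow> locally_bounded q \<and> primitive p y \<and> primitive (\<lambda>x. q x * y x) p"

lemma solvesD:
  assumes "solves q y p"
  shows "locally_bounded q" "primitive p y" "primitive (\<lambda>x. q x * y x) p" "continuous_on S y" "continuous_on S p" "locally_bounded y" "locally_bounded p"
  using assms by (auto simp: solves_def intro: primitive_continuous primitive_locally_bounded primitive_locally_bounded')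

text \<open>Translations, reflections and the stretching by \<open>\<epsilon>\<close> are all instances.\<close>
lemma solves_affine:
  assumes "solves q y p"
  shows "solves (\<lambda>x. c\<^sup>2 * q (c * x + d)) (\<lambda>x. y (c * x + d)) (\<lambda>x. c * p (c * x + d))"
  unfolding solves_def
proof (intro conjI)
  show "locally_bounded (\<lambda>x. c\<^sup>2 * q (c * x + d))" using assms by (intro locally_bounded_mult locally_bounded_const locally_bounded_affine solvesD)
  show "primitive (\<lambda>x. c * p (c * x + d)) (\<lambda>x. y (c * x + d))"
    using assms by (intro primitive_affine solvesD)
  show "primitive (\<lambda>x. c\<^sup>2 * q (c * x + d) * y (c * x + d)) (\<lambda>x. c * p (c * x + d))"
    by (rule primitive_cong[OF primitive_cmult[OF primitive_affine[OF solvesD(3)[OF assms]], of c c d]])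
      (auto simp: power2_eq_square)
qed

lemma solves_reflect:
  "solves q y p \<Longrightarrow> solves (\<lambda>x. q (- x)) (\<lambda>x. y (- x)) (\<lambda>x. - p (- x))"
  using solves_affine[of q y p "-1" 0] by simp

lemma solves_cmult: "solves q y p \<Longrightarrow> solves q (\<lambda>x. c * y x) (\<lambda>x. c * p x)"
  unfolding solves_def using primitive_cmult[of p y c] primitive_cmult[of "\<lambda>x. q x * y x" p c]
  by (auto simp: mult.left_commute)

lemma solves_add: "solves q y p \<Longrightarrow> solves q z r \<Longrightarrow> solves q (\<lambda>x. y x + z x) (\<lambda>x. p x + r x)"
  unfolding solves_def using primitive_add[of p y r z] primitive_add[of "\<lambda>x. q x * y x" p "\<lambda>x. q x * z x" r]
  by (auto simp: distrib_left)

lemma solves_diff: "solves q y p \<Longrightarrow> solves q z r \<Longrightarrow> solves q (\<lambda>x. y x - z x) (\<lambda>x. p x - r x)"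
  using solves_add[of q y p "\<lambda>x. (-1) * z x" "\<lambda>x. (-1) * r x"] solves_cmult[of q z r "-1"] by simp

text \<open>Green's identity. For equal potentials it says that the Wronskian is constant; for different ones it yields the
orthogonality of eigenfunctions and the perturbation formula.\<close>
lemma solves_wronskian:
  assumes "solves q1 y1 p1" "solves q2 y2 p2"
  shows "primitive (\<lambda>x. (q1 x - q2 x) * (y1 x * y2 x)) (\<lambda>x. p1 x * y2 x - y1 x * p2 x)"
  by (rule primitive_cong[OF primitive_diff[OF primitive_mult primitive_mult,
        OF solvesD(3)[OF assms(1)] solvesD(2)[OF assms(2)] solvesD(2)[OF assms(1)] solvesD(3)[OF assms(2)]]])
    (auto simp: algebra_simps)

text \<open>A Gronwall estimate for \<open>d\<^sup>2 + e\<^sup>2\<close>, where \<open>d\<close> and \<open>e\<close> are the differences of the solutions and of their derivatives. From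
\<open>d' = e\<close> and \<open>e' = q1 d + (q1 - q2) y2\<close> its logarithmic growth rate is at most \<open>2 + M\<close>, apart from the source term.\<close>
lemma solves_dependence:
  assumes s1: "solves q1 y1 p1" and s2: "solves q2 y2 p2" and ax: "a \<le> x"
    and M: "0 \<le> M" "\<And>t. t \<in> {a..x} \<Longrightarrow> \<bar>q1 t\<bar> \<le> M"
    and r: "\<And>t. t \<in> {a..x} \<Longrightarrow> \<bar>(q1 t - q2 t) * y2 t\<bar> \<le> r"
  shows "(y1 x - y2 x)\<^sup>2 + (p1 x - p2 x)\<^sup>2 \<le>
     exp ((2 + M) * (x - a)) * ((y1 a - y2 a)\<^sup>2 + (p1 a - p2 a)\<^sup>2 + (x - a) * r\<^sup>2)"
proof -
  define d where "d t = y1 t - y2 t" for t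
  define e where "e t = p1 t - p2 t" for t
  define g where "g t = q1 t * d t + (q1 t - q2 t) * y2 t" for t
  define c where "c = 2 + M"
  have pd: "primitive e d" unfolding d_def[abs_def] e_def[abs_def] using s1 s2 by (intro primitive_diff solvesD)
  have pe: "primitive g e"
    by (rule primitive_cong[OF primitive_diff[OF solvesD(3)[OF s1] solvesD(3)[OF s2]]])
      (auto simp: g_def d_def e_def algebra_simps)
  have pE: "primitive (\<lambda>t. 2 * e t * (d t + g t)) (\<lambda>t. d t * d t + e t * e t)"
    by (rule primitive_cong[OF primitive_add[OF primitive_mult[OF pd pd] primitive_mult[OF pe pe]]]) (auto simp: algebra_simps)
  have px: "primitive (\<lambda>t. - c * exp (- c * (t - a))) (\<lambda>t. exp (- c * (t - a)))"
    by (rule primitive_deriv) (auto intro!: derivative_eq_intros locally_bounded_continuous continuous_intros)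
  have left_deriv: "primitive (\<lambda>t. r\<^sup>2) (\<lambda>t. r\<^sup>2 * (t - a))"
    by (rule primitive_deriv) (auto intro!: derivative_eq_intros locally_bounded_continuous continuous_intros)
  have pF: "primitive (\<lambda>t. (2 * e t * (d t + g t) - c * (d t * d t + e t * e t)) * exp (- c * (t - a)) - r\<^sup>2)
     (\<lambda>t. (d t * d t + e t * e t) * exp (- c * (t - a)) - r\<^sup>2 * (t - a))"
    by (rule primitive_cong[OF primitive_diff[OF primitive_mult[OF pE px] left_deriv]]) (auto simp: algebra_simps)
  have "(d x * d x + e x * e x) * exp (- c * (x - a)) - r\<^sup>2 * (x - a)
     \<le> (d a * d a + e a * e a) * exp (- c * (a - a)) - r\<^sup>2 * (a - a)"
  proof (rule primitive_antimono[OF pF ax])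
    fix t assume t: "t \<in> {a..x}"
    define R where "R = (q1 t - q2 t) * y2 t"
    have R: "R\<^sup>2 \<le> r\<^sup>2" using r[OF t] unfolding R_def by (metis abs_ge_zero power2_abs power_mono)
    have "2 * e t * (q1 t * d t) \<le> M * (d t * d t + e t * e t)"
    proof -
      have "2 * e t * (q1 t * d t) \<le> \<bar>q1 t\<bar> * (2 * \<bar>e t\<bar> * \<bar>d t\<bar>)"
        by (simp add: abs_mult[symmetric] algebra_simps)
      also have "\<dots> \<le> M * (2 * \<bar>e t\<bar> * \<bar>d t\<bar>)" using M t by (intro mult_right_mono) auto
      also have "\<dots> \<le> M * (d t * d t + e t * e t)"
        using M(1) sum_squares_bound[of "\<bar>e t\<bar>" "\<bar>d t\<bar>"] by (intro mult_left_mono) (auto simp: power2_eq_square)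
      finally show ?thesis .
    qed
    moreover have "2 * e t * R \<le> e t * e t + R\<^sup>2" "2 * e t * d t \<le> e t * e t + d t * d t"
      using sum_squares_bound[of "e t" R] sum_squares_bound[of "e t" "d t"] by (auto simp: power2_eq_square)
    moreover have "0 \<le> d t * d t" by simp
    moreover have "2 * e t * (d t + g t) = 2 * e t * d t + 2 * e t * (q1 t * d t) + 2 * e t * R"
      by (simp add: g_def R_def algebra_simps)
    moreover have "c * (d t * d t + e t * e t) = 2 * (d t * d t) + 2 * (e t * e t) + M * (d t * d t + e t * e t)"
      by (simp add: c_def distrib_right)
    ultimately have 1: "2 * e t * (d t + g t) - c * (d t * d t + e t * e t) \<le> r\<^sup>2"
      using R by argo
    have "0 \<le> c * (t - a)" using t M(1) by (intro mult_nonneg_nonneg) (auto simp: c_def)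
    then have ex: "exp (- c * (t - a)) \<le> 1" by simp
    have "(2 * e t * (d t + g t) - c * (d t * d t + e t * e t)) * exp (- c * (t - a)) \<le> r\<^sup>2 * exp (- c * (t - a))"
      using 1 by (intro mult_right_mono) auto
    also have "\<dots> \<le> r\<^sup>2 * 1" using ex by (intro mult_left_mono) auto
    finally show "(2 * e t * (d t + g t) - c * (d t * d t + e t * e t)) * exp (- c * (t - a)) - r\<^sup>2 \<le> 0" by simp
  qed
  then have "(d x * d x + e x * e x) * exp (- c * (x - a)) \<le> (d a * d a + e a * e a) + (x - a) * r\<^sup>2"
    by (simp add: algebra_simps)
  then have "(d x * d x + e x * e x) * exp (- c * (x - a)) * exp (c * (x - a)) \<le>
    ((d a * d a + e a * e a) + (x - a) * r\<^sup>2) * exp (c * (x - a))"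
    by (intro mult_right_mono) auto
  then have "d x * d x + e x * e x \<le> ((d a * d a + e a * e a) + (x - a) * r\<^sup>2) * exp (c * (x - a))"
    by (simp add: mult.assoc exp_add[symmetric])
  then show ?thesis by (simp add: d_def e_def c_def power2_eq_square mult.commute)
qed

lemma solves_unique:
  assumes "solves q y p" "solves q z r" "y a = z a" "p a = r a"
  shows "y x = z x" "p x = r x"
proof -
  have fwd: "y x = 0 \<and> p x = 0" if s: "solves q y p" "y a = 0" "p a = 0" "a \<le> x" for q y p a x
  proof -
    obtain M where "M \<ge> 0" "\<And>t. t \<in> {a..x} \<Longrightarrow> \<bar>q t\<bar> \<le> M"
      using locally_bounded_bound[OF solvesD(1)[OF s(1)]] by meson
    moreover have "solves q (\<lambda>x. 0) (\<lambda>x. 0)" using solves_cmult[OF s(1), of 0] by simp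
    ultimately have "(y x - 0)\<^sup>2 + (p x - 0)\<^sup>2 \<le> 0"
      using solves_dependence[of q y p q "\<lambda>x. 0" "\<lambda>x. 0" a x M 0] s by simp
    then show ?thesis by (simp add: sum_power2_le_zero_iff)
  qed
  have "y x - z x = 0 \<and> p x - r x = 0"
  proof (cases "a \<le> x")
    case True
    then show ?thesis using fwd[OF solves_diff[OF assms(1,2)], of a x] assms(3,4) by simp
  next
    case False
    then show ?thesis using fwd[OF solves_reflect[OF solves_diff[OF assms(1,2)]], of "-a" "-x"] assms(3,4) by simp
  qed
  then show "y x = z x" "p x = r x" by auto
qed

text \<open>Integration gains the factor \<open>1 / L\<close> in the norm with weight \<open>exp (- L \<bar>x\<bar>)\<close>.\<close>
lemma antideriv_exp_bound:
  assumes F: "primitive f F" and F0: "F 0 = 0" and f: "\<And>t. \<bar>f t\<bar> \<le> c * exp (L * \<bar>t\<bar>)" and L: "L > 0"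
  shows "\<bar>F x\<bar> \<le> c / L * exp (L * \<bar>x\<bar>)"
proof -
  have pos: "F x \<le> c / L * exp (L * x)" if F: "primitive f F" "F 0 = 0" and f: "\<And>t. \<bar>f t\<bar> \<le> c * exp (L * \<bar>t\<bar>)"
     and x: "x \<ge> 0" for f F x
  proof -
    have "0 \<le> c" using f[of 0] by simp
    have "primitive (\<lambda>t. c * exp (L * t)) (\<lambda>t. c / L * exp (L * t))"
      using L by (intro primitive_deriv) (auto intro!: derivative_eq_intros locally_bounded_continuous continuous_intros)
    then have "c / L * exp (L * 0) - F 0 \<le> c / L * exp (L * x) - F x"
    proof (rule primitive_mono[OF primitive_diff[OF _ F(1)] x])
      fix t assume "t \<in> {0..x}"
      then show "0 \<le> c * exp (L * t) - f t" using f[of t] by auto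
    qed
    moreover have "0 \<le> c / L" using \<open>0 \<le> c\<close> L by simp
    ultimately show ?thesis using F(2) by simp
  qed
  have nm: "F x \<le> c / L * exp (L * \<bar>x\<bar>)" if F: "primitive f F" "F 0 = 0" and f: "\<And>t. \<bar>f t\<bar> \<le> c * exp (L * \<bar>t\<bar>)" for f F
  proof (cases "x \<ge> 0")
    case True
    then show ?thesis using pos[OF F f] by simp
  next
    case False
    have "primitive (\<lambda>t. - f (-t)) (\<lambda>t. F (- t))" using primitive_affine[OF F(1), of "-1" 0] by simp
    moreover have "\<bar>- f (- t)\<bar> \<le> c * exp (L * \<bar>t\<bar>)" for t using f[of "-t"] by simp
    ultimately show ?thesis using pos[of "\<lambda>t. - f (-t)" "\<lambda>t. F (-t)" "-x"] F(2) False by simp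
  qed
  have "\<bar>-1 * f t\<bar> \<le> c * exp (L * \<bar>t\<bar>)" for t using f[of t] by simp
  from nm[OF primitive_cmult[OF F, of "-1"] _ this] F0 have "- F x \<le> c / L * exp (L * \<bar>x\<bar>)" by simp
  then show ?thesis using nm[OF F F0 f] by simp
qed

text \<open>Picard iteration on the whole line at once. Divided by the weight \<open>E x = exp (L \<bar>x\<bar>)\<close>, the Volterra equation
\<open>y x = \<alpha> + \<beta> x + \<integral> \<integral> q y\<close> is a fixed point equation for bounded continuous functions; two integrations give the
contraction factor \<open>M / L\<^sup>2\<close>, which is below \<open>1\<close> for \<open>L = M + 1\<close>.\<close>
lemma solves_exists_at_0:
  assumes q: "q \<in> borel_measurable borel" "\<And>x. \<bar>q x\<bar> \<le> M"
  shows "\<exists>y p. solves q y p \<and> y 0 = \<alpha> \<and> p 0 = \<beta>"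
proof -
  define L where "L = M + 1"
  have M0: "M \<ge> 0" using q(2)[of 0] by simp
  then have L: "L \<ge> 1" by (simp add: L_def)
  have lq: "locally_bounded q" using q by (rule locally_bounded_bounded)
  define E where "E x = exp (L * \<bar>x\<bar>)" for x
  define A where "A f = antideriv (antideriv f)" for f
  define h where "h w x = q x * (E x * w x)" for w x
  define T where "T w x = (\<alpha> + \<beta> * x + A (h w) x) / E x" for w x
  have Epos: "E x > 0" for x by (simp add: E_def)
  have Ege: "E x \<ge> 1" for x using L by (simp add: E_def)
  have Econt: "continuous_on UNIV E" unfolding E_def by (intro continuous_intros)
  have lh: "locally_bounded (h w)" if "continuous_on UNIV w" for w
    unfolding h_def[abs_def] using that Econt by (intro locally_bounded_mult lq locally_bounded_continuous)
  have hb: "\<bar>h w t\<bar> \<le> (M * b) * exp (L * \<bar>t\<bar>)" if "\<And>x. \<bar>w x\<bar> \<le> b" for w b t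
  proof -
    have "\<bar>h w t\<bar> = (\<bar>q t\<bar> * \<bar>w t\<bar>) * exp (L * \<bar>t\<bar>)" by (simp add: h_def abs_mult E_def)
    also have "\<dots> \<le> (M * b) * exp (L * \<bar>t\<bar>)"
      using q(2) that M0 by (intro mult_right_mono mult_mono) auto
    finally show ?thesis .
  qed
  have pA: "primitive (h w) (antideriv (h w))" "primitive (antideriv (h w)) (A (h w))" if "continuous_on UNIV w" for w
    using primitive_antideriv[OF lh[OF that]] primitive_antideriv[OF primitive_locally_bounded'[OF primitive_antideriv[OF lh[OF that]]]]
    by (auto simp: A_def)
  have Tc: "continuous_on UNIV (T w)" if "continuous_on UNIV w" for w
    unfolding T_def[abs_def] using Epos
    by (intro continuous_intros Econt primitive_continuous[OF pA(2)[OF that]]) (metis less_irrefl)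
  have D: "\<bar>T w x - T z x\<bar> \<le> M / L\<^sup>2 * b"
    if c: "continuous_on UNIV w" "continuous_on UNIV z" and b: "\<And>x. \<bar>w x - z x\<bar> \<le> b" for w z x b
  proof -
    have "primitive (h (\<lambda>x. w x - z x)) (\<lambda>x. antideriv (h w) x - antideriv (h z) x)"
      by (rule primitive_cong[OF primitive_diff[OF pA(1)[OF c(1)] pA(1)[OF c(2)]]]) (auto simp: h_def algebra_simps)
    from antideriv_exp_bound[OF this, of "M * b" L] hb[of "\<lambda>x. w x - z x", OF b] L
    have 1: "\<bar>antideriv (h w) x - antideriv (h z) x\<bar> \<le> (M * b / L) * exp (L * \<bar>x\<bar>)" for x by simp
    have "\<bar>A (h w) x - A (h z) x\<bar> \<le> (M * b / L) / L * exp (L * \<bar>x\<bar>)"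
      using antideriv_exp_bound[OF primitive_diff[OF pA(2)[OF c(1)] pA(2)[OF c(2)]], of "M * b / L" L] 1 L
      by (simp add: A_def)
    then have "\<bar>(A (h w) x - A (h z) x) / E x\<bar> \<le> M * b / L / L"
      using Epos[of x] by (simp add: abs_divide pos_divide_le_eq E_def)
    moreover have "T w x - T z x = (A (h w) x - A (h z) x) / E x"
      by (simp add: T_def diff_divide_distrib[symmetric])
    ultimately show ?thesis by (simp add: power2_eq_square)
  qed
  have lin: "\<bar>\<alpha> + \<beta> * x\<bar> / E x \<le> \<bar>\<alpha>\<bar> + \<bar>\<beta>\<bar>" for x
  proof -
    have "\<bar>x\<bar> \<le> L * \<bar>x\<bar>" using L mult_right_mono[of 1 L "\<bar>x\<bar>"] by simp
    then have "\<bar>x\<bar> \<le> E x" unfolding E_def using exp_ge_add_one_self[of "L * \<bar>x\<bar>"] by linarith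
    then have "\<bar>\<beta> * x\<bar> \<le> \<bar>\<beta>\<bar> * E x" unfolding abs_mult by (intro mult_left_mono) auto
    moreover have "\<bar>\<alpha>\<bar> * 1 \<le> \<bar>\<alpha>\<bar> * E x" using Ege by (intro mult_left_mono) auto
    ultimately have "\<bar>\<alpha> + \<beta> * x\<bar> \<le> (\<bar>\<alpha>\<bar> + \<bar>\<beta>\<bar>) * E x" by (simp add: distrib_right)
    then show ?thesis using Epos[of x] by (simp add: pos_divide_le_eq)
  qed
  have T0: "T (\<lambda>x. 0) x = (\<alpha> + \<beta> * x) / E x" for x
    by (simp add: T_def A_def h_def[abs_def] antideriv_def[abs_def])
  have Tb: "\<bar>T w x\<bar> \<le> \<bar>\<alpha>\<bar> + \<bar>\<beta>\<bar> + M / L\<^sup>2 * b" if c: "continuous_on UNIV w" and b: "\<And>x. \<bar>w x\<bar> \<le> b" for w b x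
    proof -
    have "\<bar>T w x - T (\<lambda>x. 0) x\<bar> \<le> M / L\<^sup>2 * b" using D[of w "\<lambda>x. 0" b x] c b by simp
    moreover have "\<bar>T (\<lambda>x. 0) x\<bar> \<le> \<bar>\<alpha>\<bar> + \<bar>\<beta>\<bar>"
      using lin[of x] Epos[of x] unfolding T0 by (simp add: abs_divide)
    ultimately show ?thesis by linarith
  qed
  define TT where "TT w = Bcontfun (T (apply_bcontfun w))" for w :: "real \<Rightarrow>\<^sub>C real"
  have TT: "apply_bcontfun (TT w) = T (apply_bcontfun w)" for w
    unfolding TT_def
  proof (rule Bcontfun_inverse)
    have c: "continuous_on UNIV (apply_bcontfun w)" by (simp add: continuous_on_apply_bcontfun)
    obtain b where b: "\<And>x. \<bar>apply_bcontfun w x\<bar> \<le> b"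
      using bounded_apply_bcontfun[of w] unfolding bounded_iff by auto
    show "T (apply_bcontfun w) \<in> bcontfun"
      unfolding bcontfun_def using Tc[OF c] Tb[OF c b] by (auto simp: bounded_iff)
  qed
  have "M < L\<^sup>2" using M0 by (simp add: L_def power2_eq_square algebra_simps) (smt (verit) mult_nonneg_nonneg)
  then have c1: "M / L\<^sup>2 < 1" using L by (simp add: divide_less_eq_1)
  have "\<exists>!w. TT w = w"
  proof (rule banach_fix_type[OF _ c1])
    show "0 \<le> M / L\<^sup>2" using M0 by simp
    show "\<forall>w z. dist (TT w) (TT z) \<le> M / L\<^sup>2 * dist w z"
    proof (intro allI dist_bound)
      fix w z :: "real \<Rightarrow>\<^sub>C real" and x
      have "\<bar>apply_bcontfun w x - apply_bcontfun z x\<bar> \<le> dist w z" for x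
        using dist_bounded[of w x z] by (simp add: dist_real_def)
      then show "dist (apply_bcontfun (TT w) x) (apply_bcontfun (TT z) x) \<le> M / L\<^sup>2 * dist w z"
        unfolding TT dist_real_def by (intro D continuous_on_apply_bcontfun)
    qed
  qed
  then obtain W where W: "TT W = W" by blast
  define w where "w = apply_bcontfun W"
  have wc: "continuous_on UNIV w" by (simp add: w_def continuous_on_apply_bcontfun)
  have w: "T w x = w x" for x using TT[of W] W by (simp add: w_def)
  define y where "y x = E x * w x" for x
  have y: "y x = \<alpha> + \<beta> * x + A (h w) x" for x
    using w[of x] Epos[of x] by (simp add: y_def T_def field_simps)
  have pab: "primitive (\<lambda>x. \<beta>) (\<lambda>x. \<alpha> + \<beta> * x)"
    by (rule primitive_deriv) (auto intro!: derivative_eq_intros locally_bounded_const)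
  have "primitive (\<lambda>x. \<beta> + antideriv (h w) x) y"
    by (rule primitive_cong[OF primitive_add[OF pab pA(2)[OF wc]]]) (auto simp: y)
  moreover have "primitive (\<lambda>x. q x * y x) (\<lambda>x. \<beta> + antideriv (h w) x)"
    by (rule primitive_cong[OF primitive_add[OF primitive_const[of \<beta>] pA(1)[OF wc]]]) (auto simp: y_def h_def)
  ultimately have "solves q y (\<lambda>x. \<beta> + antideriv (h w) x)" using lq by (simp add: solves_def)
  moreover have "y 0 = \<alpha>" by (simp add: y A_def)
  ultimately show ?thesis by (intro exI[of _ y] exI[of _ "\<lambda>x. \<beta> + antideriv (h w) x"]) auto
qed

lemma solves_exists:
  assumes q: "q \<in> borel_measurable borel" "\<And>x. \<bar>q x\<bar> \<le> M"
  shows "\<exists>y p. solves q y p \<and> y a = \<alpha> \<and> p a = \<beta>"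
proof -
  have "(\<lambda>x. q (x + a)) \<in> borel_measurable borel" using q(1) by measurable
  then obtain y p where s: "solves (\<lambda>x. q (x + a)) y p" "y 0 = \<alpha>" "p 0 = \<beta>"
    using solves_exists_at_0[of "\<lambda>x. q (x + a)" M \<alpha> \<beta>] q(2) by auto
  show ?thesis
    using solves_affine[OF s(1), of 1 "-a"] s(2,3)
    by (intro exI[of _ "\<lambda>x. y (x - a)"] exI[of _ "\<lambda>x. p (x - a)"]) simp
qed

section \<open>Shooting for the bound states of a potential well\<close>

text \<open>The energy estimate in the form used for comparisons on a fixed interval: linear in the differences of the data
and of the potentials.\<close>
lemma solves_close:
  assumes s1: "solves q1 y1 p1" and s2: "solves q2 y2 p2" and x: "x \<in> {a..b}"
    and M: "0 \<le> M" "\<And>t. t \<in> {a..b} \<Longrightarrow> \<bar>q1 t\<bar> \<le> M"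
    and d: "\<And>t. t \<in> {a..b} \<Longrightarrow> \<bar>q1 t - q2 t\<bar> \<le> d"
    and B: "\<And>t. t \<in> {a..b} \<Longrightarrow> \<bar>y2 t\<bar> \<le> B"
  shows "\<bar>y1 x - y2 x\<bar> \<le> exp ((2 + M) * (b - a)) * (\<bar>y1 a - y2 a\<bar> + \<bar>p1 a - p2 a\<bar> + (1 + (b - a)) * (d * B))"
    "\<bar>p1 x - p2 x\<bar> \<le> exp ((2 + M) * (b - a)) * (\<bar>y1 a - y2 a\<bar> + \<bar>p1 a - p2 a\<bar> + (1 + (b - a)) * (d * B))"
proof -
  define \<alpha> where "\<alpha> = \<bar>y1 a - y2 a\<bar>"
  define \<beta> where "\<beta> = \<bar>p1 a - p2 a\<bar>"
  define r where "r = d * B"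
  define l where "l = b - a"
  define E where "E = exp ((2 + M) * l)"
  have "0 \<le> d" "0 \<le> B" using d[OF x] B[OF x] by auto
  then have r0: "0 \<le> r" by (simp add: r_def)
  have l0: "0 \<le> l" "x - a \<le> l" using x by (auto simp: l_def)
  have E1: "1 \<le> E" using l0 M by (simp add: E_def)
  have ab0: "0 \<le> \<alpha>" "0 \<le> \<beta>" by (auto simp: \<alpha>_def \<beta>_def)
  have rb: "\<bar>(q1 t - q2 t) * y2 t\<bar> \<le> r" if "t \<in> {a..x}" for t
    unfolding abs_mult r_def using that x d[of t] B[of t] \<open>0 \<le> d\<close> by (intro mult_mono) auto
  have "(y1 x - y2 x)\<^sup>2 + (p1 x - p2 x)\<^sup>2 \<le> exp ((2 + M) * (x - a)) * (\<alpha>\<^sup>2 + \<beta>\<^sup>2 + (x - a) * r\<^sup>2)"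
    unfolding \<alpha>_def \<beta>_def power2_abs
    by (rule solves_dependence[OF s1 s2 _ M(1) _ rb]) (use M(2) x in auto)
  also have "\<dots> \<le> E * (\<alpha>\<^sup>2 + \<beta>\<^sup>2 + l * r\<^sup>2)"
    unfolding E_def using l0 M x by (intro mult_mono add_mono mult_right_mono) (auto intro!: mult_left_mono add_nonneg_nonneg)
  also have "\<dots> \<le> (E * (\<alpha> + \<beta> + (1 + l) * r))\<^sup>2"
  proof -
    have "\<alpha>\<^sup>2 + \<beta>\<^sup>2 + l * r\<^sup>2 \<le> (\<alpha> + \<beta> + (1 + l) * r)\<^sup>2"
    proof -
      have "l \<le> (1 + l)\<^sup>2" using l0 by (simp add: power2_eq_square algebra_simps)
      then have "l * r\<^sup>2 \<le> ((1 + l) * r)\<^sup>2" by (simp add: power_mult_distrib mult_right_mono)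
      moreover have "(\<alpha> + \<beta> + (1 + l) * r)\<^sup>2 = \<alpha>\<^sup>2 + \<beta>\<^sup>2 + ((1 + l) * r)\<^sup>2 + 2 * \<alpha> * \<beta> + 2 * (\<alpha> + \<beta>) * ((1 + l) * r)"
        by (simp add: power2_eq_square algebra_simps)
      moreover have "0 \<le> 2 * \<alpha> * \<beta> + 2 * (\<alpha> + \<beta>) * ((1 + l) * r)" using ab0 l0 r0 by auto
      ultimately show ?thesis by linarith
    qed
    moreover have "E \<le> E\<^sup>2" using E1 by (simp add: power2_eq_square)
    ultimately show ?thesis unfolding power_mult_distrib using E1 by (intro mult_mono) (auto simp: l0 ab0 r0)
  qed
  finally have *: "(y1 x - y2 x)\<^sup>2 + (p1 x - p2 x)\<^sup>2 \<le> (E * (\<alpha> + \<beta> + (1 + l) * r))\<^sup>2" .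
  have n: "0 \<le> E * (\<alpha> + \<beta> + (1 + l) * r)" using E1 ab0 l0 r0 by auto
  have "(y1 x - y2 x)\<^sup>2 \<le> (E * (\<alpha> + \<beta> + (1 + l) * r))\<^sup>2" "(p1 x - p2 x)\<^sup>2 \<le> (E * (\<alpha> + \<beta> + (1 + l) * r))\<^sup>2"
    using * by (smt (verit) zero_le_power2)+
  then show "\<bar>y1 x - y2 x\<bar> \<le> exp ((2 + M) * (b - a)) * (\<bar>y1 a - y2 a\<bar> + \<bar>p1 a - p2 a\<bar> + (1 + (b - a)) * (d * B))"
    "\<bar>p1 x - p2 x\<bar> \<le> exp ((2 + M) * (b - a)) * (\<bar>y1 a - y2 a\<bar> + \<bar>p1 a - p2 a\<bar> + (1 + (b - a)) * (d * B))"
    using n by (auto simp: abs_le_square_iff[symmetric] \<alpha>_def \<beta>_def r_def l_def E_def)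
qed

text \<open>A well inside \<open>[-R, R]\<close> followed by a weak nonnegative part of size \<open>\<eta>\<^sup>2\<close> that ends at \<open>S\<close>. Separate radii allow
bounds in terms of \<open>R\<close> and \<open>\<eta>\<close> only, while \<open>S = R / \<epsilon>\<close> tends to infinity.\<close>
definition well :: "(real \<Rightarrow> real) \<Rightarrow> real \<Rightarrow> real \<Rightarrow> real \<Rightarrow> real \<Rightarrow> bool" where
  "well q R S M \<eta> \<longleftrightarrow> q \<in> borel_measurable borel \<and> (\<forall>x. \<bar>q x\<bar> \<le> M) \<and> 0 < R \<and> R \<le> S \<and> 0 \<le> \<eta> \<and>
     (\<forall>x. R \<le> \<bar>x\<bar> \<longrightarrow> 0 \<le> q x \<and> q x \<le> \<eta>\<^sup>2) \<and> (\<forall>x. S \<le> \<bar>x\<bar> \<longrightarrow> q x = 0)"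

lemma well_reflect: "well q R S M \<eta> \<Longrightarrow> well (\<lambda>x. q (- x)) R S M \<eta>"
  unfolding well_def by auto

lemma wellD:
  assumes "well q R S M \<eta>"
  shows "q \<in> borel_measurable borel" "\<And>x. \<bar>q x\<bar> \<le> M" "0 < R" "R \<le> S" "0 \<le> \<eta>" "0 \<le> M"
    "\<And>x. R \<le> \<bar>x\<bar> \<Longrightarrow> 0 \<le> q x" "\<And>x. R \<le> \<bar>x\<bar> \<Longrightarrow> q x \<le> \<eta>\<^sup>2" "\<And>x. S \<le> \<bar>x\<bar> \<Longrightarrow> q x = 0"
  using assms unfolding well_def by (auto intro: order_trans[OF abs_ge_zero])

text \<open>The solution of \<open>y'' = (q + \<kappa>\<^sup>2) y\<close>, with its derivative, that continues \<open>exp (\<kappa> (x + S))\<close> from the left of \<open>- S\<close> if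
\<open>q\<close> vanishes there.\<close>
definition left_sol_pair :: "(real \<Rightarrow> real) \<Rightarrow> real \<Rightarrow> real \<Rightarrow> (real \<Rightarrow> real) \<times> (real \<Rightarrow> real)" where
  "left_sol_pair q S \<kappa> = (SOME yp. solves (\<lambda>x. q x + \<kappa>\<^sup>2) (fst yp) (snd yp) \<and> fst yp (- S) = 1 \<and> snd yp (- S) = \<kappa>)"

abbreviation "left_sol q S \<kappa> \<equiv> fst (left_sol_pair q S \<kappa>)"
abbreviation "left_deriv q S \<kappa> \<equiv> snd (left_sol_pair q S \<kappa>)"

text \<open>For \<open>\<kappa> > 0\<close> a solution is, on the right of \<open>S\<close>, a combination of \<open>exp (\<kappa> x)\<close> and \<open>exp (- \<kappa> x)\<close>; this is the coefficient of the
growing exponential, up to a positive factor.\<close>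
definition evans :: "(real \<Rightarrow> real) \<Rightarrow> real \<Rightarrow> real \<Rightarrow> real" where
  "evans q S \<kappa> = left_deriv q S \<kappa> S + \<kappa> * left_sol q S \<kappa> S"

lemma left_sol_pair:
  assumes "well q R S M \<eta>"
  shows "solves (\<lambda>x. q x + \<kappa>\<^sup>2) (left_sol q S \<kappa>) (left_deriv q S \<kappa>)" "left_sol q S \<kappa> (- S) = 1" "left_deriv q S \<kappa> (- S) = \<kappa>"
proof -
  have "(\<lambda>x. q x + \<kappa>\<^sup>2) \<in> borel_measurable borel" using wellD(1)[OF assms] by measurable
  moreover have "\<bar>q x + \<kappa>\<^sup>2\<bar> \<le> M + \<kappa>\<^sup>2" for x
    using abs_triangle_ineq[of "q x" "\<kappa>\<^sup>2"] wellD(2)[OF assms, of x] by simp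
  ultimately obtain y p where "solves (\<lambda>x. q x + \<kappa>\<^sup>2) y p" "y (- S) = 1" "p (- S) = \<kappa>"
    using solves_exists[of "\<lambda>x. q x + \<kappa>\<^sup>2" "M + \<kappa>\<^sup>2" "-S" 1 \<kappa>] by blast
  then have "\<exists>yp. solves (\<lambda>x. q x + \<kappa>\<^sup>2) (fst yp) (snd yp) \<and> fst yp (- S) = 1 \<and> snd yp (- S) = \<kappa>"
    by (intro exI[of _ "(y, p)"]) auto
  from someI_ex[OF this]
  show "solves (\<lambda>x. q x + \<kappa>\<^sup>2) (left_sol q S \<kappa>) (left_deriv q S \<kappa>)" "left_sol q S \<kappa> (- S) = 1" "left_deriv q S \<kappa> (- S) = \<kappa>"
    unfolding left_sol_pair_def by auto
qed

lemma primitive_exp: "primitive (\<lambda>x. c * exp (c * x)) (\<lambda>x. exp (c * x))"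
  by (rule primitive_deriv) (auto intro!: derivative_eq_intros locally_bounded_continuous continuous_intros)

text \<open>The comparison of the logarithmic slope \<open>p / y\<close> with a constant \<open>k\<close>, written without division: the sign of
\<open>(q + \<kappa>\<^sup>2 - k\<^sup>2) y\<close> decides on the monotonicity of \<open>(p - k y) exp (k x)\<close>.\<close>
lemma solves_riccati:
  assumes "solves (\<lambda>x. q x + \<kappa>\<^sup>2) y p"
  shows "primitive (\<lambda>x. (q x + \<kappa>\<^sup>2 - k\<^sup>2) * y x * exp (k * x)) (\<lambda>x. (p x - k * y x) * exp (k * x))"
  by (rule primitive_cong[OF primitive_mult[OF primitive_diff[OF solvesD(3)[OF assms] primitive_cmult[OF solvesD(2)[OF assms], of k]]
     primitive_exp[of k]]]) (auto simp: algebra_simps power2_eq_square)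

lemma tail_left:
  assumes s: "solves (\<lambda>x. q x + \<kappa>\<^sup>2) y p" and q: "\<And>x. x \<le> -S \<Longrightarrow> q x = 0" and p: "p (-S) = \<kappa> * y (-S)" and x: "x \<le> -S"
  shows "p x = \<kappa> * y x" "y x = y (-S) * exp (\<kappa> * (x + S))"
proof -
  have *: "p x = \<kappa> * y x" if x: "x \<le> -S" for x
    using primitive_zero[OF solves_riccati[OF s, of \<kappa>] x] q p by auto
  show "p x = \<kappa> * y x" by (rule *[OF x])
  have "primitive (\<lambda>x. (p x - \<kappa> * y x) * exp (- \<kappa> * x)) (\<lambda>x. y x * exp (- \<kappa> * x))"
    by (rule primitive_cong[OF primitive_mult[OF solvesD(2)[OF s] primitive_exp[of "-\<kappa>"]]]) (auto simp: algebra_simps)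
  from primitive_zero[OF this x] * have "y (-S) * exp (\<kappa> * S) = y x * exp (- \<kappa> * x)" by auto
  then have "y (-S) * exp (\<kappa> * S) * exp (\<kappa> * x) = y x * (exp (- \<kappa> * x) * exp (\<kappa> * x))" by simp
  then show "y x = y (-S) * exp (\<kappa> * (x + S))"
    by (simp add: exp_add[symmetric] distrib_left mult.assoc add.commute)
qed

lemma tail_right:
  assumes s: "solves (\<lambda>x. q x + \<kappa>\<^sup>2) y p" and q: "\<And>x. x \<ge> S \<Longrightarrow> q x = 0" and p: "p S = - \<kappa> * y S" and x: "x \<ge> S"
  shows "p x = - \<kappa> * y x" "y x = y S * exp (- \<kappa> * (x - S))"
  using tail_left[OF solves_reflect[OF s], of S "-x"] q p x by (auto simp: algebra_simps)

text \<open>The product \<open>y p\<close> increases because its derivative is \<open>p\<^sup>2 + (q + \<kappa>\<^sup>2) y\<^sup>2\<close>, so it stays positive and \<open>y\<close> has no zero. The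
comparison of slopes then confines \<open>p / y\<close> to \<open>[\<kappa>, K]\<close>.\<close>
lemma left_positive:
  assumes s: "solves (\<lambda>x. q x + \<kappa>\<^sup>2) y p" and \<kappa>: "0 < \<kappa>"
    and q: "\<And>x. x \<in> {-S..-R} \<Longrightarrow> 0 \<le> q x" and p: "p (-S) = \<kappa> * y (-S)" and y: "0 < y (-S)"
    and x: "x \<in> {-S..-R}"
  shows "0 < y x" "\<kappa> * y x \<le> p x"
    "\<And>K. \<kappa> \<le> K \<Longrightarrow> (\<And>x. x \<in> {-S..-R} \<Longrightarrow> q x + \<kappa>\<^sup>2 \<le> K\<^sup>2) \<Longrightarrow> p x \<le> K * y x"
proof -
  have prod: "primitive (\<lambda>x. p x * p x + (q x + \<kappa>\<^sup>2) * y x * y x) (\<lambda>x. p x * y x)"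
    by (rule primitive_cong[OF primitive_mult[OF solvesD(3)[OF s] solvesD(2)[OF s]]]) (auto simp: algebra_simps)
  have nz: "y t \<noteq> 0" if t: "t \<in> {-S..-R}" for t
  proof -
    have "p (-S) * y (-S) \<le> p t * y t"
      using t q by (intro primitive_mono[OF prod]) (auto intro!: add_nonneg_nonneg simp: mult.assoc)
    moreover have "0 < p (-S) * y (-S)" using y \<kappa> by (simp add: p)
    ultimately show ?thesis by auto
  qed
  have pos: "0 < y t" if t: "t \<in> {-S..-R}" for t
  proof (rule ccontr)
    assume "\<not> 0 < y t"
    then have "\<exists>z. -S \<le> z \<and> z \<le> t \<and> y z = 0"
      using t y by (intro IVT2' solvesD(4)[OF s]) auto
    then show False using nz t by auto
  qed
  show "0 < y x" by (rule pos[OF x])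
  have "(p (-S) - \<kappa> * y (-S)) * exp (\<kappa> * (-S)) \<le> (p x - \<kappa> * y x) * exp (\<kappa> * x)"
    using x q pos by (intro primitive_mono[OF solves_riccati[OF s]]) (auto intro!: mult_nonneg_nonneg simp: less_imp_le)
  then show "\<kappa> * y x \<le> p x" by (simp add: p zero_le_mult_iff)
  fix K assume K: "\<kappa> \<le> K" "(\<And>x. x \<in> {-S..-R} \<Longrightarrow> q x + \<kappa>\<^sup>2 \<le> K\<^sup>2)"
  have "(p x - K * y x) * exp (K * x) \<le> (p (-S) - K * y (-S)) * exp (K * (-S))"
  proof (rule primitive_antimono[OF solves_riccati[OF s]])
    show "-S \<le> x" using x by simp
    fix t assume "t \<in> {-S..x}"
    then have "t \<in> {-S..-R}" using x by auto
    then show "(q t + \<kappa>\<^sup>2 - K\<^sup>2) * y t * exp (K * t) \<le> 0"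
      using K(2)[of t] pos[of t] by (auto simp: mult_le_0_iff)
  qed
  also have "\<dots> \<le> 0" using K y by (simp add: p mult_le_0_iff)
  finally show "p x \<le> K * y x" by (simp add: mult_le_0_iff)
qed

lemma ge_one_half_line_not_integrable:
  fixes f :: "real \<Rightarrow> real"
  assumes "integrable lborel f" "\<And>x. 0 \<le> f x" "\<And>x. x \<le> X \<Longrightarrow> 1 \<le> f x"
  shows False
proof -
  obtain n :: nat where n: "(\<integral>x. f x \<partial>lborel) < real n" using reals_Archimedean2 by blast
  have "real n = (\<integral>x. indicator {X - real n..X} x \<partial>lborel)" by simp
  also have "\<dots> \<le> (\<integral>x. f x \<partial>lborel)"
  proof (rule integral_mono)
    show "integrable lborel (indicator {X - real n..X} :: real \<Rightarrow> real)"
      by (intro integrable_real_indicator) auto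
  qed (use assms in \<open>auto simp: indicator_def\<close>)
  finally show False using n by simp
qed

text \<open>On the left of \<open>- S\<close> the solution is a combination of \<open>exp (\<kappa> x)\<close> and \<open>exp (- \<kappa> x)\<close>. If the coefficient \<open>A\<close> of the
second one were not zero, then \<open>\<bar>y\<bar> \<ge> 1\<close> on a half line.\<close>
lemma square_integrable_imp_left_decay:
  assumes s: "solves (\<lambda>x. q x + \<kappa>\<^sup>2) y p" and \<kappa>: "0 < \<kappa>" and q: "\<And>x. x \<le> -S \<Longrightarrow> q x = 0"
    and int: "integrable lborel (\<lambda>x. (y x)\<^sup>2)"
  shows "p (-S) = \<kappa> * y (-S)"
proof (rule ccontr)
  assume ne: "p (-S) \<noteq> \<kappa> * y (-S)"
  define A where "A = (p (-S) - \<kappa> * y (-S)) * exp (- \<kappa> * S)"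
  define B where "B = (p (-S) + \<kappa> * y (-S)) * exp (\<kappa> * S)"
  have A0: "A \<noteq> 0" using ne by (simp add: A_def)
  have A: "(p x - \<kappa> * y x) = A * exp (- \<kappa> * x)" and B: "(p x + \<kappa> * y x) = B * exp (\<kappa> * x)" if x: "x \<le> -S" for x
  proof -
    have "A = (p x - \<kappa> * y x) * exp (\<kappa> * x)"
      using primitive_zero[OF solves_riccati[OF s, of \<kappa>] x] q by (simp add: A_def)
    then have "A * exp (- \<kappa> * x) = (p x - \<kappa> * y x) * (exp (\<kappa> * x) * exp (- \<kappa> * x))" by simp
    then show "(p x - \<kappa> * y x) = A * exp (- \<kappa> * x)" by (simp add: exp_add[symmetric])
    have "B = (p x + \<kappa> * y x) * exp (- \<kappa> * x)"
      using primitive_zero[OF solves_riccati[OF s, of "-\<kappa>"] x] q by (simp add: B_def)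
    then have "B * exp (\<kappa> * x) = (p x + \<kappa> * y x) * (exp (- \<kappa> * x) * exp (\<kappa> * x))" by simp
    then show "(p x + \<kappa> * y x) = B * exp (\<kappa> * x)" by (simp add: exp_add[symmetric])
  qed
  define X where "X = min (-S) (- ((2 * \<kappa> + \<bar>B\<bar> * exp (- \<kappa> * S)) / (\<bar>A\<bar> * \<kappa>)))"
  have "1 \<le> (y x)\<^sup>2" if x: "x \<le> X" for x
  proof -
    have xS: "x \<le> -S" using x by (simp add: X_def)
    have "\<bar>B\<bar> * exp (\<kappa> * x) \<le> \<bar>B\<bar> * exp (- \<kappa> * S)" using xS \<kappa> mult_left_mono[of x "-S" \<kappa>]
      by (intro mult_left_mono) auto
    moreover have "2 * \<kappa> + \<bar>B\<bar> * exp (- \<kappa> * S) \<le> \<bar>A\<bar> * exp (- \<kappa> * x)"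
    proof -
      have "(2 * \<kappa> + \<bar>B\<bar> * exp (- \<kappa> * S)) / (\<bar>A\<bar> * \<kappa>) \<le> - x" using x by (simp add: X_def)
      then have "2 * \<kappa> + \<bar>B\<bar> * exp (- \<kappa> * S) \<le> \<bar>A\<bar> * (- \<kappa> * x)"
        using A0 \<kappa> by (simp add: divide_le_eq mult_ac)
      also have "\<dots> \<le> \<bar>A\<bar> * exp (- \<kappa> * x)"
        using exp_ge_add_one_self[of "- \<kappa> * x"] by (intro mult_left_mono) auto
      finally show ?thesis .
    qed
    moreover have "2 * \<kappa> * y x = B * exp (\<kappa> * x) - A * exp (- \<kappa> * x)"
      using A[OF xS] B[OF xS] by simp
    then have "2 * \<kappa> * \<bar>y x\<bar> = \<bar>B * exp (\<kappa> * x) - A * exp (- \<kappa> * x)\<bar>"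
      using \<kappa> by (metis abs_mult abs_of_pos mult_pos_pos zero_less_numeral)
    moreover have "\<bar>A\<bar> * exp (- \<kappa> * x) - \<bar>B\<bar> * exp (\<kappa> * x) \<le> \<bar>B * exp (\<kappa> * x) - A * exp (- \<kappa> * x)\<bar>"
      using abs_triangle_ineq2[of "A * exp (- \<kappa> * x)" "B * exp (\<kappa> * x)"] by (simp add: abs_mult abs_minus_commute)
    ultimately have "2 * \<kappa> * 1 \<le> 2 * \<kappa> * \<bar>y x\<bar>" by linarith
    then have "1 \<le> \<bar>y x\<bar>" using \<kappa> by simp
    then have "1\<^sup>2 \<le> \<bar>y x\<bar>\<^sup>2" by (intro power_mono) auto
    then show ?thesis by simp
  qed
  then show False using ge_one_half_line_not_integrable[OF int, of X] by simp
qed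

lemma square_integrable_imp_right_decay:
  assumes s: "solves (\<lambda>x. q x + \<kappa>\<^sup>2) y p" and \<kappa>: "0 < \<kappa>" and q: "\<And>x. x \<ge> S \<Longrightarrow> q x = 0"
    and int: "integrable lborel (\<lambda>x. (y x)\<^sup>2)"
  shows "p S = - \<kappa> * y S"
proof -
  have "integrable lborel (\<lambda>x. (y (- x))\<^sup>2)"
    using lborel_integrable_real_affine[OF int, of "-1" 0] by simp
  then show ?thesis
    using square_integrable_imp_left_decay[OF solves_reflect[OF s] \<kappa>, of S] q by simp
qed

text \<open>A bound state decays on the left, so it has the same data at \<open>- S\<close> as a multiple of the shooting solution, and
uniqueness applies. Its decay on the right is the vanishing of \<open>evans\<close>.\<close>
lemma evans_zero_of_square_integrable:
  assumes w: "well q R S M \<eta>" and s: "solves (\<lambda>x. q x + \<kappa>\<^sup>2) y p" and \<kappa>: "0 < \<kappa>"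
    and int: "integrable lborel (\<lambda>x. (y x)\<^sup>2)" and nz: "\<exists>x. y x \<noteq> 0"
  shows "evans q S \<kappa> = 0" "y (-S) \<noteq> 0" "\<And>x. y x = y (-S) * left_sol q S \<kappa> x"
proof -
  note l = left_sol_pair[OF w, of \<kappa>]
  have S: "S > 0" using wellD(3,4)[OF w] by simp
  have pL: "p (-S) = \<kappa> * y (-S)"
    using wellD(9)[OF w] S by (intro square_integrable_imp_left_decay[OF s \<kappa> _ int]) auto
  have pR: "p S = - \<kappa> * y S"
    using wellD(9)[OF w] S by (intro square_integrable_imp_right_decay[OF s \<kappa> _ int]) auto
  have eq: "y x = y (-S) * left_sol q S \<kappa> x" "p x = y (-S) * left_deriv q S \<kappa> x" for x
    by (rule solves_unique[OF s solves_cmult[OF l(1)], where a = "-S"], simp_all add: l(2,3) pL)+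
  then show y: "\<And>x. y x = y (-S) * left_sol q S \<kappa> x" by blast
  show nz: "y (-S) \<noteq> 0"
  proof
    assume "y (-S) = 0"
    moreover obtain x where "y x \<noteq> 0" using nz by blast
    ultimately show False using eq(1)[of x] by simp
  qed
  have "y (-S) * left_deriv q S \<kappa> S = - \<kappa> * (y (-S) * left_sol q S \<kappa> S)"
    using pR eq[of S] by simp
  then have "y (-S) * evans q S \<kappa> = 0" unfolding evans_def by (simp add: algebra_simps)
  then show "evans q S \<kappa> = 0" using nz by simp
qed

lemma evans_zero_decay:
  assumes w: "well q R S M \<eta>" and e: "evans q S \<kappa> = 0"
  shows "x \<le> -S \<Longrightarrow> left_deriv q S \<kappa> x = \<kappa> * left_sol q S \<kappa> x" "x \<le> -S \<Longrightarrow> left_sol q S \<kappa> x = exp (\<kappa> * (x + S))"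
    "x \<ge> S \<Longrightarrow> left_deriv q S \<kappa> x = - \<kappa> * left_sol q S \<kappa> x" "x \<ge> S \<Longrightarrow> left_sol q S \<kappa> x = left_sol q S \<kappa> S * exp (- \<kappa> * (x - S))"
proof -
  note l = left_sol_pair[OF w, of \<kappa>]
  have S: "S > 0" using wellD(3,4)[OF w] by simp
  show "x \<le> -S \<Longrightarrow> left_deriv q S \<kappa> x = \<kappa> * left_sol q S \<kappa> x" "x \<le> -S \<Longrightarrow> left_sol q S \<kappa> x = exp (\<kappa> * (x + S))"
    using tail_left[OF l(1), of S x] wellD(9)[OF w] S l(2,3) by auto
  have "left_deriv q S \<kappa> S = - \<kappa> * left_sol q S \<kappa> S" using e by (simp add: evans_def)
  then show "x \<ge> S \<Longrightarrow> left_deriv q S \<kappa> x = - \<kappa> * left_sol q S \<kappa> x" "x \<ge> S \<Longrightarrow> left_sol q S \<kappa> x = left_sol q S \<kappa> S * exp (- \<kappa> * (x - S))"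
    using tail_right[OF l(1), of S x] wellD(9)[OF w] S by auto
qed

text \<open>Normalising at \<open>- R\<close> instead of \<open>- S\<close> makes the estimates on \<open>[-R, R]\<close> independent of \<open>S\<close>.\<close>
definition norm_sol where "norm_sol q R S \<kappa> x = left_sol q S \<kappa> x / left_sol q S \<kappa> (-R)"
definition norm_deriv where "norm_deriv q R S \<kappa> x = left_deriv q S \<kappa> x / left_sol q S \<kappa> (-R)"
text \<open>Reflection turns the solution that decays on the right into one that decays on the left; this is minus its
logarithmic slope at \<open>R\<close>.\<close>
definition right_slope where "right_slope q R S \<kappa> = norm_deriv (\<lambda>x. q (-x)) R S \<kappa> (-R)"
text \<open>The Wronskian at \<open>R\<close> of the two decaying solutions, normalised at \<open>- R\<close> and \<open>R\<close>.\<close>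
definition reduced_evans where "reduced_evans q R S \<kappa> = norm_deriv q R S \<kappa> R + right_slope q R S \<kappa> * norm_sol q R S \<kappa> R"

lemma left_sol_positive:
  assumes w: "well q R S M \<eta>" and \<kappa>: "0 < \<kappa>" and x: "x \<le> -R"
  shows "0 < left_sol q S \<kappa> x" "\<kappa> * left_sol q S \<kappa> x \<le> left_deriv q S \<kappa> x"
    "\<And>K. \<kappa> \<le> K \<Longrightarrow> \<kappa>\<^sup>2 + \<eta>\<^sup>2 \<le> K\<^sup>2 \<Longrightarrow> left_deriv q S \<kappa> x \<le> K * left_sol q S \<kappa> x"
proof -
  note l = left_sol_pair[OF w, of \<kappa>]
  have S: "S > 0" using wellD(3,4)[OF w] by simp
  have t: "0 < left_sol q S \<kappa> x \<and> left_deriv q S \<kappa> x = \<kappa> * left_sol q S \<kappa> x" if "x \<le> -S"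
    using tail_left[OF l(1), of S x] wellD(9)[OF w] S l(2,3) that by auto
  note lp = left_positive[OF l(1) \<kappa>, of S R x]
  have q: "0 \<le> q t" "q t \<le> \<eta>\<^sup>2" if "t \<in> {-S..-R}" for t
    using wellD(3,7,8)[OF w] that by auto
  consider "x \<in> {-S..-R}" | "x \<le> -S" using x by force
  note c = this
  from c show "0 < left_sol q S \<kappa> x" "\<kappa> * left_sol q S \<kappa> x \<le> left_deriv q S \<kappa> x"
    by (cases; use t lp(1,2) q l in auto)+
  fix K assume K: "\<kappa> \<le> K" "\<kappa>\<^sup>2 + \<eta>\<^sup>2 \<le> K\<^sup>2"
  from c show "left_deriv q S \<kappa> x \<le> K * left_sol q S \<kappa> x"
  proof cases
    case 1
    show ?thesis
    proof (rule lp(3))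
      show "q t + \<kappa>\<^sup>2 \<le> K\<^sup>2" if "t \<in> {-S..-R}" for t using q(2)[OF that] K by simp
    qed (use q l 1 K in auto)
  next
    case 2
    then show ?thesis using t K by (auto intro!: mult_right_mono)
  qed
qed

text \<open>What is needed about the normalised solution. The relation to \<open>evans\<close> holds because the Wronskian of the two
decaying solutions is constant: its value at \<open>S\<close> is \<open>evans\<close>, its value at \<open>R\<close> is a positive multiple of \<open>reduced_evans\<close>.\<close>
lemma norm_sol:
  assumes w: "well q R S M \<eta>" and \<kappa>: "0 < \<kappa>"
  shows "solves (\<lambda>x. q x + \<kappa>\<^sup>2) (norm_sol q R S \<kappa>) (norm_deriv q R S \<kappa>)" "norm_sol q R S \<kappa> (-R) = 1"
    "\<kappa> \<le> norm_deriv q R S \<kappa> (-R)" "\<And>K. \<kappa> \<le> K \<Longrightarrow> \<kappa>\<^sup>2 + \<eta>\<^sup>2 \<le> K\<^sup>2 \<Longrightarrow> norm_deriv q R S \<kappa> (-R) \<le> K"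
    "\<And>x. x \<le> -R \<Longrightarrow> 0 < norm_sol q R S \<kappa> x"
    "\<kappa> \<le> right_slope q R S \<kappa>" "\<And>K. \<kappa> \<le> K \<Longrightarrow> \<kappa>\<^sup>2 + \<eta>\<^sup>2 \<le> K\<^sup>2 \<Longrightarrow> right_slope q R S \<kappa> \<le> K"
    "\<exists>c>0. evans q S \<kappa> = c * reduced_evans q R S \<kappa>"
    "\<exists>c>0. \<forall>x. left_sol q S \<kappa> x = c * norm_sol q R S \<kappa> x \<and> left_deriv q S \<kappa> x = c * norm_deriv q R S \<kappa> x"
proof -
  note l = left_sol_pair[OF w, of \<kappa>]
  note w' = well_reflect[OF w]
  note l' = left_sol_pair[OF w', of \<kappa>]
  have pos: "0 < left_sol q S \<kappa> (-R)" using left_sol_positive(1)[OF w \<kappa>] by simp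
  have pos': "0 < left_sol (\<lambda>x. q (-x)) S \<kappa> (-R)" using left_sol_positive(1)[OF w' \<kappa>] by simp
  show "solves (\<lambda>x. q x + \<kappa>\<^sup>2) (norm_sol q R S \<kappa>) (norm_deriv q R S \<kappa>)"
    using solves_cmult[OF l(1), of "1 / left_sol q S \<kappa> (-R)"] by (simp add: norm_sol_def[abs_def] norm_deriv_def[abs_def])
  show "norm_sol q R S \<kappa> (-R) = 1" using pos by (simp add: norm_sol_def)
  show "\<kappa> \<le> norm_deriv q R S \<kappa> (-R)" using left_sol_positive(2)[OF w \<kappa>, of "-R"] pos by (simp add: norm_deriv_def pos_le_divide_eq)
  show "\<And>K. \<kappa> \<le> K \<Longrightarrow> \<kappa>\<^sup>2 + \<eta>\<^sup>2 \<le> K\<^sup>2 \<Longrightarrow> norm_deriv q R S \<kappa> (-R) \<le> K"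
    using left_sol_positive(3)[OF w \<kappa>, of "-R"] pos by (simp add: norm_deriv_def pos_divide_le_eq)
  show "\<And>x. x \<le> -R \<Longrightarrow> 0 < norm_sol q R S \<kappa> x" using left_sol_positive(1)[OF w \<kappa>] pos by (simp add: norm_sol_def)
  show "\<kappa> \<le> right_slope q R S \<kappa>" using left_sol_positive(2)[OF w' \<kappa>, of "-R"] pos' by (simp add: right_slope_def norm_deriv_def pos_le_divide_eq)
  show "\<And>K. \<kappa> \<le> K \<Longrightarrow> \<kappa>\<^sup>2 + \<eta>\<^sup>2 \<le> K\<^sup>2 \<Longrightarrow> right_slope q R S \<kappa> \<le> K"
    using left_sol_positive(3)[OF w' \<kappa>, of "-R"] pos' by (simp add: right_slope_def norm_deriv_def pos_divide_le_eq)
  show "\<exists>c>0. \<forall>x. left_sol q S \<kappa> x = c * norm_sol q R S \<kappa> x \<and> left_deriv q S \<kappa> x = c * norm_deriv q R S \<kappa> x"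
    using pos by (intro exI[of _ "left_sol q S \<kappa> (-R)"]) (auto simp: norm_sol_def norm_deriv_def)
  define yr where "yr x = left_sol (\<lambda>x. q (-x)) S \<kappa> (-x)" for x
  define pr where "pr x = - left_deriv (\<lambda>x. q (-x)) S \<kappa> (-x)" for x
  have sr: "solves (\<lambda>x. q x + \<kappa>\<^sup>2) yr pr"
    using solves_reflect[OF l'(1)] by (simp add: yr_def[abs_def] pr_def[abs_def])
  have RS: "R \<le> S" using wellD(4)[OF w] .
  have "left_deriv q S \<kappa> S * yr S - left_sol q S \<kappa> S * pr S = left_deriv q S \<kappa> R * yr R - left_sol q S \<kappa> R * pr R"
    using primitive_zero[OF solves_wronskian[OF l(1) sr] RS] by simp
  moreover have "yr S = 1" "pr S = - \<kappa>" using l'(2,3) by (auto simp: yr_def pr_def)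
  moreover have "pr R = - right_slope q R S \<kappa> * yr R" using pos' by (simp add: right_slope_def norm_deriv_def yr_def pr_def)
  ultimately have "evans q S \<kappa> = yr R * (left_deriv q S \<kappa> R + right_slope q R S \<kappa> * left_sol q S \<kappa> R)"
    unfolding evans_def by (simp add: algebra_simps)
  also have "\<dots> = (yr R * left_sol q S \<kappa> (-R)) * reduced_evans q R S \<kappa>"
    using pos by (simp add: reduced_evans_def norm_sol_def norm_deriv_def field_simps)
  finally show "\<exists>c>0. evans q S \<kappa> = c * reduced_evans q R S \<kappa>"
    using pos pos' by (intro exI[of _ "yr R * left_sol q S \<kappa> (-R)"]) (simp add: yr_def)
qed

lemma evans_continuous:
  assumes w: "well q R S M \<eta>"
  shows "continuous_on {0..b} (evans q S)"
  unfolding continuous_on_eq_continuous_within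
proof
  fix k assume k: "k \<in> {0..b}"
  have S: "S > 0" using wellD(3,4)[OF w] by simp
  note l = left_sol_pair[OF w]
  obtain B where B: "\<And>t. t \<in> {-S..S} \<Longrightarrow> \<bar>left_sol q S k t\<bar> \<le> B"
    using locally_bounded_bound[OF solvesD(6)[OF l(1)]] by meson
  define E where "E = exp ((2 + (M + b\<^sup>2)) * (S - (-S)))"
  define C where "C = E * (1 + (1 + (S - (-S))) * (2 * b * B))"
  have B0: "0 \<le> B" using B[of S] S by simp
  have est: "\<bar>left_sol q S j S - left_sol q S k S\<bar> \<le> C * \<bar>j - k\<bar> \<and> \<bar>left_deriv q S j S - left_deriv q S k S\<bar> \<le> C * \<bar>j - k\<bar>" if j: "j \<in> {0..b}" for j
  proof -
    have 1: "\<bar>(q t + j\<^sup>2) - (q t + k\<^sup>2)\<bar> \<le> 2 * b * \<bar>j - k\<bar>" for t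
    proof -
      have "\<bar>j\<^sup>2 - k\<^sup>2\<bar> = \<bar>j + k\<bar> * \<bar>j - k\<bar>" by (simp add: power2_eq_square abs_mult[symmetric] algebra_simps)
      also have "\<dots> \<le> 2 * b * \<bar>j - k\<bar>" using j k by (intro mult_right_mono) auto
      finally show ?thesis by simp
    qed
    have 2: "\<bar>q t + j\<^sup>2\<bar> \<le> M + b\<^sup>2" for t
    proof -
      have "j\<^sup>2 \<le> b\<^sup>2" using j by (intro power_mono) auto
      then show ?thesis using abs_triangle_ineq[of "q t" "j\<^sup>2"] wellD(2)[OF w, of t] by simp
    qed
    have c: "E * (\<bar>left_sol q S j (-S) - left_sol q S k (-S)\<bar> + \<bar>left_deriv q S j (-S) - left_deriv q S k (-S)\<bar> + (1 + (S - (-S))) * (2 * b * \<bar>j - k\<bar> * B)) = C * \<bar>j - k\<bar>"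
      by (simp add: l(2,3)[of j] l(2,3)[of k] C_def algebra_simps)
    have "S \<in> {-S..S}" "0 \<le> M + b\<^sup>2" using S wellD(6)[OF w] by auto
    note sc = solves_close[OF l(1)[of j] l(1)[of k] this(1) this(2), of "2 * b * \<bar>j - k\<bar>" B]
    show ?thesis using sc 1 2 B unfolding E_def[symmetric] c by auto
  qed
  have "((\<lambda>j. left_sol q S j S) \<longlongrightarrow> left_sol q S k S) (at k within {0..b})" "((\<lambda>j. left_deriv q S j S) \<longlongrightarrow> left_deriv q S k S) (at k within {0..b})"
  proof -
    have z: "((\<lambda>j. C * \<bar>j - k\<bar>) \<longlongrightarrow> 0) (at k within {0..b})" by (auto intro!: tendsto_eq_intros)
    have ev: "\<forall>\<^sub>F j in at k within {0..b}. j \<in> {0..b}" by (auto simp: eventually_at intro: exI[of _ 1])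
    have "((\<lambda>j. left_sol q S j S - left_sol q S k S) \<longlongrightarrow> 0) (at k within {0..b})"
      by (rule Lim_null_comparison[OF _ z]) (use est in \<open>auto intro: eventually_mono[OF ev]\<close>)
    then show "((\<lambda>j. left_sol q S j S) \<longlongrightarrow> left_sol q S k S) (at k within {0..b})" by (simp add: LIM_zero_iff)
    have "((\<lambda>j. left_deriv q S j S - left_deriv q S k S) \<longlongrightarrow> 0) (at k within {0..b})"
      by (rule Lim_null_comparison[OF _ z]) (use est in \<open>auto intro: eventually_mono[OF ev]\<close>)
    then show "((\<lambda>j. left_deriv q S j S) \<longlongrightarrow> left_deriv q S k S) (at k within {0..b})" by (simp add: LIM_zero_iff)
  qed
  then show "continuous (at k within {0..b}) (evans q S)"
    unfolding continuous_within evans_def by (intro tendsto_intros)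
qed

text \<open>If \<open>q + k\<^sup>2 \<ge> 0\<close>, then \<open>y p\<close> increases from its value \<open>k > 0\<close> at \<open>- S\<close>, whereas \<open>y p = - k y\<^sup>2\<close> at \<open>S\<close> for a root.\<close>
lemma evans_nonzero_large:
  assumes w: "well q R S M \<eta>" and k: "0 < k" "M \<le> k\<^sup>2"
  shows "evans q S k \<noteq> 0"
proof
  assume e: "evans q S k = 0"
  note l = left_sol_pair[OF w, of k]
  have S: "S > 0" using wellD(3,4)[OF w] by simp
  have "primitive (\<lambda>x. left_deriv q S k x * left_deriv q S k x + (q x + k\<^sup>2) * (left_sol q S k x * left_sol q S k x)) (\<lambda>x. left_deriv q S k x * left_sol q S k x)"
    by (rule primitive_cong[OF primitive_mult[OF solvesD(3)[OF l(1)] solvesD(2)[OF l(1)]]]) (auto simp: algebra_simps)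
  then have "left_deriv q S k (-S) * left_sol q S k (-S) \<le> left_deriv q S k S * left_sol q S k S"
  proof (rule primitive_mono)
    fix x
    have "- q x \<le> k\<^sup>2" using wellD(2)[OF w, of x] k by linarith
    then show "0 \<le> left_deriv q S k x * left_deriv q S k x + (q x + k\<^sup>2) * (left_sol q S k x * left_sol q S k x)" by simp
  qed (use S in auto)
  moreover have "left_deriv q S k S * left_sol q S k S = - k * (left_sol q S k S)\<^sup>2"
  proof -
    have "left_deriv q S k S = - k * left_sol q S k S" using e by (simp add: evans_def)
    then show ?thesis unfolding power2_eq_square by (simp only: mult.assoc)
  qed
  moreover have "- k * (left_sol q S k S)\<^sup>2 \<le> 0" using k by (simp add: mult_le_0_iff)
  ultimately show False using l(2,3) k by simp
qed

lemma evans_zero_nonzero_right: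
  assumes w: "well q R S M \<eta>" and e: "evans q S k = 0"
  shows "left_sol q S k S \<noteq> 0"
proof
  note l = left_sol_pair[OF w, of k]
  assume 0: "left_sol q S k S = 0"
  then have 1: "left_deriv q S k S = 0" using e by (simp add: evans_def)
  have "left_sol q S k (-S) = 0 * left_sol q S k (-S)"
    by (rule solves_unique(1)[OF l(1) solves_cmult[OF l(1)], where a = S]) (simp_all add: 0 1)
  then show False using l(2) by simp
qed

text \<open>The reflected solution decays on the left, so \<open>left_positive\<close> describes it up to \<open>S\<close>; the factor \<open>y S\<close> fixes its sign.\<close>
lemma evans_zero_right:
  assumes w: "well q R S M \<eta>" and k: "0 < k" and e: "evans q S k = 0" and x: "R \<le> x"
  shows "0 < left_sol q S k S * left_sol q S k x" "left_sol q S k x * left_deriv q S k x \<le> - k * (left_sol q S k x)\<^sup>2"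
proof -
  note l = left_sol_pair[OF w, of k]
  define c where "c = left_sol q S k S"
  have c0: "c \<noteq> 0" unfolding c_def by (rule evans_zero_nonzero_right[OF w e])
  have pS: "left_deriv q S k S = - k * left_sol q S k S" using e by (simp add: evans_def)
  have "0 < c * left_sol q S k x \<and> k * (c * left_sol q S k x) \<le> c * (- left_deriv q S k x)"
  proof (cases "x \<le> S")
    case True
    have s: "solves (\<lambda>x. q (-x) + k\<^sup>2) (\<lambda>x. c * left_sol q S k (-x)) (\<lambda>x. c * (- left_deriv q S k (-x)))"
      by (rule solves_cmult[OF solves_reflect[OF l(1)]])
    have cc: "0 < c * c" using c0 by (meson not_real_square_gt_zero)
    have xx: "- x \<in> {-S..-R}" using True x by simp
    have qq: "0 \<le> q (- t)" if "t \<in> {-S..-R}" for t using wellD(3)[OF w] wellD(7)[OF w, of "-t"] that by simp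
    show ?thesis
      using left_positive(1,2)[OF s k qq _ _ xx] cc pS by (simp add: c_def algebra_simps)
  next
    case False
    then have "left_deriv q S k x = - k * left_sol q S k x" "left_sol q S k x = c * exp (- k * (x - S))"
      using evans_zero_decay(3,4)[OF w e, of x] by (auto simp: c_def)
    moreover have "0 < c * c" using c0 by (meson not_real_square_gt_zero)
    ultimately show ?thesis by (simp add: mult.assoc[symmetric])
  qed
  then have *: "0 < c * left_sol q S k x" "k * (c * left_sol q S k x) \<le> c * (- left_deriv q S k x)" by auto
  then show "0 < left_sol q S k S * left_sol q S k x" by (simp add: c_def)
  have "(c * left_sol q S k x) * (k * (c * left_sol q S k x)) \<le> (c * left_sol q S k x) * (c * (- left_deriv q S k x))"
    using * by (intro mult_left_mono) auto
  then have "c\<^sup>2 * (k * (left_sol q S k x)\<^sup>2) \<le> c\<^sup>2 * (- (left_sol q S k x * left_deriv q S k x))"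
    by (simp add: power2_eq_square mult_ac)
  then have "k * (left_sol q S k x)\<^sup>2 \<le> - (left_sol q S k x * left_deriv q S k x)"
    using c0 by (subst (asm) mult_le_cancel_left_pos) auto
  then show "left_sol q S k x * left_deriv q S k x \<le> - k * (left_sol q S k x)\<^sup>2" by simp
qed

text \<open>Representatives of \<open>U\<close>, \<open>V\<close>, \<open>W\<close> that are bounded everywhere, with one radius \<open>R\<close> for all supports and one bound \<open>M\<close>.\<close>
locale scaled_wells =
  fixes U V W :: "real \<Rightarrow> real" and R M :: real
  assumes meas: "U \<in> borel_measurable borel" "V \<in> borel_measurable borel" "W \<in> borel_measurable borel"
    and bound: "\<And>x. \<bar>U x\<bar> \<le> M" "\<And>x. \<bar>V x\<bar> \<le> M" "\<And>x. 0 \<le> W x" "\<And>x. W x \<le> M"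
    and supp: "\<And>x. R \<le> \<bar>x\<bar> \<Longrightarrow> U x = 0" "\<And>x. R \<le> \<bar>x\<bar> \<Longrightarrow> V x = 0" "\<And>x. R \<le> \<bar>x\<bar> \<Longrightarrow> W x = 0"
    and R: "0 < R" and M: "1 \<le> M"
begin

definition "scaled_potential e x = V x + e * U x + e\<^sup>2 * W (e * x)"

lemma scaled_potential_diff: assumes "0 \<le> e" "e \<le> 1" shows "\<bar>scaled_potential e x - V x\<bar> \<le> 2 * M * e"
proof -
  have "\<bar>e * U x\<bar> \<le> e * M" unfolding abs_mult using assms bound(1) by (simp add: mult_left_mono)
  moreover have "\<bar>e\<^sup>2 * W (e * x)\<bar> \<le> e * M"
  proof -
    have "e\<^sup>2 \<le> e" using assms by (simp add: power2_eq_square mult_left_le)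
    then show ?thesis unfolding abs_mult using bound(3,4) assms by (intro mult_mono) auto
  qed
  moreover have "e * M = M * e" by (rule mult.commute)
  ultimately show ?thesis unfolding scaled_potential_def using abs_triangle_ineq[of "e * U x" "e\<^sup>2 * W (e * x)"] by linarith
qed

lemma scaled_potential_bound: assumes "0 \<le> e" "e \<le> 1" shows "\<bar>scaled_potential e x\<bar> \<le> 3 * M"
proof -
  have "2 * M * e \<le> 2 * M * 1" using assms M by (intro mult_left_mono) auto
  then show ?thesis using scaled_potential_diff[OF assms, of x] bound(2)[of x] by linarith
qed

lemma well_V: "well V R R (3 * M) 0"
proof -
  have "\<bar>V x\<bar> \<le> 3 * M" for x using bound(2)[of x] M by linarith
  then show ?thesis unfolding well_def using meas supp R by auto
qed

text \<open>The outer part of the potential is \<open>\<epsilon>\<^sup>2 W(\<epsilon> x)\<close>, which lies between \<open>0\<close> and \<open>(\<epsilon> sqrt M)\<^sup>2\<close> and vanishes from \<open>R / \<epsilon>\<close> on.\<close>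
lemma well_scaled_potential: assumes "0 < e" "e \<le> 1" shows "well (scaled_potential e) R (R / e) (3 * M) (e * sqrt M)"
  unfolding well_def
proof (intro conjI allI impI)
  show "scaled_potential e \<in> borel_measurable borel" using meas unfolding scaled_potential_def[abs_def] by measurable
  show "R \<le> R / e" using assms R by (simp add: pos_le_divide_eq mult_left_le)
  show "0 < R" by (rule R)
  fix x
  show "\<bar>scaled_potential e x\<bar> \<le> 3 * M" using scaled_potential_bound assms by simp
  show "0 \<le> e * sqrt M" using assms M by simp
  { assume "R \<le> \<bar>x\<bar>"
    then have "scaled_potential e x = e\<^sup>2 * W (e * x)" using supp by (simp add: scaled_potential_def)
    then show "0 \<le> scaled_potential e x" "scaled_potential e x \<le> (e * sqrt M)\<^sup>2" using bound(3,4) M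
      by (auto simp: power_mult_distrib intro: mult_left_mono) }
  assume x: "R / e \<le> \<bar>x\<bar>"
  then have "R \<le> \<bar>e * x\<bar>" using assms by (simp add: abs_mult pos_divide_le_eq mult.commute)
  moreover have "R \<le> \<bar>x\<bar>" using x \<open>R \<le> R / e\<close> by simp
  ultimately show "scaled_potential e x = 0" using supp by (simp add: scaled_potential_def)
qed

text \<open>Since \<open>3 M\<close> bounds all potentials in question, all roots lie below \<open>K\<close>.\<close>
definition K where "K = 3 * M + 1"
lemma K: "1 \<le> K" "0 < K" "3 * M \<le> K\<^sup>2" using M by (auto simp: K_def power2_eq_square algebra_simps)

text \<open>Unperturbed solutions are denoted by \<open>v\<close> and perturbed ones by \<open>u\<close>, their derivatives by \<open>pv\<close> and \<open>pu\<close>; \<open>D0\<close> and \<open>N\<close> are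
the shooting functions, \<open>G\<close> is the reduced form of \<open>N\<close>.\<close>
abbreviation "v k0 \<equiv> left_sol V R k0"
abbreviation "pv k0 \<equiv> left_deriv V R k0"
abbreviation "D0 k0 \<equiv> evans V R k0"
abbreviation "u e k \<equiv> norm_sol (scaled_potential e) R (R / e) k"
abbreviation "pu e k \<equiv> norm_deriv (scaled_potential e) R (R / e) k"
abbreviation "G e k \<equiv> reduced_evans (scaled_potential e) R (R / e) k"
abbreviation "N e k \<equiv> evans (scaled_potential e) (R / e) k"

lemma root_less_K:
  "0 < k \<Longrightarrow> D0 k = 0 \<Longrightarrow> k < K" "0 < k \<Longrightarrow> 0 < e \<Longrightarrow> e \<le> 1 \<Longrightarrow> N e k = 0 \<Longrightarrow> k < K"
proof -
  have a: "3 * M \<le> k\<^sup>2" if "K \<le> k" using K power_mono[OF that, of 2] by simp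
  show "0 < k \<Longrightarrow> D0 k = 0 \<Longrightarrow> k < K" using evans_nonzero_large[OF well_V, of k] a by force
  show "0 < k \<Longrightarrow> 0 < e \<Longrightarrow> e \<le> 1 \<Longrightarrow> N e k = 0 \<Longrightarrow> k < K" using evans_nonzero_large[OF well_scaled_potential, of e k] a by force
qed

lemma N_zero_iff: assumes "0 < e" "e \<le> 1" "0 < k" shows "N e k = 0 \<longleftrightarrow> G e k = 0"
  using norm_sol(8)[OF well_scaled_potential[OF assms(1,2)] assms(3)] by auto

text \<open>The bounds with \<open>\<epsilon>\<close> hold down to \<open>k = 0\<close> and control what happens at the threshold. The bounds with \<open>\<epsilon>\<^sup>2\<close>
are good enough for the second order remainder, but only for \<open>k\<close> away from \<open>0\<close>.\<close>
lemma slopes: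
  assumes e: "0 < e" "e \<le> 1" and k: "0 < k"
  shows "\<bar>pu e k (-R) - k\<bar> \<le> e * sqrt M" "\<bar>right_slope (scaled_potential e) R (R / e) k - k\<bar> \<le> e * sqrt M"
    "\<bar>pu e k (-R) - k\<bar> \<le> e\<^sup>2 * M / (2 * k)" "\<bar>right_slope (scaled_potential e) R (R / e) k - k\<bar> \<le> e\<^sup>2 * M / (2 * k)"
proof -
  note n = norm_sol[OF well_scaled_potential[OF e] k]
  have sM: "(sqrt M)\<^sup>2 = M" using M by simp
  have 1: "k \<le> k + e * sqrt M" "k\<^sup>2 + (e * sqrt M)\<^sup>2 \<le> (k + e * sqrt M)\<^sup>2" using e k M by (auto simp: power2_sum)
  have 2: "k \<le> k + e\<^sup>2 * M / (2 * k)" using e k M by auto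
  have 3: "k\<^sup>2 + (e * sqrt M)\<^sup>2 \<le> (k + e\<^sup>2 * M / (2 * k))\<^sup>2"
    using k unfolding power_mult_distrib sM power2_sum by simp
  show "\<bar>pu e k (-R) - k\<bar> \<le> e * sqrt M" using n(3) n(4)[OF 1] by simp
  show "\<bar>right_slope (scaled_potential e) R (R / e) k - k\<bar> \<le> e * sqrt M" using n(6) n(7)[OF 1] by simp
  show "\<bar>pu e k (-R) - k\<bar> \<le> e\<^sup>2 * M / (2 * k)" using n(3) n(4)[OF 2 3] by simp
  show "\<bar>right_slope (scaled_potential e) R (R / e) k - k\<bar> \<le> e\<^sup>2 * M / (2 * k)" using n(6) n(7)[OF 2 3] by simp
qed

lemma v: "solves (\<lambda>x. V x + k\<^sup>2) (v k) (pv k)" "v k (- R) = 1" "pv k (- R) = k"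
  using left_sol_pair[OF well_V] by auto

lemma v_bound: "\<exists>B\<ge>1. \<forall>k\<in>{0..K}. \<forall>x\<in>{-R..R}. \<bar>v k x\<bar> \<le> B \<and> \<bar>pv k x\<bar> \<le> B"
proof -
  define B where "B = exp ((2 + (M + K\<^sup>2)) * (R - (-R))) * (1 + K + (1 + (R - (-R))) * (0 * 0))"
  have "1 * 1 \<le> B" unfolding B_def using R K M by (intro mult_mono) auto
  moreover have "\<bar>v k x\<bar> \<le> B \<and> \<bar>pv k x\<bar> \<le> B" if k: "k \<in> {0..K}" and x: "x \<in> {-R..R}" for k x
  proof -
    have b: "\<bar>V t + k\<^sup>2\<bar> \<le> M + K\<^sup>2" for t
    proof -
      have "k\<^sup>2 \<le> K\<^sup>2" using k by (intro power_mono) auto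
      then show ?thesis using abs_triangle_ineq[of "V t" "k\<^sup>2"] bound(2)[of t] by simp
    qed
    have z: "solves (\<lambda>x. V x + k\<^sup>2) (\<lambda>x. 0) (\<lambda>x. 0)" using solves_cmult[OF v(1)[of k], of 0] by simp
    have "0 \<le> M + K\<^sup>2" using M by simp
    note sc = solves_close[OF v(1)[of k] z x this, of 0 0]
    have "exp ((2 + (M + K\<^sup>2)) * (R - (-R))) * (\<bar>v k (-R) - 0\<bar> + \<bar>pv k (-R) - 0\<bar> + (1 + (R - (-R))) * (0 * 0)) \<le> B"
      unfolding B_def v(2,3) using k by (intro mult_left_mono) auto
    moreover have "\<bar>v k x\<bar> \<le> exp ((2 + (M + K\<^sup>2)) * (R - (-R))) * (\<bar>v k (-R) - 0\<bar> + \<bar>pv k (-R) - 0\<bar> + (1 + (R - (-R))) * (0 * 0))"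
     "\<bar>pv k x\<bar> \<le> exp ((2 + (M + K\<^sup>2)) * (R - (-R))) * (\<bar>v k (-R) - 0\<bar> + \<bar>pv k (-R) - 0\<bar> + (1 + (R - (-R))) * (0 * 0))"
      using sc b by auto
    ultimately show ?thesis by linarith
  qed
  ultimately show ?thesis by auto
qed

text \<open>A bound for the unperturbed solutions, uniform in the energy; it enters all constants below.\<close>
definition "B = (SOME B. B \<ge> 1 \<and> (\<forall>k\<in>{0..K}. \<forall>x\<in>{-R..R}. \<bar>v k x\<bar> \<le> B \<and> \<bar>pv k x\<bar> \<le> B))"

lemma B: "1 \<le> B" "\<And>k x. k \<in> {0..K} \<Longrightarrow> x \<in> {-R..R} \<Longrightarrow> \<bar>v k x\<bar> \<le> B" "\<And>k x. k \<in> {0..K} \<Longrightarrow> x \<in> {-R..R} \<Longrightarrow> \<bar>pv k x\<bar> \<le> B"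
  using someI_ex[OF v_bound[unfolded bex_simps]] unfolding B_def[symmetric] by blast+

text \<open>The Gronwall factor over \<open>[-R, R]\<close> times the Lipschitz constants of the data and of the source term.\<close>
definition "C = exp ((2 + (3 * M + K\<^sup>2)) * (R - (-R))) * (1 + sqrt M + (1 + (R - (-R))) * (2 * (M + K) * B))"

lemma C: "1 \<le> C"
proof -
  have "1 * (1 + 0 + 0) \<le> C" unfolding C_def using R K M B by (intro mult_mono add_mono) auto
  then show ?thesis by simp
qed

text \<open>On \<open>[-R, R]\<close> the data at \<open>- R\<close> and the potentials differ by \<open>O(\<epsilon> + \<bar>k - k0\<bar>)\<close>, with constants that do not see \<open>R / \<epsilon>\<close>.\<close>
lemma u_close:
  assumes e: "0 < e" "e \<le> 1" and k: "0 < k" "k \<le> K" and k0: "k0 \<in> {0..K}" and x: "x \<in> {-R..R}"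
  shows "\<bar>u e k x - v k0 x\<bar> \<le> C * (e + \<bar>k - k0\<bar>)" "\<bar>pu e k x - pv k0 x\<bar> \<le> C * (e + \<bar>k - k0\<bar>)"
proof -
  note n = norm_sol[OF well_scaled_potential[OF e] k(1)]
  define t where "t = e + \<bar>k - k0\<bar>"
  have b: "\<bar>scaled_potential e s + k\<^sup>2\<bar> \<le> 3 * M + K\<^sup>2" for s
  proof -
    have "k\<^sup>2 \<le> K\<^sup>2" using k by (intro power_mono) auto
    then show ?thesis using abs_triangle_ineq[of "scaled_potential e s" "k\<^sup>2"] scaled_potential_bound[of e s] e by simp
  qed
  have d: "\<bar>(scaled_potential e s + k\<^sup>2) - (V s + k0\<^sup>2)\<bar> \<le> 2 * (M + K) * t" for s
  proof -
    have "\<bar>k\<^sup>2 - k0\<^sup>2\<bar> = \<bar>k + k0\<bar> * \<bar>k - k0\<bar>" by (simp add: power2_eq_square abs_mult[symmetric] algebra_simps)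
    also have "\<dots> \<le> 2 * K * \<bar>k - k0\<bar>" using k k0 by (intro mult_right_mono) auto
    finally have "\<bar>k\<^sup>2 - k0\<^sup>2\<bar> \<le> 2 * K * \<bar>k - k0\<bar>" .
    then have "\<bar>(scaled_potential e s + k\<^sup>2) - (V s + k0\<^sup>2)\<bar> \<le> 2 * M * e + 2 * K * \<bar>k - k0\<bar>"
      using scaled_potential_diff[of e s] e by linarith
    also have "\<dots> \<le> 2 * (M + K) * t"
      unfolding t_def using e K M by (simp add: algebra_simps)
    finally show ?thesis .
  qed
  have "\<bar>pu e k (-R) - k0\<bar> \<le> (1 + sqrt M) * t"
  proof -
    have "\<bar>pu e k (-R) - k0\<bar> \<le> e * sqrt M + \<bar>k - k0\<bar>" using slopes(1)[OF e k(1)] by linarith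
    also have "\<dots> \<le> (1 + sqrt M) * t" unfolding t_def using e M by (simp add: algebra_simps)
    finally show ?thesis .
  qed
  then have "\<bar>u e k (-R) - v k0 (-R)\<bar> + \<bar>pu e k (-R) - pv k0 (-R)\<bar> + (1 + (R - (-R))) * (2 * (M + K) * t * B)
      \<le> (1 + sqrt M) * t + (1 + (R - (-R))) * (2 * (M + K) * t * B)"
    using n(2) v(2,3)[of k0] by simp
  also have "\<dots> = (1 + sqrt M + (1 + (R - (-R))) * (2 * (M + K) * B)) * t" by (simp add: algebra_simps)
  finally have c: "exp ((2 + (3 * M + K\<^sup>2)) * (R - (-R))) * (\<bar>u e k (-R) - v k0 (-R)\<bar> + \<bar>pu e k (-R) - pv k0 (-R)\<bar> + (1 + (R - (-R))) * (2 * (M + K) * t * B))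
     \<le> C * t" unfolding C_def mult.assoc by (intro mult_left_mono) auto
  have "0 \<le> 3 * M + K\<^sup>2" using M by simp
  note sc = solves_close[OF n(1) v(1)[of k0] x this b d B(2)[OF k0]]
  show "\<bar>u e k x - v k0 x\<bar> \<le> C * (e + \<bar>k - k0\<bar>)"
    unfolding t_def[symmetric] by (rule order_trans[OF sc(1) c])
  show "\<bar>pu e k x - pv k0 x\<bar> \<le> C * (e + \<bar>k - k0\<bar>)"
    unfolding t_def[symmetric] by (rule order_trans[OF sc(2) c])
qed

lemma G_close:
  assumes e: "0 < e" "e \<le> 1" and k: "0 < k" "k \<le> K"
  shows "\<bar>G e k - D0 k\<bar> \<le> (C + K * C + sqrt M * (B + C)) * e"
proof -
  have kk: "k \<in> {0..K}" and RR: "R \<in> {-R..R}" using k R by auto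
  note c = u_close[OF e k kk RR, simplified]
  define m where "m = right_slope (scaled_potential e) R (R / e) k"
  have m: "\<bar>m - k\<bar> \<le> e * sqrt M" using slopes(2)[OF e k(1)] by (simp add: m_def)
  have "\<bar>u e k R\<bar> \<le> B + C * e" using c(1) B(2)[OF kk RR] by linarith
  also have "\<dots> \<le> B + C" using C e by (simp add: mult_left_le)
  finally have ub: "\<bar>u e k R\<bar> \<le> B + C" .
  have "G e k - D0 k = (pu e k R - pv k R) + (m - k) * u e k R + k * (u e k R - v k R)"
    by (simp add: reduced_evans_def evans_def m_def algebra_simps)
  then have "\<bar>G e k - D0 k\<bar> \<le> \<bar>pu e k R - pv k R\<bar> + \<bar>m - k\<bar> * \<bar>u e k R\<bar> + k * \<bar>u e k R - v k R\<bar>"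
  proof -
    have "\<bar>X + Y + Z\<bar> \<le> \<bar>X\<bar> + \<bar>Y\<bar> + \<bar>Z\<bar>" for X Y Z :: real by linarith
    from this[of "pu e k R - pv k R" "(m - k) * u e k R" "k * (u e k R - v k R)"] show ?thesis
      unfolding \<open>G e k - D0 k = _\<close> abs_mult using k by simp
  qed
  also have "\<dots> \<le> C * e + (e * sqrt M) * (B + C) + K * (C * e)"
    using c m ub k C B e M by (intro add_mono mult_mono) auto
  finally show ?thesis by (simp add: algebra_simps)
qed

section \<open>First order expansion of the shooting function\<close>

definition "core_mass k0 = integral {-R..R} (\<lambda>x. v k0 x * v k0 x)"
definition "coupling k0 = integral {-R..R} (\<lambda>x. U x * (v k0 x * v k0 x))"
text \<open>For a root \<open>k0 > 0\<close> this is \<open>2 k0\<close> times the squared norm of the eigenfunction \<open>v k0\<close> on the whole line: the two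
exponential tails contribute \<open>1 / (2 k0)\<close> and \<open>(v k0 R)\<^sup>2 / (2 k0)\<close>. It is the derivative of the shooting function at the
root, up to the factor \<open>v k0 R\<close>.\<close>
definition "root_slope k0 = 1 + (v k0 R)\<^sup>2 + 2 * k0 * core_mass k0"

lemma locally_bounded_U: "locally_bounded U" using meas(1) bound(1) by (rule locally_bounded_bounded)
lemma locally_bounded_v: "locally_bounded (v k)" using v(1) by (rule solvesD)

lemma core_mass_nonneg: "0 \<le> core_mass k0"
  unfolding core_mass_def by (intro integral_nonneg locally_bounded_integrable locally_bounded_mult locally_bounded_v) simp

lemma root_slope_ge: "0 \<le> k0 \<Longrightarrow> 1 \<le> root_slope k0"
  unfolding root_slope_def using core_mass_nonneg by simp

lemma u_bound:
  assumes e: "0 < e" "e \<le> 1" and k: "0 < k" "k \<le> K" and x: "x \<in> {-R..R}"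
  shows "\<bar>u e k x\<bar> \<le> B + C"
proof -
  have kk: "k \<in> {0..K}" using k by auto
  have "\<bar>u e k x - v k x\<bar> \<le> C * e" using u_close(1)[OF e k kk x] by simp
  also have "\<dots> \<le> C" using C e by (simp add: mult_left_le)
  finally show ?thesis using B(2)[OF kk x] by linarith
qed

text \<open>Green's identity on \<open>[-R, R]\<close> between the perturbed and the unperturbed solution. The boundary term at \<open>R\<close> contains \<open>G\<close>
because \<open>v\<close> has slope \<open>- k0\<close> there.\<close>
lemma green:
  assumes e: "0 < e" "e \<le> 1" and k: "0 < k" and d: "D0 k0 = 0"
  shows "((\<lambda>x. (scaled_potential e x - V x + k\<^sup>2 - k0\<^sup>2) * (u e k x * v k0 x)) has_integral
      (v k0 R * G e k - (pu e k (-R) - k0) - (right_slope (scaled_potential e) R (R / e) k - k0) * (u e k R * v k0 R))) {-R..R}"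
proof -
  note n = norm_sol[OF well_scaled_potential[OF e] k]
  have "primitive (\<lambda>x. (scaled_potential e x - V x + k\<^sup>2 - k0\<^sup>2) * (u e k x * v k0 x)) (\<lambda>x. pu e k x * v k0 x - u e k x * pv k0 x)"
    by (rule primitive_cong[OF solves_wronskian[OF n(1) v(1)[of k0]]]) (auto simp: algebra_simps)
  moreover have "-R \<le> R" using R by simp
  ultimately have "((\<lambda>x. (scaled_potential e x - V x + k\<^sup>2 - k0\<^sup>2) * (u e k x * v k0 x)) has_integral
      ((pu e k R * v k0 R - u e k R * pv k0 R) - (pu e k (-R) * v k0 (-R) - u e k (-R) * pv k0 (-R)))) {-R..R}"
    unfolding primitive_def by blast
  moreover have "pv k0 R = - k0 * v k0 R" using d by (simp add: evans_def)
  moreover have "(pu e k R * v k0 R - u e k R * (- k0 * v k0 R)) - (pu e k (-R) * 1 - 1 * k0) =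
    v k0 R * G e k - (pu e k (-R) - k0) - (right_slope (scaled_potential e) R (R / e) k - k0) * (u e k R * v k0 R)"
    by (simp add: reduced_evans_def algebra_simps)
  ultimately show ?thesis unfolding n(2) v(2,3)[of k0] by (simp only:)
qed

text \<open>The central formula. In Green's identity \<open>u\<close> may be replaced by \<open>v\<close> at the cost of a second order error, since \<open>u - v\<close>
is of first order and is multiplied by a difference of potentials, itself of first order.\<close>
lemma expansion:
  assumes k0: "k0 \<in> {0..K}" and d: "D0 k0 = 0"
  shows "\<exists>A\<ge>0. \<forall>e k. 0 < e \<longrightarrow> e \<le> 1 \<longrightarrow> 0 < k \<longrightarrow> k \<le> K \<longrightarrow>
    \<bar>v k0 R * G e k - (k - k0) * root_slope k0 - e * coupling k0\<bar> \<le>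
      A * ((e + \<bar>k - k0\<bar>)\<^sup>2 + \<bar>pu e k (-R) - k\<bar> + \<bar>right_slope (scaled_potential e) R (R / e) k - k\<bar>)"
proof -
  define A1 where "A1 = (M + 2 * K) * (C * B) + (M + 1) * ((B + C) * B)"
  define A where "A = 2 * R * A1 + 1 + (B + C) * B + C * B"
  have pos: "0 \<le> B" "0 \<le> C" "0 \<le> K" "0 \<le> M" using B C K M by auto
  have A1: "0 \<le> A1" unfolding A1_def using pos by simp
  have A0: "0 \<le> A" unfolding A_def using pos R A1 by simp
  show ?thesis
  proof (intro exI[of _ A] conjI A0 allI impI)
    fix e k :: real assume e: "0 < e" "e \<le> 1" and k: "0 < k" "k \<le> K"
    note n = norm_sol[OF well_scaled_potential[OF e] k(1)]
    define t where "t = e + \<bar>k - k0\<bar>"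
    define m where "m = pu e k (-R)"
    define m' where "m' = right_slope (scaled_potential e) R (R / e) k"
    have t0: "0 \<le> t" using e by (simp add: t_def)
    let ?X = "v k0 R * G e k - (m - k0) - (m' - k0) * (u e k R * v k0 R)"
    (* the integrand of Green's identity minus its first order part *)
    define f where "f x = (scaled_potential e x - V x + k\<^sup>2 - k0\<^sup>2) * (u e k x * v k0 x) - (2 * k0 * (k - k0) * (v k0 x * v k0 x) + e * (U x * (v k0 x * v k0 x)))" for x
    have "(f has_integral (?X - (2 * k0 * (k - k0) * core_mass k0 + e * coupling k0))) {-R..R}"
      unfolding f_def[abs_def] core_mass_def coupling_def m_def m'_def
      by (intro has_integral_diff has_integral_add has_integral_mult_right green e k d
           integrable_integral locally_bounded_integrable locally_bounded_mult locally_bounded_U locally_bounded_v)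
    then have I: "(f has_integral (?X - (2 * k0 * (k - k0) * core_mass k0 + e * coupling k0))) (cbox (-R) R)" by simp
    have fb: "norm (f x) \<le> A1 * t\<^sup>2" if x: "x \<in> cbox (-R) R - {}" for x
    proof -
      have x: "x \<in> {-R..R}" using that by simp
      have uv: "\<bar>u e k x - v k0 x\<bar> \<le> C * t" using u_close(1)[OF e k k0 x] by (simp add: t_def)
      have f: "f x = (e * U x + 2 * k0 * (k - k0)) * ((u e k x - v k0 x) * v k0 x) + (e\<^sup>2 * W (e * x) + (k - k0)\<^sup>2) * (u e k x * v k0 x)"
        by (simp add: f_def scaled_potential_def power2_eq_square algebra_simps)
      have "\<bar>e * U x + 2 * k0 * (k - k0)\<bar> \<le> (M + 2 * K) * t"
      proof -
        have "\<bar>e * U x\<bar> \<le> t * M" unfolding abs_mult using e bound(1) t0 pos by (intro mult_mono) (auto simp: t_def)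
        moreover have "\<bar>2 * k0 * (k - k0)\<bar> \<le> 2 * K * t" unfolding abs_mult using k0 e pos by (intro mult_mono) (auto simp: t_def)
        ultimately show ?thesis by (simp add: algebra_simps abs_le_iff)
      qed
      moreover have "\<bar>(u e k x - v k0 x) * v k0 x\<bar> \<le> (C * t) * B"
        unfolding abs_mult using uv B(2)[OF k0 x] pos t0 by (intro mult_mono) auto
      ultimately have 1: "\<bar>(e * U x + 2 * k0 * (k - k0)) * ((u e k x - v k0 x) * v k0 x)\<bar> \<le> ((M + 2 * K) * t) * ((C * t) * B)"
        unfolding abs_mult[of "e * U x + 2 * k0 * (k - k0)"] using pos t0 by (intro mult_mono) auto
      have "\<bar>e\<^sup>2 * W (e * x) + (k - k0)\<^sup>2\<bar> \<le> (M + 1) * t\<^sup>2"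
      proof -
        have "e\<^sup>2 \<le> t\<^sup>2" using e by (intro power_mono) (auto simp: t_def)
        then have "e\<^sup>2 * W (e * x) \<le> t\<^sup>2 * M" using bound(3,4) pos by (intro mult_mono) auto
        moreover have "\<bar>k - k0\<bar>\<^sup>2 \<le> t\<^sup>2" using e by (intro power_mono) (auto simp: t_def)
        moreover have "0 \<le> e\<^sup>2 * W (e * x)" using bound(3) by simp
        ultimately show ?thesis by (simp add: algebra_simps)
      qed
      moreover have "\<bar>u e k x * v k0 x\<bar> \<le> (B + C) * B"
        unfolding abs_mult using u_bound[OF e k x] B(2)[OF k0 x] pos by (intro mult_mono) auto
      ultimately have 2: "\<bar>(e\<^sup>2 * W (e * x) + (k - k0)\<^sup>2) * (u e k x * v k0 x)\<bar> \<le> ((M + 1) * t\<^sup>2) * ((B + C) * B)"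
        unfolding abs_mult[of "e\<^sup>2 * W (e * x) + (k - k0)\<^sup>2"] using pos t0 by (intro mult_mono) auto
      have "\<bar>f x\<bar> \<le> ((M + 2 * K) * t) * ((C * t) * B) + ((M + 1) * t\<^sup>2) * ((B + C) * B)"
        unfolding f using 1 2 by linarith
      also have "\<dots> = A1 * t\<^sup>2" by (simp add: A1_def power2_eq_square algebra_simps)
      finally show ?thesis by simp
    qed
    have "norm (?X - (2 * k0 * (k - k0) * core_mass k0 + e * coupling k0)) \<le> (A1 * t\<^sup>2) * measure lborel (cbox (-R) R)"
      by (rule has_integral_bound_spike_finite[OF _ _ I fb]) (use A1 in auto)
    then have X: "\<bar>?X - (2 * k0 * (k - k0) * core_mass k0 + e * coupling k0)\<bar> \<le> 2 * R * A1 * t\<^sup>2"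
      using R by (simp add: mult_ac)
    have RR: "R \<in> {-R..R}" using R by simp
    have uR: "\<bar>u e k R - v k0 R\<bar> \<le> C * t" using u_close(1)[OF e k k0 RR] by (simp add: t_def)
    have "\<bar>u e k R * v k0 R\<bar> \<le> (B + C) * B"
      unfolding abs_mult using u_bound[OF e k RR] B(2)[OF k0 RR] pos by (intro mult_mono) auto
    then have 3: "\<bar>(m' - k) * (u e k R * v k0 R)\<bar> \<le> \<bar>m' - k\<bar> * ((B + C) * B)"
      unfolding abs_mult[of "m' - k"] by (intro mult_left_mono) auto
    have 4: "\<bar>(k - k0) * ((u e k R - v k0 R) * v k0 R)\<bar> \<le> t * ((C * t) * B)"
      unfolding abs_mult using uR B(2)[OF k0 RR] pos t0 e by (intro mult_mono) (auto simp: t_def)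
    have eq: "v k0 R * G e k - (k - k0) * root_slope k0 - e * coupling k0 =
      (?X - (2 * k0 * (k - k0) * core_mass k0 + e * coupling k0)) + (m - k) + (m' - k) * (u e k R * v k0 R) + (k - k0) * ((u e k R - v k0 R) * v k0 R)"
      by (simp add: root_slope_def power2_eq_square algebra_simps)
    have "\<bar>v k0 R * G e k - (k - k0) * root_slope k0 - e * coupling k0\<bar> \<le> 2 * R * A1 * t\<^sup>2 + \<bar>m - k\<bar> + \<bar>m' - k\<bar> * ((B + C) * B) + t * ((C * t) * B)"
      unfolding eq using X 3 4 by linarith
    also have "\<dots> = (2 * R * A1 + C * B) * t\<^sup>2 + 1 * \<bar>m - k\<bar> + ((B + C) * B) * \<bar>m' - k\<bar>"
      by (simp add: power2_eq_square algebra_simps)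
    also have "\<dots> \<le> A * t\<^sup>2 + A * \<bar>m - k\<bar> + A * \<bar>m' - k\<bar>"
      unfolding A_def using pos A1 R by (intro add_mono mult_right_mono) auto
    finally show "\<bar>v k0 R * G e k - (k - k0) * root_slope k0 - e * coupling k0\<bar> \<le>
      A * ((e + \<bar>k - k0\<bar>)\<^sup>2 + \<bar>pu e k (-R) - k\<bar> + \<bar>right_slope (scaled_potential e) R (R / e) k - k\<bar>)"
      by (simp add: distrib_left m_def m'_def t_def)
  qed
qed

lemma sum_square_le: "(e + \<bar>d\<bar>)\<^sup>2 \<le> 2 * e\<^sup>2 + 2 * d\<^sup>2" for e d :: real
  using sum_squares_bound[of e "\<bar>d\<bar>"] by (simp add: power2_sum)

text \<open>Here \<open>k0 = 0\<close> is allowed. The term \<open>\<epsilon> \<integral> U v\<^sup>2\<close> and the slopes are absorbed into the error \<open>O(\<epsilon>)\<close>.\<close>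
lemma expansion_coarse:
  assumes k0: "k0 \<in> {0..K}" and d: "D0 k0 = 0"
  shows "\<exists>A\<ge>1. \<forall>e k. 0 < e \<longrightarrow> e \<le> 1 \<longrightarrow> 0 < k \<longrightarrow> k \<le> K \<longrightarrow>
    \<bar>v k0 R * G e k - (k - k0) * root_slope k0\<bar> \<le> A * (e + (k - k0)\<^sup>2)"
proof -
  obtain A where A: "A \<ge> 0" "\<And>e k. 0 < e \<Longrightarrow> e \<le> 1 \<Longrightarrow> 0 < k \<Longrightarrow> k \<le> K \<Longrightarrow>
    \<bar>v k0 R * G e k - (k - k0) * root_slope k0 - e * coupling k0\<bar> \<le>
      A * ((e + \<bar>k - k0\<bar>)\<^sup>2 + \<bar>pu e k (-R) - k\<bar> + \<bar>right_slope (scaled_potential e) R (R / e) k - k\<bar>)"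
    using expansion[OF assms] by blast
  define A' where "A' = 1 + \<bar>coupling k0\<bar> + A * (2 + 2 * sqrt M)"
  have "A' \<ge> 1" unfolding A'_def using A M by simp
  moreover have "\<bar>v k0 R * G e k - (k - k0) * root_slope k0\<bar> \<le> A' * (e + (k - k0)\<^sup>2)"
    if e: "0 < e" "e \<le> 1" and k: "0 < k" "k \<le> K" for e k
  proof -
    have "e\<^sup>2 \<le> e" using e by (simp add: power2_eq_square mult_left_le)
    then have "(e + \<bar>k - k0\<bar>)\<^sup>2 + \<bar>pu e k (-R) - k\<bar> + \<bar>right_slope (scaled_potential e) R (R / e) k - k\<bar> \<le> 2 * e + 2 * (k - k0)\<^sup>2 + 2 * (e * sqrt M)"
      using sum_square_le[of e "k - k0"] slopes(1,2)[OF e k(1)] by linarith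
    also have "\<dots> \<le> (2 + 2 * sqrt M) * (e + (k - k0)\<^sup>2)" using e M by (simp add: algebra_simps)
    finally have "A * ((e + \<bar>k - k0\<bar>)\<^sup>2 + \<bar>pu e k (-R) - k\<bar> + \<bar>right_slope (scaled_potential e) R (R / e) k - k\<bar>)
       \<le> A * ((2 + 2 * sqrt M) * (e + (k - k0)\<^sup>2))"
      using A(1) by (rule mult_left_mono)
    moreover have "\<bar>e * coupling k0\<bar> \<le> (1 + \<bar>coupling k0\<bar>) * (e + (k - k0)\<^sup>2)"
      using e by (simp add: abs_mult algebra_simps)
    moreover have "A' * (e + (k - k0)\<^sup>2) = (1 + \<bar>coupling k0\<bar>) * (e + (k - k0)\<^sup>2) + A * ((2 + 2 * sqrt M) * (e + (k - k0)\<^sup>2))"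
      by (simp add: A'_def algebra_simps)
    ultimately show ?thesis using A(2)[OF e k] by linarith
  qed
  ultimately show ?thesis by blast
qed

text \<open>Away from the threshold the slopes contribute \<open>O(\<epsilon>\<^sup>2)\<close> only.\<close>
lemma expansion_fine:
  assumes k0: "0 < k0" "k0 \<le> K" and d: "D0 k0 = 0"
  shows "\<exists>A\<ge>0. \<forall>e k. 0 < e \<longrightarrow> e \<le> 1 \<longrightarrow> k0 / 2 \<le> k \<longrightarrow> k \<le> K \<longrightarrow>
    \<bar>v k0 R * G e k - (k - k0) * root_slope k0 - e * coupling k0\<bar> \<le> A * (e\<^sup>2 + (k - k0)\<^sup>2)"
proof -
  have "k0 \<in> {0..K}" using k0 by auto
  then obtain A where A: "A \<ge> 0" "\<And>e k. 0 < e \<Longrightarrow> e \<le> 1 \<Longrightarrow> 0 < k \<Longrightarrow> k \<le> K \<Longrightarrow>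
    \<bar>v k0 R * G e k - (k - k0) * root_slope k0 - e * coupling k0\<bar> \<le>
      A * ((e + \<bar>k - k0\<bar>)\<^sup>2 + \<bar>pu e k (-R) - k\<bar> + \<bar>right_slope (scaled_potential e) R (R / e) k - k\<bar>)"
    using expansion[OF _ d] by blast
  have "\<bar>v k0 R * G e k - (k - k0) * root_slope k0 - e * coupling k0\<bar> \<le> (A * (2 + 2 * M / k0)) * (e\<^sup>2 + (k - k0)\<^sup>2)"
    if e: "0 < e" "e \<le> 1" and k: "k0 / 2 \<le> k" "k \<le> K" for e k
  proof -
    have kp: "0 < k" using k k0 by simp
    have "e\<^sup>2 * M / (2 * k) \<le> e\<^sup>2 * M / k0" using k k0 M by (intro divide_left_mono) auto
    then have "(e + \<bar>k - k0\<bar>)\<^sup>2 + \<bar>pu e k (-R) - k\<bar> + \<bar>right_slope (scaled_potential e) R (R / e) k - k\<bar> \<le> 2 * e\<^sup>2 + 2 * (k - k0)\<^sup>2 + 2 * (e\<^sup>2 * M / k0)"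
      using sum_square_le[of e "k - k0"] slopes(3,4)[OF e kp] by linarith
    also have "\<dots> \<le> (2 + 2 * M / k0) * (e\<^sup>2 + (k - k0)\<^sup>2)" using k0 M by (simp add: algebra_simps)
    finally have "A * ((e + \<bar>k - k0\<bar>)\<^sup>2 + \<bar>pu e k (-R) - k\<bar> + \<bar>right_slope (scaled_potential e) R (R / e) k - k\<bar>)
       \<le> A * ((2 + 2 * M / k0) * (e\<^sup>2 + (k - k0)\<^sup>2))"
      using A(1) by (rule mult_left_mono)
    then show ?thesis using A(2)[OF e kp k(2)] by (simp add: mult.assoc)
  qed
  moreover have "0 \<le> A * (2 + 2 * M / k0)" using A k0 M by simp
  ultimately show ?thesis by blast
qed

text \<open>For \<open>k0 = 0\<close> this says that roots near the threshold are \<open>O(\<epsilon>)\<close>; the corresponding eigenvalues \<open>- (k / \<epsilon>)\<^sup>2\<close> are bounded.\<close>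
lemma root_near:
  assumes k0: "k0 \<in> {0..K}" and d: "D0 k0 = 0"
  shows "\<exists>\<delta>>0. \<exists>A. \<forall>e k. 0 < e \<longrightarrow> e \<le> 1 \<longrightarrow> 0 < k \<longrightarrow> k \<le> K \<longrightarrow> \<bar>k - k0\<bar> < \<delta> \<longrightarrow> G e k = 0 \<longrightarrow> \<bar>k - k0\<bar> \<le> A * e"
proof -
  obtain A where A: "A \<ge> 1" "\<And>e k. 0 < e \<Longrightarrow> e \<le> 1 \<Longrightarrow> 0 < k \<Longrightarrow> k \<le> K \<Longrightarrow>
    \<bar>v k0 R * G e k - (k - k0) * root_slope k0\<bar> \<le> A * (e + (k - k0)\<^sup>2)"
    using expansion_coarse[OF assms] by blast
  have "\<bar>k - k0\<bar> \<le> (2 * A) * e" if e: "0 < e" "e \<le> 1" and k: "0 < k" "k \<le> K" and kk: "\<bar>k - k0\<bar> < 1 / (2 * A)" and g: "G e k = 0" for e k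
  proof -
    have "\<bar>(k - k0) * root_slope k0\<bar> \<le> A * (e + (k - k0)\<^sup>2)" using A(2)[OF e k] g by simp
    moreover have "\<bar>k - k0\<bar> * 1 \<le> \<bar>(k - k0) * root_slope k0\<bar>"
      unfolding abs_mult using root_slope_ge[of k0] k0 by (intro mult_left_mono) auto
    moreover have "A * (k - k0)\<^sup>2 \<le> \<bar>k - k0\<bar> / 2"
    proof -
      have "A * (k - k0)\<^sup>2 = (A * \<bar>k - k0\<bar>) * \<bar>k - k0\<bar>" by (simp add: power2_eq_square mult.assoc)
      also have "\<dots> \<le> (1 / 2) * \<bar>k - k0\<bar>"
        using kk A(1) by (intro mult_right_mono) (auto simp: field_simps)
      finally show ?thesis by simp
    qed
    ultimately show ?thesis by (simp add: algebra_simps)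
  qed
  then show ?thesis using A(1) by (intro exI[of _ "1 / (2 * A)"] conjI exI[of _ "2 * A"]) auto
qed

text \<open>By the coarse expansion the shooting function has opposite signs at \<open>k0 \<plusminus> h\<close> as soon as \<open>h\<close> exceeds the error
\<open>A (\<epsilon> + h\<^sup>2)\<close>; for small \<open>\<epsilon>\<close> the choice \<open>h = 2 A \<epsilon>\<close> does.\<close>
lemma root_exists:
  assumes k0: "0 < k0" "k0 < K" and d: "D0 k0 = 0"
  shows "\<exists>A. \<exists>e0>0. e0 \<le> 1 \<and> (\<forall>e. 0 < e \<longrightarrow> e < e0 \<longrightarrow> (\<exists>k. 0 < k \<and> k < K \<and> N e k = 0 \<and> \<bar>k - k0\<bar> \<le> A * e))"
proof -
  have kk: "k0 \<in> {0..K}" using k0 by auto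
  obtain A where A: "A \<ge> 1" "\<And>e k. 0 < e \<Longrightarrow> e \<le> 1 \<Longrightarrow> 0 < k \<Longrightarrow> k \<le> K \<Longrightarrow>
    \<bar>v k0 R * G e k - (k - k0) * root_slope k0\<bar> \<le> A * (e + (k - k0)\<^sup>2)"
    using expansion_coarse[OF kk d] by blast
  define e0 where "e0 = min (1 / (16 * A\<^sup>2)) (min (k0 / (4 * A)) ((K - k0) / (4 * A)))"
  have e0: "0 < e0" using A k0 by (simp add: e0_def)
  have A2: "1 \<le> A\<^sup>2" using A(1) by simp
  then have "1 / (16 * A\<^sup>2) \<le> 1 / 1" by (intro divide_left_mono) auto
  then have e01: "e0 \<le> 1" by (simp add: e0_def)
  have "\<exists>k. 0 < k \<and> k < K \<and> N e k = 0 \<and> \<bar>k - k0\<bar> \<le> (4 * A) * e" if e: "0 < e" "e < e0" for e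
  proof -
    define h where "h = 2 * A * e"
    have e1: "e \<le> 1" using e e01 by simp
    have ea: "16 * A\<^sup>2 * e < 1" "4 * A * e < k0" "4 * A * e < K - k0"
      using e A(1) A2 by (auto simp: e0_def pos_less_divide_eq mult_ac)
    have hp: "0 < h" using e A by (simp add: h_def)
    have hA: "A * (e + h\<^sup>2) < h"
    proof -
      have "h\<^sup>2 = (4 * A\<^sup>2 * e) * e" by (simp add: h_def power2_eq_square algebra_simps)
      also have "\<dots> < 1 * e" using ea e by (intro mult_strict_right_mono) auto
      finally have "A * (e + h\<^sup>2) < A * (e + e)" using A(1) by simp
      then show ?thesis by (simp add: h_def)
    qed
    have k12: "0 < k0 - h" "k0 + h < K" using ea hp by (auto simp: h_def)
    have hb: "h \<le> h * root_slope k0" using root_slope_ge[of k0] k0 hp by simp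
    have hi: "0 < v k0 R * G e (k0 + h)"
    proof -
      have "\<bar>v k0 R * G e (k0 + h) - h * root_slope k0\<bar> \<le> A * (e + h\<^sup>2)"
        using A(2)[of e "k0 + h"] e e1 k12 hp k0 by simp
      then show ?thesis using hA hb by linarith
    qed
    have lo: "v k0 R * G e (k0 - h) < 0"
    proof -
      have "\<bar>v k0 R * G e (k0 - h) - (- h) * root_slope k0\<bar> \<le> A * (e + h\<^sup>2)"
        using A(2)[of e "k0 - h"] e e1 k12 hp k0 by simp
      then show ?thesis using hA hb by linarith
    qed
    obtain c1 where c1: "c1 > 0" "N e (k0 + h) = c1 * G e (k0 + h)"
      using norm_sol(8)[OF well_scaled_potential[OF e(1) e1], of "k0 + h"] k0 hp by auto
    obtain c2 where c2: "c2 > 0" "N e (k0 - h) = c2 * G e (k0 - h)"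
      using norm_sol(8)[OF well_scaled_potential[OF e(1) e1], of "k0 - h"] k12 by auto
    have "0 \<le> v k0 R * N e (k0 + h)" "v k0 R * N e (k0 - h) \<le> 0"
    proof -
      have "v k0 R * N e (k0 + h) = c1 * (v k0 R * G e (k0 + h))" "v k0 R * N e (k0 - h) = c2 * (v k0 R * G e (k0 - h))"
        unfolding c1(2) c2(2) by (rule mult.left_commute)+
      moreover have "0 < c1 * (v k0 R * G e (k0 + h))" "c2 * (v k0 R * G e (k0 - h)) < 0"
        using hi lo c1(1) c2(1) by (auto intro: mult_pos_pos mult_pos_neg)
      ultimately show "0 \<le> v k0 R * N e (k0 + h)" "v k0 R * N e (k0 - h) \<le> 0" by linarith+
    qed
    moreover have "continuous_on {k0 - h..k0 + h} (\<lambda>k. v k0 R * N e k)"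
      using evans_continuous[OF well_scaled_potential[OF e(1) e1], of K] k12
      by (intro continuous_intros) (auto elim: continuous_on_subset)
    ultimately obtain k where k: "k0 - h \<le> k" "k \<le> k0 + h" "v k0 R * N e k = 0"
      using IVT'[of "\<lambda>k. v k0 R * N e k" "k0 - h" 0 "k0 + h"] hp by auto
    have "v k0 R \<noteq> 0" using hi by auto
    then have "N e k = 0" using k by simp
    then show ?thesis using k k12 hp A e by (intro exI[of _ k]) (auto simp: h_def abs_le_iff)
  qed
  then show ?thesis using e0 e01 by blast
qed

end

section \<open>Counting the roots of the shooting function\<close>

text \<open>Bound states with different energies are orthogonal. The product of two shooting solutions is positive on the left
of \<open>- R\<close>, and on the right of \<open>R\<close> if it is positive at \<open>R\<close>; so its integral cannot vanish if the part over \<open>[-R, R]\<close>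
is positive as well.\<close>
lemma evans_roots_orthogonal:
  assumes w: "well q R S M \<eta>" and k: "0 < k1" "k1 < k2" and e: "evans q S k1 = 0" "evans q S k2 = 0"
    and i: "0 < integral {-R..R} (\<lambda>x. left_sol q S k1 x * left_sol q S k2 x)" and r: "0 < left_sol q S k1 R * left_sol q S k2 R"
  shows False
proof -
  have k2: "0 < k2" using k by simp
  have RS: "0 < R" "R \<le> S" using wellD(3,4)[OF w] by auto
  note l1 = left_sol_pair[OF w, of k1] and l2 = left_sol_pair[OF w, of k2]
  define h where "h x = left_sol q S k1 x * left_sol q S k2 x" for x
  have lh: "locally_bounded h" unfolding h_def[abs_def] by (intro locally_bounded_mult solvesD(6)[OF l1(1)] solvesD(6)[OF l2(1)])
  define A where "A = antideriv h"
  have A: "primitive h A" unfolding A_def by (rule primitive_antideriv[OF lh])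
  have left: "0 < h x" if "x \<le> -R" for x
    unfolding h_def using left_sol_positive(1)[OF w k(1) that] left_sol_positive(1)[OF w k2 that] by simp
  have right: "0 < h x" if x: "R \<le> x" for x
  proof -
    have p: "0 < (left_sol q S k1 S * left_sol q S k2 S) * h x" if "R \<le> x" for x
      using mult_pos_pos[OF evans_zero_right(1)[OF w k(1) e(1) that] evans_zero_right(1)[OF w k2 e(2) that]]
      by (simp add: h_def mult_ac)
    have "0 < left_sol q S k1 S * left_sol q S k2 S"
      by (rule zero_less_mult_pos2[OF p[OF order_refl]]) (use r in \<open>simp add: h_def\<close>)
    then show ?thesis by (rule zero_less_mult_pos[OF p[OF x]])
  qed
  have mid: "(h has_integral (A R - A (-R))) {-R..R}" using A RS by (auto simp: primitive_def)
  have "0 < A R - A (-R)" using i integral_unique[OF mid] by (simp add: h_def[abs_def])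
  moreover have "A (-S) \<le> A (-R)" using RS left by (intro primitive_mono[OF A]) (auto simp: less_imp_le)
  moreover have "A R \<le> A S" using RS right by (intro primitive_mono[OF A]) (auto simp: less_imp_le)
  ultimately have AS: "0 < A S - A (-S)" by linarith
  define w12 where "w12 x = left_deriv q S k1 x * left_sol q S k2 x - left_sol q S k1 x * left_deriv q S k2 x" for x
  have pw: "primitive (\<lambda>x. 0) (\<lambda>x. w12 x - (k1\<^sup>2 - k2\<^sup>2) * A x)"
    by (rule primitive_cong[OF primitive_diff[OF solves_wronskian[OF l1(1) l2(1)] primitive_cmult[OF A, of "k1\<^sup>2 - k2\<^sup>2"]]])
      (auto simp: h_def w12_def)
  have "-S \<le> S" using RS by simp
  from primitive_zero[OF pw this refl]
  have "w12 S - (k1\<^sup>2 - k2\<^sup>2) * A S = w12 (-S) - (k1\<^sup>2 - k2\<^sup>2) * A (-S)" .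
  then have eq: "w12 S - w12 (-S) = (k1\<^sup>2 - k2\<^sup>2) * (A S - A (-S))" by (simp add: algebra_simps)
  have "k1\<^sup>2 < k2\<^sup>2" using k by (intro power_strict_mono) auto
  then have "w12 S - w12 (-S) < 0" unfolding eq using AS by (simp add: mult_neg_pos)
  moreover have "w12 (-S) = k1 - k2" using l1 l2 by (simp add: w12_def)
  moreover have "w12 S = (k2 - k1) * h S"
  proof -
    have "left_deriv q S k1 S = - k1 * left_sol q S k1 S" "left_deriv q S k2 S = - k2 * left_sol q S k2 S" using e by (auto simp: evans_def)
    then show ?thesis by (simp add: w12_def h_def algebra_simps)
  qed
  moreover have "0 < (k2 - k1) * h S" using right[OF RS(2)] k by simp
  ultimately show False using k by linarith
qed

context scaled_wells begin

lemma core_mass_pos: "0 < core_mass k0"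
proof -
  have c: "continuous_on {-R..R} (\<lambda>x. v k0 x * v k0 x)" by (intro continuous_intros solvesD(4)[OF v(1)])
  have "core_mass k0 \<noteq> 0"
    unfolding core_mass_def using integral_eq_0_iff[OF c] R v(2)[of k0] by force
  then show ?thesis using core_mass_nonneg[of k0] by simp
qed

text \<open>Two perturbed eigenfunctions with energies close to the same unperturbed one are both close to \<open>v k0\<close> on \<open>[-R, R]\<close>.
Hence the integral of their product is close to \<open>\<integral> v\<^sup>2 > 0\<close>, and they are not orthogonal.\<close>
lemma root_unique:
  assumes k0: "0 < k0" "k0 \<le> K" and d: "D0 k0 = 0"
  shows "\<exists>\<delta>>0. \<forall>e k1 k2. 0 < e \<longrightarrow> e \<le> 1 \<longrightarrow> e < \<delta> \<longrightarrow> 0 < k1 \<longrightarrow> 0 < k2 \<longrightarrow> N e k1 = 0 \<longrightarrow> N e k2 = 0 \<longrightarrow>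
     \<bar>k1 - k0\<bar> < \<delta> \<longrightarrow> \<bar>k2 - k0\<bar> < \<delta> \<longrightarrow> k1 = k2"
proof -
  have kk: "k0 \<in> {0..K}" using k0 by auto
  have vR: "v k0 R \<noteq> 0" by (rule evans_zero_nonzero_right[OF well_V d])
  have pos: "0 < B" "0 < C" using B C by auto
  define D where "D = C * (2 * B + C)"
  have D: "0 < D" unfolding D_def using pos by simp
  define \<delta> where "\<delta> = min (core_mass k0 / (8 * R * D)) ((v k0 R)\<^sup>2 / (4 * D))"
  have \<delta>: "0 < \<delta>" unfolding \<delta>_def using core_mass_pos R D vR by simp
  have no: False if e: "0 < e" "e \<le> 1" "e < \<delta>" and k: "0 < k1" "k1 < k2" and n: "N e k1 = 0" "N e k2 = 0"
    and n1: "\<bar>k1 - k0\<bar> < \<delta>" and n2: "\<bar>k2 - k0\<bar> < \<delta>" for e k1 k2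
  proof -
    have k2: "0 < k2" using k by simp
    have kK: "k1 \<le> K" "k2 \<le> K" using root_less_K(2)[OF k(1) e(1,2) n(1)] root_less_K(2)[OF k2 e(1,2) n(2)] by auto
    have cl: "\<bar>u e k1 x * u e k2 x - v k0 x * v k0 x\<bar> \<le> 2 * D * \<delta>" if x: "x \<in> {-R..R}" for x
    proof -
      have "C * (e + \<bar>k1 - k0\<bar>) \<le> C * (2 * \<delta>)" "C * (e + \<bar>k2 - k0\<bar>) \<le> C * (2 * \<delta>)"
        using n1 n2 e pos by (auto intro!: mult_left_mono)
      then have 1: "\<bar>u e k1 x - v k0 x\<bar> \<le> C * (2 * \<delta>)" "\<bar>u e k2 x - v k0 x\<bar> \<le> C * (2 * \<delta>)"
        using u_close(1)[OF e(1,2) k(1) kK(1) kk x] u_close(1)[OF e(1,2) k2 kK(2) kk x] by linarith+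
      have "\<bar>(u e k1 x - v k0 x) * u e k2 x\<bar> \<le> (C * (2 * \<delta>)) * (B + C)"
        unfolding abs_mult using 1 u_bound[OF e(1,2) k2 kK(2) x] pos \<delta> by (intro mult_mono) auto
      moreover have "\<bar>v k0 x * (u e k2 x - v k0 x)\<bar> \<le> B * (C * (2 * \<delta>))"
        unfolding abs_mult using 1 B(2)[OF kk x] pos \<delta> by (intro mult_mono) auto
      moreover have "u e k1 x * u e k2 x - v k0 x * v k0 x = (u e k1 x - v k0 x) * u e k2 x + v k0 x * (u e k2 x - v k0 x)"
        by (simp add: algebra_simps)
      ultimately have "\<bar>u e k1 x * u e k2 x - v k0 x * v k0 x\<bar> \<le> (C * (2 * \<delta>)) * (B + C) + B * (C * (2 * \<delta>))" by linarith
      then show ?thesis by (simp add: D_def algebra_simps)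
    qed
    note w = well_scaled_potential[OF e(1,2)]
    note n1 = norm_sol[OF w k(1)] and n2 = norm_sol[OF w k2]
    have d1: "2 * D * \<delta> < (v k0 R)\<^sup>2"
    proof -
      have "\<delta> \<le> (v k0 R)\<^sup>2 / (4 * D)" by (simp add: \<delta>_def)
      then have "4 * D * \<delta> \<le> (v k0 R)\<^sup>2" using D by (simp add: pos_le_divide_eq mult_ac)
      moreover have "0 < D * \<delta>" using D \<delta> by simp
      ultimately show ?thesis by linarith
    qed
    have d2: "2 * R * (2 * D * \<delta>) < core_mass k0"
    proof -
      have "\<delta> \<le> core_mass k0 / (8 * R * D)" by (simp add: \<delta>_def)
      then have "8 * (R * D * \<delta>) \<le> core_mass k0" using D R by (simp add: pos_le_divide_eq mult_ac)
      moreover have "0 < R * D * \<delta>" using D \<delta> R by simp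
      ultimately show ?thesis by (simp add: algebra_simps)
    qed
    have uR: "0 < u e k1 R * u e k2 R"
      using cl[of R] R d1 by (auto simp: power2_eq_square)
    have lu: "locally_bounded (\<lambda>x. u e k1 x * u e k2 x)"
      by (intro locally_bounded_mult solvesD(6)[OF n1(1)] solvesD(6)[OF n2(1)])
    have ui: "0 < integral {-R..R} (\<lambda>x. u e k1 x * u e k2 x)"
    proof -
      have hi: "((\<lambda>x. u e k1 x * u e k2 x - v k0 x * v k0 x) has_integral
          (integral {-R..R} (\<lambda>x. u e k1 x * u e k2 x) - core_mass k0)) (cbox (-R) R)"
        unfolding core_mass_def using locally_bounded_integrable[OF lu, of "-R" R] locally_bounded_integrable[OF locally_bounded_mult[OF locally_bounded_v[of k0] locally_bounded_v[of k0]], of "-R" R]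
        by (intro has_integral_diff) (auto intro: integrable_integral)
      have "norm (integral {-R..R} (\<lambda>x. u e k1 x * u e k2 x) - core_mass k0) \<le> (2 * D * \<delta>) * measure lborel (cbox (-R) R)"
        by (rule has_integral_bound_spike_finite[OF _ _ hi, of _ "{}"]) (use D \<delta> cl in auto)
      then show ?thesis using d2 R by (simp add: mult_ac)
    qed
    obtain c1 where c1: "c1 > 0" "\<And>x. left_sol (scaled_potential e) (R / e) k1 x = c1 * u e k1 x" using n1(9) by blast
    obtain c2 where c2: "c2 > 0" "\<And>x. left_sol (scaled_potential e) (R / e) k2 x = c2 * u e k2 x" using n2(9) by blast
    have eq: "left_sol (scaled_potential e) (R / e) k1 x * left_sol (scaled_potential e) (R / e) k2 x = (c1 * c2) * (u e k1 x * u e k2 x)" for x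
      by (simp add: c1 c2)
    show False
    proof (rule evans_roots_orthogonal[OF w k n])
      show "0 < integral {-R..R} (\<lambda>x. left_sol (scaled_potential e) (R / e) k1 x * left_sol (scaled_potential e) (R / e) k2 x)"
        unfolding eq using ui c1(1) c2(1) by simp
      show "0 < left_sol (scaled_potential e) (R / e) k1 R * left_sol (scaled_potential e) (R / e) k2 R"
        unfolding eq using uR c1(1) c2(1) by simp
    qed
  qed
  have "k1 = k2" if "0 < e" "e \<le> 1" "e < \<delta>" "0 < k1" "0 < k2" "N e k1 = 0" "N e k2 = 0"
     "\<bar>k1 - k0\<bar> < \<delta>" "\<bar>k2 - k0\<bar> < \<delta>" for e k1 k2
    using no[of e k1 k2] no[of e k2 k1] that by (meson linorder_neqE_linordered_idom)
  then show ?thesis using \<delta> by blast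
qed

text \<open>Off the balls around its zeros the continuous function \<open>D0\<close> is bounded away from \<open>0\<close> on the compact set \<open>[0, K]\<close>, and \<open>G\<close>
is uniformly close to it. A zero of \<open>D0\<close> at \<open>0\<close> belongs to \<open>Z\<close>.\<close>
lemma roots_near_unperturbed_roots:
  assumes Z: "finite Z" and zeros: "\<And>k. k \<in> {0..K} \<Longrightarrow> D0 k = 0 \<longleftrightarrow> k \<in> Z" "Z \<subseteq> {0..K}"
  shows "\<exists>A\<ge>0. \<exists>e0>0. e0 \<le> 1 \<and> (\<forall>e k. 0 < e \<longrightarrow> e < e0 \<longrightarrow> 0 < k \<longrightarrow> N e k = 0 \<longrightarrow> (\<exists>z\<in>Z. \<bar>k - z\<bar> \<le> A * e))"
proof -
  have "\<forall>z\<in>Z. \<exists>\<delta>. \<exists>A. \<delta> > 0 \<and> (\<forall>e k. 0 < e \<longrightarrow> e \<le> 1 \<longrightarrow> 0 < k \<longrightarrow> k \<le> K \<longrightarrow> \<bar>k - z\<bar> < \<delta> \<longrightarrow> G e k = 0 \<longrightarrow> \<bar>k - z\<bar> \<le> A * e)"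
  proof
    fix z assume z: "z \<in> Z"
    then have "z \<in> {0..K}" using zeros(2) by auto
    moreover from this have "D0 z = 0" using zeros(1) z by simp
    ultimately show "\<exists>\<delta>. \<exists>A. \<delta> > 0 \<and> (\<forall>e k. 0 < e \<longrightarrow> e \<le> 1 \<longrightarrow> 0 < k \<longrightarrow> k \<le> K \<longrightarrow> \<bar>k - z\<bar> < \<delta> \<longrightarrow> G e k = 0 \<longrightarrow> \<bar>k - z\<bar> \<le> A * e)"
      using root_near[of z] by simp
  qed
  then obtain \<delta> A where \<delta>: "\<And>z. z \<in> Z \<Longrightarrow> \<delta> z > 0"
    and A: "\<And>z e k. z \<in> Z \<Longrightarrow> 0 < e \<Longrightarrow> e \<le> 1 \<Longrightarrow> 0 < k \<Longrightarrow> k \<le> K \<Longrightarrow> \<bar>k - z\<bar> < \<delta> z \<Longrightarrow> G e k = 0 \<Longrightarrow> \<bar>k - z\<bar> \<le> A z * e"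
    by metis
  define A' where "A' = (\<Sum>z\<in>Z. \<bar>A z\<bar>)"
  have A': "A z \<le> A'" if "z \<in> Z" for z
    using member_le_sum[OF that, of "\<lambda>z. \<bar>A z\<bar>"] Z by (simp add: A'_def)
  define X where "X = {0..K} - (\<Union>z\<in>Z. ball z (\<delta> z))"
  have "compact X" unfolding X_def by (intro compact_diff open_UN) auto
  moreover have "continuous_on X (\<lambda>k. \<bar>D0 k\<bar>)"
    by (intro continuous_intros continuous_on_subset[OF evans_continuous[OF well_V, of K]]) (auto simp: X_def)
  moreover have "0 < \<bar>D0 k\<bar>" if "k \<in> X" for k
  proof -
    have "k \<in> {0..K}" "k \<notin> Z" using that \<delta>[of k] by (auto simp: X_def)
    then show ?thesis using zeros(1)[of k] by simp
  qed
  ultimately have "\<exists>c>0. \<forall>k\<in>X. c \<le> \<bar>D0 k\<bar>"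
  proof (cases "X = {}")
    case False
    assume a: "compact X" "continuous_on X (\<lambda>k. \<bar>D0 k\<bar>)" "\<And>k. k \<in> X \<Longrightarrow> 0 < \<bar>D0 k\<bar>"
    from continuous_attains_inf[OF a(1) False a(2)] a(3) show ?thesis by blast
  qed (auto intro: exI[of _ 1])
  then obtain c where c: "c > 0" "\<And>k. k \<in> X \<Longrightarrow> c \<le> \<bar>D0 k\<bar>" by blast
  define L where "L = C + K * C + sqrt M * (B + C)"
  have L: "0 < L" unfolding L_def using C K M B by (intro add_pos_nonneg) auto
  have main: "\<exists>z\<in>Z. \<bar>k - z\<bar> \<le> A' * e" if e: "0 < e" "e < min 1 (c / L)" and k: "0 < k" and n: "N e k = 0" for e k
  proof -
    have e1: "e \<le> 1" using e by simp
    have kK: "k \<le> K" using root_less_K(2)[OF k e(1) e1 n] by simp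
    have g: "G e k = 0" using N_zero_iff[OF e(1) e1 k] n by simp
    have "\<bar>D0 k\<bar> \<le> L * e" using G_close[OF e(1) e1 k kK] g by (simp add: L_def)
    also have "\<dots> < c" using e L by (simp add: pos_less_divide_eq mult.commute)
    finally have "k \<notin> X" using c(2) by force
    then obtain z where z: "z \<in> Z" "\<bar>k - z\<bar> < \<delta> z" using k kK by (auto simp: X_def dist_real_def abs_minus_commute)
    from A[OF z(1) e(1) e1 k kK z(2) g] have "\<bar>k - z\<bar> \<le> A z * e" .
    also have "\<dots> \<le> A' * e" using A'[OF z(1)] e by (intro mult_right_mono) auto
    finally show ?thesis using z by blast
  qed
  have "0 \<le> A'" unfolding A'_def by (intro sum_nonneg) auto
  then show ?thesis using main c L by (intro exI[of _ A'] conjI exI[of _ "min 1 (c / L)"]) auto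
qed

text \<open>The perturbed roots: one branch \<open>\<kappa> k0\<close> for each unperturbed root \<open>k0\<close>, with its first order expansion, and possibly
roots of size \<open>O(\<epsilon>)\<close> that come from the threshold.\<close>
lemma evans_roots:
  assumes fin: "finite \<Omega>" and pos: "\<And>k. k \<in> \<Omega> \<Longrightarrow> 0 < k" and zeros: "\<And>k. 0 < k \<Longrightarrow> D0 k = 0 \<longleftrightarrow> k \<in> \<Omega>"
  shows "\<exists>A\<ge>0. \<exists>e0>0. \<exists>\<kappa>. e0 \<le> 1 \<and> (\<forall>e. 0 < e \<longrightarrow> e < e0 \<longrightarrow>
    (\<forall>k0\<in>\<Omega>. 0 < \<kappa> k0 e \<and> N e (\<kappa> k0 e) = 0 \<and> \<bar>\<kappa> k0 e - k0\<bar> \<le> A * e \<and>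
        \<bar>(\<kappa> k0 e - k0) * root_slope k0 + e * coupling k0\<bar> \<le> A * e\<^sup>2) \<and>
    (\<forall>k>0. N e k = 0 \<longrightarrow> k \<le> A * e \<or> (\<exists>k0\<in>\<Omega>. k = \<kappa> k0 e)))"
proof -
  have OK: "0 < k0 \<and> k0 < K \<and> D0 k0 = 0" if "k0 \<in> \<Omega>" for k0
    using pos[OF that] zeros that root_less_K(1) by blast
  define Z where "Z = {k \<in> {0..K}. D0 k = 0}"
  have ZO: "Z \<subseteq> insert 0 \<Omega>"
  proof
    fix z assume "z \<in> Z"
    then have "0 \<le> z" "D0 z = 0" by (auto simp: Z_def)
    then show "z \<in> insert 0 \<Omega>" using zeros[of z] by (cases "z = 0") auto
  qed
  then have fZ: "finite Z" using fin by (meson finite.insertI finite_subset)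
  have zz: "\<And>k. k \<in> {0..K} \<Longrightarrow> D0 k = 0 \<longleftrightarrow> k \<in> Z" "Z \<subseteq> {0..K}" by (auto simp: Z_def)
  obtain A1 e1 where A1: "A1 \<ge> 0" "e1 > 0" "e1 \<le> 1" and near: "\<And>e k. 0 < e \<Longrightarrow> e < e1 \<Longrightarrow> 0 < k \<Longrightarrow> N e k = 0 \<Longrightarrow> \<exists>z\<in>Z. \<bar>k - z\<bar> \<le> A1 * e"
    using roots_near_unperturbed_roots[OF fZ zz] by blast
  have "\<forall>k0\<in>\<Omega>. \<exists>A e0. e0 > 0 \<and> e0 \<le> 1 \<and> (\<forall>e. 0 < e \<longrightarrow> e < e0 \<longrightarrow> (\<exists>k. 0 < k \<and> k < K \<and> N e k = 0 \<and> \<bar>k - k0\<bar> \<le> A * e))"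
  proof
    fix k0 assume "k0 \<in> \<Omega>"
    from root_exists[of k0] OK[OF this]
    show "\<exists>A e0. e0 > 0 \<and> e0 \<le> 1 \<and> (\<forall>e. 0 < e \<longrightarrow> e < e0 \<longrightarrow> (\<exists>k. 0 < k \<and> k < K \<and> N e k = 0 \<and> \<bar>k - k0\<bar> \<le> A * e))"
      by simp
  qed
  then obtain A2 e2 where e2: "\<And>k0. k0 \<in> \<Omega> \<Longrightarrow> e2 k0 > 0 \<and> e2 k0 \<le> 1"
    and ex: "\<And>k0 e. k0 \<in> \<Omega> \<Longrightarrow> 0 < e \<Longrightarrow> e < e2 k0 \<Longrightarrow> \<exists>k. 0 < k \<and> k < K \<and> N e k = 0 \<and> \<bar>k - k0\<bar> \<le> A2 k0 * e"
    by metis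
  have "\<forall>k0\<in>\<Omega>. \<exists>A. A \<ge> 0 \<and> (\<forall>e k. 0 < e \<longrightarrow> e \<le> 1 \<longrightarrow> k0 / 2 \<le> k \<longrightarrow> k \<le> K \<longrightarrow>
    \<bar>v k0 R * G e k - (k - k0) * root_slope k0 - e * coupling k0\<bar> \<le> A * (e\<^sup>2 + (k - k0)\<^sup>2))"
    using expansion_fine OK by (simp add: less_imp_le)
  then obtain A3 where A3: "\<And>k0. k0 \<in> \<Omega> \<Longrightarrow> 0 \<le> A3 k0" and fine: "\<And>k0 e k. k0 \<in> \<Omega> \<Longrightarrow> 0 < e \<Longrightarrow> e \<le> 1 \<Longrightarrow> k0 / 2 \<le> k \<Longrightarrow> k \<le> K \<Longrightarrow>
    \<bar>v k0 R * G e k - (k - k0) * root_slope k0 - e * coupling k0\<bar> \<le> A3 k0 * (e\<^sup>2 + (k - k0)\<^sup>2)"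
    by metis
  have "\<forall>k0\<in>\<Omega>. \<exists>\<delta>. \<delta> > 0 \<and> (\<forall>e k1 k2. 0 < e \<longrightarrow> e \<le> 1 \<longrightarrow> e < \<delta> \<longrightarrow> 0 < k1 \<longrightarrow> 0 < k2 \<longrightarrow> N e k1 = 0 \<longrightarrow> N e k2 = 0 \<longrightarrow>
     \<bar>k1 - k0\<bar> < \<delta> \<longrightarrow> \<bar>k2 - k0\<bar> < \<delta> \<longrightarrow> k1 = k2)"
    using root_unique OK by (simp add: less_imp_le)
  then obtain \<delta> where \<delta>: "\<And>k0. k0 \<in> \<Omega> \<Longrightarrow> \<delta> k0 > 0" and uniq: "\<And>k0 e k1 k2. k0 \<in> \<Omega> \<Longrightarrow> 0 < e \<Longrightarrow> e \<le> 1 \<Longrightarrow> e < \<delta> k0 \<Longrightarrow> 0 < k1 \<Longrightarrow> 0 < k2 \<Longrightarrow> N e k1 = 0 \<Longrightarrow> N e k2 = 0 \<Longrightarrow>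
     \<bar>k1 - k0\<bar> < \<delta> k0 \<Longrightarrow> \<bar>k2 - k0\<bar> < \<delta> k0 \<Longrightarrow> k1 = k2"
    by metis
  (* one constant for all branches, first for the localisation and then for the expansion *)
  define A4 where "A4 = A1 + (\<Sum>k0\<in>\<Omega>. \<bar>A2 k0\<bar>)"
  define A where "A = A4 + (\<Sum>k0\<in>\<Omega>. A3 k0 * (1 + A4\<^sup>2))"
  have A4: "A1 \<le> A4" "\<And>k0. k0 \<in> \<Omega> \<Longrightarrow> A2 k0 \<le> A4" "0 \<le> A4"
  proof -
    show "A1 \<le> A4" "0 \<le> A4" unfolding A4_def using A1 by (auto intro!: add_nonneg_nonneg sum_nonneg)
    fix k0 assume "k0 \<in> \<Omega>"
    from member_le_sum[OF this, of "\<lambda>k. \<bar>A2 k\<bar>"] fin show "A2 k0 \<le> A4" using A1 by (simp add: A4_def)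
  qed
  have A: "A4 \<le> A" "\<And>k0. k0 \<in> \<Omega> \<Longrightarrow> A3 k0 * (1 + A4\<^sup>2) \<le> A"
  proof -
    show "A4 \<le> A" unfolding A_def using A3 by (auto intro!: sum_nonneg)
    fix k0 assume "k0 \<in> \<Omega>"
    from member_le_sum[OF this, of "\<lambda>k. A3 k * (1 + A4\<^sup>2)"] fin A3 show "A3 k0 * (1 + A4\<^sup>2) \<le> A"
      using A4(3) by (simp add: A_def)
  qed
  have pe2: "0 < e2 k0" if "k0 \<in> \<Omega>" for k0 using e2[OF that] by simp
  have "\<exists>e3>0. \<forall>k0\<in>\<Omega>. e3 \<le> e2 k0 \<and> e3 \<le> \<delta> k0 \<and> A4 * e3 < \<delta> k0 \<and> A4 * e3 \<le> k0 / 2"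
  proof -
    have "\<forall>k0\<in>\<Omega>. \<forall>\<^sub>F e in at_right 0. e \<le> e2 k0 \<and> e \<le> \<delta> k0 \<and> A4 * e < \<delta> k0 \<and> A4 * e \<le> k0 / 2"
    proof
      fix k0 assume k: "k0 \<in> \<Omega>"
      have t: "((\<lambda>e. A4 * e) \<longlongrightarrow> 0) (at_right 0)" "((\<lambda>e::real. e) \<longlongrightarrow> 0) (at_right 0)"
        by (auto intro!: tendsto_eq_intros)
      have "\<forall>\<^sub>F e in at_right 0. e < e2 k0" "\<forall>\<^sub>F e in at_right 0. e < \<delta> k0"
         "\<forall>\<^sub>F e in at_right 0. A4 * e < \<delta> k0" "\<forall>\<^sub>F e in at_right 0. A4 * e < k0 / 2"
        by (rule order_tendstoD(2)[OF t(2) pe2[OF k]] order_tendstoD(2)[OF t(2) \<delta>[OF k]]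
            order_tendstoD(2)[OF t(1) \<delta>[OF k]] order_tendstoD(2)[OF t(1) half_gt_zero[OF pos[OF k]]])+
      then show "\<forall>\<^sub>F e in at_right 0. e \<le> e2 k0 \<and> e \<le> \<delta> k0 \<and> A4 * e < \<delta> k0 \<and> A4 * e \<le> k0 / 2"
        by eventually_elim auto
    qed
    then have "\<forall>\<^sub>F e in at_right 0. \<forall>k0\<in>\<Omega>. e \<le> e2 k0 \<and> e \<le> \<delta> k0 \<and> A4 * e < \<delta> k0 \<and> A4 * e \<le> k0 / 2"
      using fin by (simp add: eventually_ball_finite)
    moreover have "\<forall>\<^sub>F e::real in at_right 0. 0 < e" by (simp add: eventually_at_right_less)
    ultimately have "\<forall>\<^sub>F e in at_right (0::real). 0 < e \<and> (\<forall>k0\<in>\<Omega>. e \<le> e2 k0 \<and> e \<le> \<delta> k0 \<and> A4 * e < \<delta> k0 \<and> A4 * e \<le> k0 / 2)"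
      by eventually_elim auto
    from eventually_happens[OF this] show ?thesis by auto
  qed
  then obtain e3 where e3: "e3 > 0" "\<And>k0. k0 \<in> \<Omega> \<Longrightarrow> e3 \<le> e2 k0 \<and> e3 \<le> \<delta> k0 \<and> A4 * e3 < \<delta> k0 \<and> A4 * e3 \<le> k0 / 2" by blast
  define e0 where "e0 = min e1 e3"
  define \<kappa> where "\<kappa> k0 e = (SOME k. 0 < k \<and> k < K \<and> N e k = 0 \<and> \<bar>k - k0\<bar> \<le> A2 k0 * e)" for k0 e
  have \<kappa>: "0 < \<kappa> k0 e" "\<kappa> k0 e < K" "N e (\<kappa> k0 e) = 0" "\<bar>\<kappa> k0 e - k0\<bar> \<le> A4 * e"
    if k: "k0 \<in> \<Omega>" and e: "0 < e" "e < e0" for k0 e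
  proof -
    have "e < e2 k0" using e e3(2)[OF k] by (simp add: e0_def)
    from someI_ex[OF ex[OF k e(1) this]]
    have s: "0 < \<kappa> k0 e \<and> \<kappa> k0 e < K \<and> N e (\<kappa> k0 e) = 0 \<and> \<bar>\<kappa> k0 e - k0\<bar> \<le> A2 k0 * e" unfolding \<kappa>_def[symmetric] .
    then show "0 < \<kappa> k0 e" "\<kappa> k0 e < K" "N e (\<kappa> k0 e) = 0" by auto
    have "A2 k0 * e \<le> A4 * e" using A4(2)[OF k] e by (intro mult_right_mono) auto
    then show "\<bar>\<kappa> k0 e - k0\<bar> \<le> A4 * e" using s by linarith
  qed
  have Ae: "A4 * e < \<delta> k0 \<and> A4 * e \<le> k0 / 2 \<and> e < \<delta> k0" if k: "k0 \<in> \<Omega>" and e: "0 < e" "e < e0" for k0 e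
  proof -
    have "A4 * e \<le> A4 * e3" using A4(3) e by (intro mult_left_mono) (auto simp: e0_def)
    then show ?thesis using e3(2)[OF k] e by (auto simp: e0_def)
  qed
  have "0 \<le> A \<and> 0 < e0 \<and> e0 \<le> 1 \<and> (\<forall>e. 0 < e \<longrightarrow> e < e0 \<longrightarrow>
    (\<forall>k0\<in>\<Omega>. 0 < \<kappa> k0 e \<and> N e (\<kappa> k0 e) = 0 \<and> \<bar>\<kappa> k0 e - k0\<bar> \<le> A * e \<and>
        \<bar>(\<kappa> k0 e - k0) * root_slope k0 + e * coupling k0\<bar> \<le> A * e\<^sup>2) \<and>
    (\<forall>k>0. N e k = 0 \<longrightarrow> k \<le> A * e \<or> (\<exists>k0\<in>\<Omega>. k = \<kappa> k0 e)))"
  proof (intro conjI allI impI ballI)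
    show "0 \<le> A" using A(1) A4(3) by simp
    show "0 < e0" "e0 \<le> 1" using A1 e3 by (auto simp: e0_def)
    fix e assume e: "0 < e" "e < e0"
    have e1: "e \<le> 1" "e < e1" using e A1 by (auto simp: e0_def)
    { fix k0 assume k: "k0 \<in> \<Omega>"
      note kp = \<kappa>[OF k e]
      show "0 < \<kappa> k0 e" "N e (\<kappa> k0 e) = 0" by fact+
      have "A4 * e \<le> A * e" using A(1) e by (intro mult_right_mono) auto
      then show "\<bar>\<kappa> k0 e - k0\<bar> \<le> A * e" using kp(4) by linarith
      have g: "G e (\<kappa> k0 e) = 0" using N_zero_iff[OF e(1) e1(1) kp(1)] kp(3) by simp
      have "k0 / 2 \<le> \<kappa> k0 e" using Ae[OF k e] kp(4) by linarith
      from fine[OF k e(1) e1(1) this] kp(2) g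
      have "\<bar>(\<kappa> k0 e - k0) * root_slope k0 + e * coupling k0\<bar> \<le> A3 k0 * (e\<^sup>2 + (\<kappa> k0 e - k0)\<^sup>2)" by simp
      also have "\<dots> \<le> A3 k0 * (e\<^sup>2 + (A4 * e)\<^sup>2)"
      proof -
        have "\<bar>\<kappa> k0 e - k0\<bar>\<^sup>2 \<le> (A4 * e)\<^sup>2" using kp(4) by (intro power_mono) auto
        then show ?thesis using A3[OF k] by (intro mult_left_mono) auto
      qed
      also have "\<dots> = (A3 k0 * (1 + A4\<^sup>2)) * e\<^sup>2" by (simp add: power_mult_distrib algebra_simps)
      also have "\<dots> \<le> A * e\<^sup>2" using A(2)[OF k] by (intro mult_right_mono) auto
      finally show "\<bar>(\<kappa> k0 e - k0) * root_slope k0 + e * coupling k0\<bar> \<le> A * e\<^sup>2" . }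
    fix k assume k: "k > 0" "N e k = 0"
    from near[OF e(1) e1(2) k] obtain z where z: "z \<in> Z" "\<bar>k - z\<bar> \<le> A1 * e" by blast
    have "A1 * e \<le> A4 * e" using A4(1) e by (intro mult_right_mono) auto
    moreover have "A4 * e \<le> A * e" using A(1) e by (intro mult_right_mono) auto
    ultimately have le: "\<bar>k - z\<bar> \<le> A4 * e" "A4 * e \<le> A * e" using z by auto
    show "k \<le> A * e \<or> (\<exists>k0\<in>\<Omega>. k = \<kappa> k0 e)"
    proof (cases "z \<in> \<Omega>")
      case True
      have "k = \<kappa> z e"
        using Ae[OF True e] \<kappa>[OF True e] le(1) by (intro uniq[OF True e(1) e1(1) _ k(1) _ k(2)]) auto
      then show ?thesis using True by blast
    next
      case False
      then have "z = 0" using z ZO by auto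
      then show ?thesis using le by auto
    qed
  qed
  then show ?thesis by blast
qed

end

section \<open>Test functions and the fundamental lemma\<close>

text \<open>Differentiability \<open>n\<close> times, by recursion on the derivative; this form admits induction on \<open>n\<close> for all \<open>f\<close> at once.\<close>
primrec ndiff :: "nat \<Rightarrow> (real \<Rightarrow> real) \<Rightarrow> bool" where
  "ndiff 0 f = True"
| "ndiff (Suc n) f = ((\<forall>x. (f has_real_derivative deriv f x) (at x)) \<and> ndiff n (deriv f))"

lemma ndiff_SucI: assumes "\<And>x. (f has_real_derivative g x) (at x)" "ndiff n g" shows "ndiff (Suc n) f"
proof -
  have "deriv f = g" using assms(1) by (auto intro!: DERIV_imp_deriv)
  then show ?thesis using assms by simp
qed

lemma ndiff_Suc_imp: "ndiff (Suc n) f \<Longrightarrow> ndiff n f"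
  by (induction n arbitrary: f) auto

lemma differentiable_on_UNIV_iff:
  "f differentiable_on UNIV \<longleftrightarrow> (\<forall>x. (f has_real_derivative deriv f x) (at x))" for f :: "real \<Rightarrow> real"
  by (auto simp: differentiable_on_def real_differentiable_def DERIV_deriv_iff_real_differentiable)

lemma ndiff_iff: "ndiff n f \<longleftrightarrow> (\<forall>k<n. (deriv ^^ k) f differentiable_on UNIV)"
proof (induction n arbitrary: f)
  case (Suc n)
  have "ndiff (Suc n) f \<longleftrightarrow> f differentiable_on UNIV \<and> (\<forall>k<n. (deriv ^^ Suc k) f differentiable_on UNIV)"
    unfolding differentiable_on_UNIV_iff by (simp add: Suc differentiable_on_UNIV_iff del: funpow.simps add: funpow_Suc_right)
  also have "\<dots> \<longleftrightarrow> (\<forall>k<Suc n. (deriv ^^ k) f differentiable_on UNIV)"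
    by (auto simp: less_Suc_eq_0_disj simp del: funpow.simps(2))
  finally show ?case .
qed simp

lemma smooth_iff: "(\<forall>k. (deriv ^^ k) f differentiable_on UNIV) \<longleftrightarrow> (\<forall>n. ndiff n f)"
  unfolding ndiff_iff by blast

lemma ndiff_add: "ndiff n f \<Longrightarrow> ndiff n g \<Longrightarrow> ndiff n (\<lambda>x. f x + g x)"
proof (induction n arbitrary: f g)
  case (Suc n)
  then show ?case by (intro ndiff_SucI[of _ "\<lambda>x. deriv f x + deriv g x"]) (auto intro!: derivative_eq_intros)
qed simp

lemma ndiff_cmult: "ndiff n f \<Longrightarrow> ndiff n (\<lambda>x. c * f x)"
proof (induction n arbitrary: f)
  case (Suc n)
  then show ?case by (intro ndiff_SucI[of _ "\<lambda>x. c * deriv f x"]) (auto intro!: derivative_eq_intros)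
qed simp

lemma ndiff_mult: "ndiff n f \<Longrightarrow> ndiff n g \<Longrightarrow> ndiff n (\<lambda>x. f x * g x)"
proof (induction n arbitrary: f g)
  case (Suc n)
  have "ndiff n (\<lambda>x. deriv f x * g x + f x * deriv g x)"
    using Suc.prems ndiff_Suc_imp[OF Suc.prems(1)] ndiff_Suc_imp[OF Suc.prems(2)] by (intro ndiff_add Suc.IH) auto
  then show ?case using Suc.prems
    by (intro ndiff_SucI[of _ "\<lambda>x. deriv f x * g x + f x * deriv g x"]) (auto intro!: derivative_eq_intros)
qed simp

lemma ndiff_affine: "ndiff n f \<Longrightarrow> ndiff n (\<lambda>x. f (c * x + d))"
proof (induction n arbitrary: f)
  case (Suc n)
  have "((\<lambda>x. f (c * x + d)) has_real_derivative c * deriv f (c * x + d)) (at x)" for x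
  proof -
    have "(f has_real_derivative deriv f (c * x + d)) (at (c * x + d))" using Suc.prems by simp
    moreover have "((\<lambda>x. c * x + d) has_real_derivative c) (at x)" by (auto intro!: derivative_eq_intros)
    ultimately show ?thesis
      using DERIV_chain2[of f "deriv f (c * x + d)" "\<lambda>x. c * x + d" x c UNIV] by (simp add: mult.commute)
  qed
  then show ?case using Suc.prems Suc.IH[of "deriv f"] by (intro ndiff_SucI[of _ "\<lambda>x. c * deriv f (c * x + d)"] ndiff_cmult) auto
qed simp

text \<open>The derivative of \<open>exp (- 1 / x) / x ^ k\<close> is a combination of functions of the same kind, so \<open>flat 0\<close>, the standard
smooth function that vanishes on a half line, is handled together with all its derivatives.\<close>
definition flat :: "nat \<Rightarrow> real \<Rightarrow> real" where
  "flat k x = (if 0 < x then exp (- (1 / x)) / x ^ k else 0)"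

lemma flat_bound: assumes "0 < x" shows "flat k x \<le> (real (k + 2)) ^ (k + 2) * x\<^sup>2"
proof -
  define n where "n = k + 2"
  have n: "real n > 0" by (simp add: n_def)
  have "(1 / x / real n) ^ n \<le> exp (1 / x / real n) ^ n"
  proof (rule power_mono)
    show "1 / x / real n \<le> exp (1 / x / real n)" using exp_ge_add_one_self[of "1 / x / real n"] by linarith
  qed (use assms n in auto)
  also have "\<dots> = exp (1 / x)" using n by (simp add: exp_of_nat_mult[symmetric])
  finally have "1 \<le> exp (1 / x) * (x ^ n * real n ^ n)"
    using assms n by (simp add: power_divide field_simps)
  then have "exp (- (1 / x)) * 1 \<le> exp (- (1 / x)) * (exp (1 / x) * (x ^ n * real n ^ n))"
    by (intro mult_left_mono) auto
  also have "\<dots> = x ^ n * real n ^ n" by (simp add: mult.assoc[symmetric] exp_add[symmetric])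
  finally have "exp (- (1 / x)) \<le> x ^ k * (x\<^sup>2 * real n ^ n)" by (simp add: n_def power_add power2_eq_square mult_ac)
  then have "exp (- (1 / x)) / x ^ k \<le> x\<^sup>2 * real n ^ n" using assms by (simp add: pos_divide_le_eq mult.commute)
  then show ?thesis using assms by (simp add: flat_def n_def mult.commute)
qed

lemma flat_deriv: "(flat k has_real_derivative (flat (k + 2) x - real k * flat (k + 1) x)) (at x)"
proof -
  consider "x > 0" | "x < 0" | "x = 0" by linarith
  then show ?thesis
  proof cases
    case 1
    have "((\<lambda>x. exp (- (1 / x)) / x ^ k) has_real_derivative (flat (k + 2) x - real k * flat (k + 1) x)) (at x)"
      using 1 apply (auto intro!: derivative_eq_intros simp: flat_def)
      apply (cases k)
       apply (auto simp: field_simps power2_eq_square)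
      done
    then show ?thesis
    proof (rule has_field_derivative_transform_within_open[where S = "{0<..}"])
      fix y :: real assume "y \<in> {0<..}"
      then show "exp (- (1 / y)) / y ^ k = flat k y" by (simp add: flat_def)
    qed (use 1 in auto)
  next
    case 2
    have "((\<lambda>x. 0) has_real_derivative (flat (k + 2) x - real k * flat (k + 1) x)) (at x)"
      using 2 by (simp add: flat_def)
    then show ?thesis
      by (rule has_field_derivative_transform_within_open[where S = "{..<0}"]) (use 2 in \<open>auto simp: flat_def\<close>)
  next
    case 3
    define c where "c = (real (k + 2)) ^ (k + 2)"
    have c0: "0 \<le> c" by (simp add: c_def)
    have b: "\<bar>flat k h\<bar> \<le> c * h\<^sup>2" for h
      using flat_bound[of h k] c0 by (cases "0 < h") (auto simp: c_def flat_def)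
    have "((\<lambda>h. (flat k (0 + h) - flat k 0) / h) \<longlongrightarrow> 0) (at 0)"
    proof (rule Lim_null_comparison[where g = "\<lambda>h. c * \<bar>h\<bar>"])
      have "norm ((flat k (0 + h) - flat k 0) / h) \<le> c * \<bar>h\<bar>" if "h \<noteq> 0" for h
        using b[of h] that by (simp add: flat_def[of k 0] abs_divide pos_divide_le_eq power2_eq_square mult.assoc abs_mult_self_eq)
      then show "\<forall>\<^sub>F h in at 0. norm ((flat k (0 + h) - flat k 0) / h) \<le> c * \<bar>h\<bar>"
        by (auto simp: eventually_at intro!: exI[of _ 1])
      show "((\<lambda>h. c * \<bar>h\<bar>) \<longlongrightarrow> 0) (at 0)" by (auto intro!: tendsto_eq_intros)
    qed
    then have "(flat k has_real_derivative 0) (at 0)" by (simp add: DERIV_def)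
    then show ?thesis using 3 by (simp add: flat_def)
  qed
qed

lemma ndiff_flat: "ndiff n (flat k)"
proof (induction n arbitrary: k)
  case (Suc n)
  have "ndiff n (\<lambda>x. flat (k + 2) x + (- real k) * flat (k + 1) x)"
    by (intro ndiff_add ndiff_cmult Suc.IH)
  then show ?case using flat_deriv[of k] by (intro ndiff_SucI) auto
qed simp

definition test_fun :: "(real \<Rightarrow> real) \<Rightarrow> bool" where
  "test_fun \<phi> \<longleftrightarrow> (\<forall>n. ndiff n \<phi>) \<and> (\<exists>N. \<forall>x. N \<le> \<bar>x\<bar> \<longrightarrow> \<phi> x = 0)"

lemma test_functions_iff: "\<phi> \<in> test_functions \<longleftrightarrow> test_fun \<phi>"
proof -
  have "compact (closure {x. \<phi> x \<noteq> 0}) \<longleftrightarrow> (\<exists>N. \<forall>x. N \<le> \<bar>x\<bar> \<longrightarrow> \<phi> x = 0)"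
  proof
    assume "compact (closure {x. \<phi> x \<noteq> 0})"
    then have "bounded {x. \<phi> x \<noteq> 0}" using compact_imp_bounded bounded_subset closure_subset by blast
    then obtain N where N: "\<And>x. \<phi> x \<noteq> 0 \<Longrightarrow> \<bar>x\<bar> \<le> N" unfolding bounded_iff by auto
    have "\<phi> x = 0" if "N + 1 \<le> \<bar>x\<bar>" for x using N[of x] that by fastforce
    then show "\<exists>N. \<forall>x. N \<le> \<bar>x\<bar> \<longrightarrow> \<phi> x = 0" by blast
  next
    assume "\<exists>N. \<forall>x. N \<le> \<bar>x\<bar> \<longrightarrow> \<phi> x = 0"
    then obtain N where "\<forall>x. N \<le> \<bar>x\<bar> \<longrightarrow> \<phi> x = 0" by blast
    then have "\<phi> x \<noteq> 0 \<Longrightarrow> \<bar>x\<bar> \<le> N" for x by (metis linear)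
    then have "bounded {x. \<phi> x \<noteq> 0}" unfolding bounded_iff by auto
    then show "compact (closure {x. \<phi> x \<noteq> 0})" by (simp add: compact_closure)
  qed
  then show ?thesis by (auto simp: test_functions_def test_fun_def smooth_iff[symmetric])
qed

lemma test_fun_zero_outside:
  assumes "test_fun \<phi>" shows "\<exists>N>0. \<forall>x. N \<le> \<bar>x\<bar> \<longrightarrow> \<phi> x = 0 \<and> deriv \<phi> x = 0"
proof -
  obtain N where N: "\<And>x. N \<le> \<bar>x\<bar> \<Longrightarrow> \<phi> x = 0" using assms by (auto simp: test_fun_def)
  have "deriv \<phi> x = 0" if x: "\<bar>N\<bar> + 1 \<le> \<bar>x\<bar>" for x
  proof -
    have "((\<lambda>x. 0) has_real_derivative 0) (at x)" by simp
    then have "(\<phi> has_real_derivative 0) (at x)"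
    proof (rule has_field_derivative_transform_within_open[where S = "ball x 1"])
      fix y assume "y \<in> ball x 1"
      then have "N \<le> \<bar>y\<bar>" using x by (auto simp: dist_real_def)
      then show "0 = \<phi> y" using N by simp
    qed auto
    then show ?thesis by (rule DERIV_imp_deriv)
  qed
  moreover have "\<phi> x = 0" if x: "\<bar>N\<bar> + 1 \<le> \<bar>x\<bar>" for x using N[of x] x by simp
  ultimately show ?thesis by (intro exI[of _ "\<bar>N\<bar> + 1"]) auto
qed

lemma test_fun_deriv: assumes "test_fun \<phi>" shows "test_fun (deriv \<phi>)" "\<And>x. (\<phi> has_real_derivative deriv \<phi> x) (at x)"
proof -
  have ndiff: "ndiff (Suc n) \<phi>" for n using assms unfolding test_fun_def by blast
  show "\<And>x. (\<phi> has_real_derivative deriv \<phi> x) (at x)" using ndiff[of 0] by simp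
  show "test_fun (deriv \<phi>)" unfolding test_fun_def using ndiff test_fun_zero_outside[OF assms] by auto
qed

lemma test_fun_continuous: "test_fun \<phi> \<Longrightarrow> continuous_on S \<phi>"
  using test_fun_deriv(2)[of \<phi>] by (meson DERIV_continuous continuous_at_imp_continuous_on)

lemma test_fun_prim: "test_fun \<phi> \<Longrightarrow> primitive (deriv \<phi>) \<phi>"
  by (intro primitive_deriv test_fun_deriv locally_bounded_continuous test_fun_continuous)

lemma test_fun_add: "test_fun \<phi> \<Longrightarrow> test_fun \<psi> \<Longrightarrow> test_fun (\<lambda>x. \<phi> x + \<psi> x)"
proof -
  assume a: "test_fun \<phi>" "test_fun \<psi>"
  then obtain N N' where "\<And>x. N \<le> \<bar>x\<bar> \<Longrightarrow> \<phi> x = 0" "\<And>x. N' \<le> \<bar>x\<bar> \<Longrightarrow> \<psi> x = 0" by (auto simp: test_fun_def)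
  then show ?thesis using a unfolding test_fun_def by (auto intro!: ndiff_add exI[of _ "max N N'"])
qed

lemma test_fun_cmult: "test_fun \<phi> \<Longrightarrow> test_fun (\<lambda>x. c * \<phi> x)"
  unfolding test_fun_def by (auto intro!: ndiff_cmult)

text \<open>The factors tend to \<open>1\<close> where their arguments are positive, because these are multiplied by \<open>j + 1\<close>. The bumps
therefore tend to the indicator function of \<open>{a<..<b}\<close>, and take the role of mollifiers.\<close>
definition bump :: "real \<Rightarrow> real \<Rightarrow> nat \<Rightarrow> real \<Rightarrow> real" where
  "bump a b j x = flat 0 (real (Suc j) * x + - (real (Suc j) * a)) * flat 0 (- real (Suc j) * x + real (Suc j) * b)"

lemma bump_zero: "x \<notin> {a<..<b} \<Longrightarrow> bump a b j x = 0"
proof -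
  assume "x \<notin> {a<..<b}"
  then have "real (Suc j) * x + - (real (Suc j) * a) \<le> 0 \<or> - real (Suc j) * x + real (Suc j) * b \<le> 0"
    by (auto simp: not_less mult_left_mono simp del: of_nat_Suc)
  then show ?thesis unfolding bump_def flat_def by auto
qed

lemma test_fun_bump: "test_fun (bump a b j)"
  unfolding test_fun_def
proof
  show "\<forall>n. ndiff n (bump a b j)" unfolding bump_def[abs_def] by (intro allI ndiff_mult ndiff_affine ndiff_flat)
  show "\<exists>N. \<forall>x. N \<le> \<bar>x\<bar> \<longrightarrow> bump a b j x = 0"
    by (intro exI[of _ "\<bar>a\<bar> + \<bar>b\<bar>"] allI impI bump_zero) auto
qed

lemma bump_bounds: "0 \<le> bump a b j x" "bump a b j x \<le> 1"
proof -
  have f: "0 \<le> flat 0 y" "flat 0 y \<le> 1" for y by (auto simp: flat_def)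
  show "0 \<le> bump a b j x" "bump a b j x \<le> 1" unfolding bump_def using f by (auto intro: mult_le_one)
qed

lemma bump_tendsto: "(\<lambda>j. bump a b j x) \<longlonglongrightarrow> indicator {a<..<b} x"
proof (cases "x \<in> {a<..<b}")
  case True
  have f: "(\<lambda>j. flat 0 (real (Suc j) * c)) \<longlonglongrightarrow> 1" if c: "c > 0" for c
  proof -
    have "(\<lambda>j. exp (- (inverse (real (Suc j)) * (1 / c)))) \<longlonglongrightarrow> exp (- (0 * (1 / c)))"
      by (intro tendsto_intros LIMSEQ_inverse_real_of_nat)
    moreover have "flat 0 (real (Suc j) * c) = exp (- (inverse (real (Suc j)) * (1 / c)))" for j
    proof -
      have "0 < real (Suc j) * c" using c by simp
      then show ?thesis by (simp add: flat_def divide_inverse mult.commute del: of_nat_Suc)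
    qed
    ultimately show ?thesis by simp
  qed
  have "(\<lambda>j. flat 0 (real (Suc j) * (x - a)) * flat 0 (real (Suc j) * (b - x))) \<longlonglongrightarrow> 1 * 1"
    using True by (intro tendsto_mult f) auto
  moreover have "bump a b j x = flat 0 (real (Suc j) * (x - a)) * flat 0 (real (Suc j) * (b - x))" for j
    unfolding bump_def by (simp add: algebra_simps del: of_nat_Suc)
  ultimately show ?thesis using True by simp
next
  case False
  then have "(\<lambda>j. bump a b j x) = (\<lambda>j. 0)" using bump_zero by auto
  then show ?thesis using False by simp
qed

definition locally_integrable :: "(real \<Rightarrow> real) \<Rightarrow> bool" where
  "locally_integrable f \<longleftrightarrow> f \<in> borel_measurable borel \<and> (\<forall>a b. set_integrable lborel {a..b} f)"

lemma locally_integrableD: "locally_integrable f \<Longrightarrow> f \<in> borel_measurable borel" "locally_integrable f \<Longrightarrow> set_integrable lborel {a..b} f"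
  by (auto simp: locally_integrable_def)

lemma locally_bounded_locally_integrable: assumes "locally_bounded f" shows "locally_integrable f"
proof -
  have "set_integrable lborel {a..b} f" for a b
  proof -
    obtain M where "\<forall>x\<in>{a..b}. \<bar>f x\<bar> \<le> M" using locally_bounded_bound[OF assms] by meson
    then show ?thesis
      using assms unfolding set_integrable_def locally_bounded_def
      by (intro integrableI_bounded_set_indicator[where B = M]) (auto simp: emeasure_lborel_Icc_eq)
  qed
  then show ?thesis using assms by (auto simp: locally_integrable_def locally_bounded_def)
qed

lemma locally_integrable_diff: "locally_integrable f \<Longrightarrow> locally_integrable g \<Longrightarrow> locally_integrable (\<lambda>x. f x - g x)"
  unfolding locally_integrable_def by (auto intro: set_integral_diff)

lemma locally_integrable_mult_bounded:
  assumes f: "locally_integrable f" and g: "locally_bounded g" shows "locally_integrable (\<lambda>x. f x * g x)"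
proof -
  have "set_integrable lborel {a..b} (\<lambda>x. f x * g x)" for a b
  proof -
    obtain M where M: "\<forall>x\<in>{a..b}. \<bar>g x\<bar> \<le> M" using locally_bounded_bound[OF g] by meson
    have "integrable lborel (\<lambda>x. M *\<^sub>R (indicator {a..b} x *\<^sub>R f x))"
      using locally_integrableD(2)[OF f] by (intro integrable_scaleR_right) (auto simp: set_integrable_def)
    then show ?thesis unfolding set_integrable_def
    proof (rule Bochner_Integration.integrable_bound)
      show "(\<lambda>x. indicator {a..b} x *\<^sub>R (f x * g x)) \<in> borel_measurable lborel"
        using locally_integrableD(1)[OF f] g by (auto simp: locally_bounded_def)
      show "AE x in lborel. norm (indicator {a..b} x *\<^sub>R (f x * g x)) \<le> norm (M *\<^sub>R (indicator {a..b} x *\<^sub>R f x))"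
      proof (rule AE_I2)
        fix x
        show "norm (indicator {a..b} x *\<^sub>R (f x * g x)) \<le> norm (M *\<^sub>R (indicator {a..b} x *\<^sub>R f x))"
        proof (cases "x \<in> {a..b}")
          case True
          then have "\<bar>f x\<bar> * \<bar>g x\<bar> \<le> \<bar>f x\<bar> * \<bar>M\<bar>" using M by (intro mult_left_mono) fastforce+
          then show ?thesis using True by (simp add: abs_mult mult.commute)
        qed simp
      qed
    qed
  qed
  then show ?thesis using f g by (auto simp: locally_integrable_def locally_bounded_def)
qed

lemma locally_integrable_compact_support:
  assumes f: "locally_integrable f" and z: "\<And>x. N \<le> \<bar>x\<bar> \<Longrightarrow> f x = 0"
  shows "integrable lborel f" "integral\<^sup>L lborel f = integral {-N..N} f"
proof -
  have "(\<lambda>x. indicator {-N..N} x *\<^sub>R f x) = f"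
  proof
    fix x show "indicator {-N..N} x *\<^sub>R f x = f x"
      using z[of x] by (cases "x \<in> {-N..N}") auto
  qed
  then show "integrable lborel f" "integral\<^sup>L lborel f = integral {-N..N} f"
    using locally_integrableD(2)[OF f, of "-N" N] set_borel_integral_eq_integral(2)[OF locally_integrableD(2)[OF f, of "-N" N]]
    by (simp_all add: set_integrable_def set_lebesgue_integral_def)
qed

lemma locally_integrable_test:
  assumes "locally_integrable f" "test_fun \<phi>" shows "integrable lborel (\<lambda>x. f x * \<phi> x)" "locally_integrable (\<lambda>x. f x * \<phi> x)"
proof -
  show l: "locally_integrable (\<lambda>x. f x * \<phi> x)" by (intro locally_integrable_mult_bounded assms locally_bounded_continuous test_fun_continuous)
  obtain N where "\<And>x. N \<le> \<bar>x\<bar> \<Longrightarrow> f x * \<phi> x = 0" using assms(2) by (auto simp: test_fun_def)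
  then show "integrable lborel (\<lambda>x. f x * \<phi> x)" by (rule locally_integrable_compact_support(1)[OF l])
qed

text \<open>Open intervals are stable under intersection and generate the Borel sets, so all integrals over Borel sets vanish.\<close>
lemma integral_over_intervals_zero:
  fixes f :: "real \<Rightarrow> real"
  assumes f: "integrable lborel f" and z: "\<And>a b. (\<integral>x\<in>{a<..<b}. f x \<partial>lborel) = 0" and t: "integral\<^sup>L lborel f = 0"
  shows "AE x in lborel. f x = 0"
proof (rule density_unique_real[OF f, of "\<lambda>x. 0"])
  fix A :: "real set" assume "A \<in> sets lborel"
  have bs: "sets borel = sigma_sets UNIV (range (\<lambda>(a, b). {a<..<b::real}))"
  proof -
    have "borel = sigma UNIV (range (\<lambda>(a, b). {a<..<b::real}))"
      using borel_eq_box[where 'a = real] by (simp add: box_real)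
    then show ?thesis by (metis (no_types, lifting) sets_measure_of top_greatest Pow_UNIV)
  qed
  have A: "A \<in> sigma_sets UNIV (range (\<lambda>(a, b). {a<..<b}))"
    using \<open>A \<in> sets lborel\<close> bs by simp
  have si: "set_integrable lborel B f" if "B \<in> sets borel" for B
    using integrable_mult_indicator[OF _ f, of B] that by (simp add: set_integrable_def)
  have s: "B \<in> sets borel" if "B \<in> sigma_sets UNIV (range (\<lambda>(a, b). {a<..<b::real}))" for B
    using that bs by simp
  have IS: "Int_stable (range (\<lambda>(a, b). {a<..<b::real}))"
  proof (rule Int_stableI_image)
    fix i j :: "real \<times> real"
    show "\<exists>k\<in>UNIV. (case i of (a, b) \<Rightarrow> {a<..<b}) \<inter> (case j of (a, b) \<Rightarrow> {a<..<b}) = (case k of (a, b) \<Rightarrow> {a<..<b})"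
      by (intro bexI[of _ "(max (fst i) (fst j), min (snd i) (snd j))"]) (auto split: prod.split)
  qed
  have "range (\<lambda>(a, b). {a<..<b::real}) \<subseteq> Pow UNIV" by simp
  with IS have "(\<integral>x\<in>A. f x \<partial>lborel) = 0" using A
  proof (induction rule: sigma_sets_induct_disjoint)
    case (basic A)
    then show ?case using z by auto
  next
    case empty
    then show ?case by (simp add: set_lebesgue_integral_def)
  next
    case (compl A)
    have "(\<integral>x\<in>A \<union> (UNIV - A). f x \<partial>lborel) = (\<integral>x\<in>A. f x \<partial>lborel) + (\<integral>x\<in>UNIV - A. f x \<partial>lborel)"
      using s[OF compl(1)] by (intro set_integral_Un si) auto
    moreover have "A \<union> (UNIV - A) = UNIV" by auto
    ultimately show ?case using t compl(2) by (simp add: set_lebesgue_integral_def)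
  next
    case (union A)
    have "(\<integral>x\<in>(\<Union>i. A i). f x \<partial>lborel) = (\<Sum>i. (\<integral>x\<in>A i. f x \<partial>lborel))"
    proof (rule lebesgue_integral_countable_add)
      show "A i \<in> sets lborel" for i using union(2) s by auto
      show "A i \<inter> A j = {}" if "i \<noteq> j" for i j using union(1) that by (auto simp: disjoint_family_on_def)
      show "set_integrable lborel (\<Union>i. A i) f" using union(2) s by (intro si) auto
    qed
    then show ?case using union(3) by simp
  qed
  then show "(\<integral>x\<in>A. f x \<partial>lborel) = (\<integral>x\<in>A. 0 \<partial>lborel)" by simp
qed auto

text \<open>Testing with bumps shows that the integral over each interval is zero.\<close>
lemma fundamental_lemma:
  assumes h: "locally_integrable h" and z: "\<And>\<phi>. test_fun \<phi> \<Longrightarrow> (\<integral>x. h x * \<phi> x \<partial>lborel) = 0"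
  shows "AE x in lborel. h x = 0"
proof -
  have i0: "(\<integral>x\<in>{a<..<b}. h x \<partial>lborel) = 0" for a b
  proof -
    have "(\<lambda>j. \<integral>x. h x * bump a b j x \<partial>lborel) \<longlonglongrightarrow> (\<integral>x. h x * indicator {a<..<b} x \<partial>lborel)"
    proof (rule integral_dominated_convergence[where w = "\<lambda>x. indicator {a..b} x *\<^sub>R \<bar>h x\<bar>"])
      show "integrable lborel (\<lambda>x. indicator {a..b} x *\<^sub>R \<bar>h x\<bar>)"
        using integrable_abs[OF locally_integrableD(2)[OF h, of a b, unfolded set_integrable_def]] by (simp add: abs_mult)
      show "AE x in lborel. norm (h x * bump a b j x) \<le> indicator {a..b} x *\<^sub>R \<bar>h x\<bar>" for j
      proof (rule AE_I2)
        fix x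
        show "norm (h x * bump a b j x) \<le> indicator {a..b} x *\<^sub>R \<bar>h x\<bar>"
          using bump_bounds[of a b j x] bump_zero[of x a b j] by (auto simp: indicator_def abs_mult mult_left_le)
      qed
      show "(\<lambda>x. h x * bump a b j x) \<in> borel_measurable lborel" for j
        using locally_integrableD(1)[OF h] borel_measurable_continuous_onI[OF test_fun_continuous[OF test_fun_bump]] by auto
      show "(\<lambda>x. h x * indicator {a<..<b} x) \<in> borel_measurable lborel"
        using locally_integrableD(1)[OF h] by auto
      show "AE x in lborel. (\<lambda>j. h x * bump a b j x) \<longlonglongrightarrow> h x * indicator {a<..<b} x"
        by (intro AE_I2 tendsto_intros bump_tendsto)
    qed
    then have "(\<lambda>j::nat. 0) \<longlonglongrightarrow> (\<integral>x. h x * indicator {a<..<b} x \<partial>lborel)"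
      by (simp only: z[OF test_fun_bump])
    from LIMSEQ_unique[OF this tendsto_const] have "(\<integral>x. h x * indicator {a<..<b} x \<partial>lborel) = 0" .
    then show ?thesis by (simp add: set_lebesgue_integral_def mult.commute)
  qed
  have "AE x in lborel. indicator {-real N<..<real N} x * h x = 0" for N :: nat
  proof (rule integral_over_intervals_zero)
    let ?f = "\<lambda>x. indicator {-real N<..<real N} x * h x"
    have "set_integrable lborel {-real N<..<real N} h"
      by (rule set_integrable_subset[OF locally_integrableD(2)[OF h, of "- real N" "real N"]]) auto
    then show "integrable lborel ?f" by (simp add: set_integrable_def)
    show "integral\<^sup>L lborel ?f = 0" using i0[of "- real N" "real N"] by (simp add: set_lebesgue_integral_def)
    fix a b
    have "indicator {a<..<b} x *\<^sub>R ?f x = indicator {max a (- real N)<..<min b (real N)} x *\<^sub>R h x" for x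
      by (auto simp: indicator_def)
    then show "(\<integral>x\<in>{a<..<b}. ?f x \<partial>lborel) = 0"
      using i0[of "max a (- real N)" "min b (real N)"] unfolding set_lebesgue_integral_def by (simp only:)
  qed
  then have "AE x in lborel. \<forall>N::nat. indicator {-real N<..<real N} x * h x = 0"
    unfolding AE_all_countable by blast
  then show ?thesis
  proof (rule AE_mp, intro AE_I2 impI)
    fix x assume a: "\<forall>N::nat. indicator {-real N<..<real N} x * h x = 0"
    obtain N :: nat where "\<bar>x\<bar> < real N" using reals_Archimedean2 by blast
    then show "h x = 0" using a[rule_format, of N] by (auto simp: indicator_def abs_less_iff)
  qed
qed

section \<open>Weak derivatives are derivatives of primitives\<close>

lemma locally_integrable_integrable_on: "locally_integrable f \<Longrightarrow> f integrable_on {a..b}"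
  by (rule set_borel_integral_eq_integral(1)[OF locally_integrableD(2)])

lemma locally_integrable_abs: assumes "locally_integrable f" shows "locally_integrable (\<lambda>x. \<bar>f x\<bar>)"
  using assms unfolding locally_integrable_def by (auto intro: set_integrable_abs)

lemma antideriv_continuous: assumes g: "locally_integrable g" shows "continuous_on UNIV (antideriv g)"
proof -
  have "isCont (antideriv g) x" for x
  proof -
    define N where "N = \<bar>x\<bar> + 1"
    have "continuous_on {-N..N} (\<lambda>x. antideriv g (-N) + integral {-N..x} g)"
      by (intro continuous_intros indefinite_integral_continuous_1 locally_integrable_integrable_on[OF g])
    then have "continuous_on {-N..N} (antideriv g)"
    proof (rule continuous_on_eq)
      fix y assume "y \<in> {-N..N}"
      then show "antideriv g (-N) + integral {-N..y} g = antideriv g y"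
        using antideriv_diff[OF locally_integrable_integrable_on[OF g], of "-N" y] by simp
    qed
    then show ?thesis by (rule continuous_on_interior) (auto simp: N_def)
  qed
  then show ?thesis by (simp add: continuous_at_imp_continuous_on)
qed

lemma primitive_parts:
  assumes F: "primitive f F" and \<phi>: "test_fun \<phi>"
  shows "(\<integral>x. F x * deriv \<phi> x \<partial>lborel) = - (\<integral>x. f x * \<phi> x \<partial>lborel)"
proof -
  note d = test_fun_deriv(1)[OF \<phi>]
  obtain N where N: "N > 0" "\<And>x. N \<le> \<bar>x\<bar> \<Longrightarrow> \<phi> x = 0 \<and> deriv \<phi> x = 0"
    using test_fun_zero_outside[OF \<phi>] by blast
  have p: "primitive (\<lambda>x. f x * \<phi> x + F x * deriv \<phi> x) (\<lambda>x. F x * \<phi> x)"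
    by (rule primitive_mult[OF F test_fun_prim[OF \<phi>]])
  have l: "locally_integrable f" "locally_integrable F" using F by (auto intro: locally_bounded_locally_integrable primitive_locally_bounded primitive_locally_bounded')
  have "(\<integral>x. f x * \<phi> x \<partial>lborel) + (\<integral>x. F x * deriv \<phi> x \<partial>lborel) = (\<integral>x. f x * \<phi> x + F x * deriv \<phi> x \<partial>lborel)"
    by (intro Bochner_Integration.integral_add[symmetric] locally_integrable_test l \<phi> d)
  also have "\<dots> = integral {-N..N} (\<lambda>x. f x * \<phi> x + F x * deriv \<phi> x)"
    by (rule locally_integrable_compact_support(2)[OF locally_bounded_locally_integrable[OF primitive_locally_bounded[OF p]]]) (use N in auto)
  also have "\<dots> = F N * \<phi> N - F (-N) * \<phi> (-N)"
    using p N(1) by (intro integral_unique) (auto simp: primitive_def)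
  also have "\<dots> = 0" using N(1) N(2)[of N] N(2)[of "-N"] by simp
  finally show ?thesis by simp
qed

lemma antideriv_abs_bound:
  assumes f: "locally_integrable f" and x: "x \<in> {-N..N}"
  shows "\<bar>antideriv f x\<bar> \<le> integral {-N..N} (\<lambda>x. \<bar>f x\<bar>)"
proof -
  note i = locally_integrable_integrable_on[OF f] locally_integrable_integrable_on[OF locally_integrable_abs[OF f]]
  have b: "\<bar>integral {a..b} f\<bar> \<le> integral {-N..N} (\<lambda>x. \<bar>f x\<bar>)" if "{a..b} \<subseteq> {-N..N}" for a b
  proof -
    have "\<bar>integral {a..b} f\<bar> \<le> integral {a..b} (\<lambda>x. \<bar>f x\<bar>)"
      using integral_norm_bound_integral[of f "{a..b}" "\<lambda>x. \<bar>f x\<bar>"] i by simp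
    also have "\<dots> \<le> integral {-N..N} (\<lambda>x. \<bar>f x\<bar>)"
      by (intro integral_subset_le that i) auto
    finally show ?thesis .
  qed
  have z: "integral {a..b} f = 0" if "b \<le> a" for a b using that by (cases "a = b") auto
  show ?thesis
  proof (cases "0 \<le> x")
    case True
    then have "antideriv f x = integral {0..x} f" using z[where a=x and b=0] by (simp add: antideriv_def)
    then show ?thesis using b[of 0 x] x True by simp
  next
    case False
    then have "antideriv f x = - integral {x..0} f" using z[where a=0 and b=x] by (simp add: antideriv_def)
    then show ?thesis using b[of x 0] x False by simp
  qed
qed

text \<open>The truncations of \<open>g\<close> are locally bounded, so the integration by parts above applies to them; it passes to the limit by
dominated convergence.\<close>
lemma antideriv_parts:
  assumes g: "locally_integrable g" and \<phi>: "test_fun \<phi>"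
  shows "(\<integral>x. antideriv g x * deriv \<phi> x \<partial>lborel) = - (\<integral>x. g x * \<phi> x \<partial>lborel)"
proof -
  note d = test_fun_deriv(1)[OF \<phi>]
  note gm = locally_integrableD(1)[OF g]
  define gn where "gn n x = max (- real n) (min (real n) (g x))" for n x
  have gnm: "gn n \<in> borel_measurable borel" for n unfolding gn_def[abs_def] using gm by measurable
  have lgn: "locally_bounded (gn n)" for n
    by (rule locally_bounded_bounded[OF gnm, of _ "real n"]) (auto simp: gn_def)
  have gnb: "\<bar>gn n x\<bar> \<le> \<bar>g x\<bar>" for n x by (auto simp: gn_def)
  have gnl: "(\<lambda>n. gn n x) \<longlonglongrightarrow> g x" for x
  proof (rule tendsto_eventually)
    obtain m :: nat where m: "\<bar>g x\<bar> \<le> real m" using real_arch_simple by blast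
    have "gn n x = g x" if "m \<le> n" for n
    proof -
      have "\<bar>g x\<bar> \<le> real n" using m that by linarith
      then show ?thesis by (auto simp: gn_def)
    qed
    then show "\<forall>\<^sub>F n in sequentially. gn n x = g x" by (auto simp: eventually_sequentially)
  qed
  obtain N where N: "N > 0" "\<And>x. N \<le> \<bar>x\<bar> \<Longrightarrow> \<phi> x = 0 \<and> deriv \<phi> x = 0"
    using test_fun_zero_outside[OF \<phi>] by blast
  have lA: "locally_integrable (antideriv g)" by (intro locally_bounded_locally_integrable locally_bounded_continuous antideriv_continuous g)
  have lAn: "locally_integrable (antideriv (gn n))" for n by (intro locally_bounded_locally_integrable primitive_locally_bounded'[OF primitive_antideriv[OF lgn]])
  have parts: "(\<integral>x. antideriv (gn n) x * deriv \<phi> x \<partial>lborel) = - (\<integral>x. gn n x * \<phi> x \<partial>lborel)" for n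
    by (rule primitive_parts[OF primitive_antideriv[OF lgn] \<phi>])
  have lim1: "(\<lambda>n. \<integral>x. gn n x * \<phi> x \<partial>lborel) \<longlonglongrightarrow> (\<integral>x. g x * \<phi> x \<partial>lborel)"
  proof (rule integral_dominated_convergence[where w = "\<lambda>x. \<bar>g x * \<phi> x\<bar>"])
    show "integrable lborel (\<lambda>x. \<bar>g x * \<phi> x\<bar>)" by (intro integrable_abs locally_integrable_test g \<phi>)
    show "(\<lambda>x. g x * \<phi> x) \<in> borel_measurable lborel" using locally_integrable_test(1)[OF g \<phi>] by auto
    show "(\<lambda>x. gn n x * \<phi> x) \<in> borel_measurable lborel" for n using locally_integrable_test(1)[OF locally_bounded_locally_integrable[OF lgn] \<phi>] by auto
    show "AE x in lborel. (\<lambda>n. gn n x * \<phi> x) \<longlonglongrightarrow> g x * \<phi> x" by (intro AE_I2 tendsto_intros gnl)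
    show "AE x in lborel. norm (gn n x * \<phi> x) \<le> \<bar>g x * \<phi> x\<bar>" for n
      by (intro AE_I2) (auto simp: abs_mult intro!: mult_right_mono gnb)
  qed
  define D where "D n = integral {-N..N} (\<lambda>x. \<bar>gn n x - g x\<bar>)" for n
  have ld: "locally_integrable (\<lambda>x. gn n x - g x)" for n by (intro locally_integrable_diff locally_bounded_locally_integrable lgn g)
  have D0: "D \<longlonglongrightarrow> 0"
  proof -
    have "(\<lambda>n. \<integral>x. indicator {-N..N} x *\<^sub>R \<bar>gn n x - g x\<bar> \<partial>lborel) \<longlonglongrightarrow> (\<integral>x. 0 \<partial>(lborel::real measure))"
    proof (rule integral_dominated_convergence[where w = "\<lambda>x. 2 * (indicator {-N..N} x *\<^sub>R \<bar>g x\<bar>)"])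
      show "integrable lborel (\<lambda>x. 2 * (indicator {-N..N} x *\<^sub>R \<bar>g x\<bar>))"
        using locally_integrableD(2)[OF locally_integrable_abs[OF g], of "-N" N] unfolding set_integrable_def by (intro integrable_mult_right) auto
      show "(\<lambda>x. indicator {-N..N} x *\<^sub>R \<bar>gn n x - g x\<bar>) \<in> borel_measurable lborel" for n using gm gnm by auto
      show "AE x in lborel. norm (indicator {-N..N} x *\<^sub>R \<bar>gn n x - g x\<bar>) \<le> 2 * (indicator {-N..N} x *\<^sub>R \<bar>g x\<bar>)" for n
      proof (rule AE_I2)
        fix x
        have "\<bar>gn n x - g x\<bar> \<le> 2 * \<bar>g x\<bar>" using gnb[of n x] by linarith
        then show "norm (indicator {-N..N} x *\<^sub>R \<bar>gn n x - g x\<bar>) \<le> 2 * (indicator {-N..N} x *\<^sub>R \<bar>g x\<bar>)"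
          by (auto simp: indicator_def)
      qed
      show "AE x in lborel. (\<lambda>n. indicator {-N..N} x *\<^sub>R \<bar>gn n x - g x\<bar>) \<longlonglongrightarrow> 0"
      proof (rule AE_I2)
        fix x
        have "(\<lambda>n. indicator {-N..N} x *\<^sub>R \<bar>gn n x - g x\<bar>) \<longlonglongrightarrow> indicator {-N..N} x *\<^sub>R \<bar>g x - g x\<bar>"
          by (intro tendsto_intros gnl)
        then show "(\<lambda>n. indicator {-N..N} x *\<^sub>R \<bar>gn n x - g x\<bar>) \<longlonglongrightarrow> 0" by simp
      qed
    qed auto
    moreover have "D n = (\<integral>x. indicator {-N..N} x *\<^sub>R \<bar>gn n x - g x\<bar> \<partial>lborel)" for n
      unfolding D_def using set_borel_integral_eq_integral(2)[OF locally_integrableD(2)[OF locally_integrable_abs[OF ld], of "-N" N n]]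
      by (simp add: set_lebesgue_integral_def)
    then have "D = (\<lambda>n. \<integral>x. indicator {-N..N} x *\<^sub>R \<bar>gn n x - g x\<bar> \<partial>lborel)" by (rule ext)
    ultimately show ?thesis by simp
  qed
  have "(\<lambda>n. (\<integral>x. antideriv (gn n) x * deriv \<phi> x \<partial>lborel) - (\<integral>x. antideriv g x * deriv \<phi> x \<partial>lborel)) \<longlonglongrightarrow> 0"
  proof (rule Lim_null_comparison[where g = "\<lambda>n. D n * (\<integral>x. \<bar>deriv \<phi> x\<bar> \<partial>lborel)"])
    show "(\<lambda>n. D n * (\<integral>x. \<bar>deriv \<phi> x\<bar> \<partial>lborel)) \<longlonglongrightarrow> 0" by (rule tendsto_mult_left_zero[OF D0])
    have "norm ((\<integral>x. antideriv (gn n) x * deriv \<phi> x \<partial>lborel) - (\<integral>x. antideriv g x * deriv \<phi> x \<partial>lborel)) \<le> D n * (\<integral>x. \<bar>deriv \<phi> x\<bar> \<partial>lborel)" for n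
    proof -
      have id: "integrable lborel (deriv \<phi>)" using locally_integrable_test(1)[OF locally_bounded_locally_integrable[OF locally_bounded_const[of 1]] d] by simp
      let ?d = "\<lambda>x. antideriv (gn n) x * deriv \<phi> x - antideriv g x * deriv \<phi> x"
      have 1: "(\<integral>x. antideriv (gn n) x * deriv \<phi> x \<partial>lborel) - (\<integral>x. antideriv g x * deriv \<phi> x \<partial>lborel)
         = (\<integral>x. ?d x \<partial>lborel)"
        by (intro Bochner_Integration.integral_diff[symmetric] locally_integrable_test lA lAn d)
      have 2: "norm (\<integral>x. ?d x \<partial>lborel) \<le> (\<integral>x. norm (?d x) \<partial>lborel)"
        by (rule integral_norm_bound)
      have 3: "(\<integral>x. norm (?d x) \<partial>lborel) \<le> (\<integral>x. D n * \<bar>deriv \<phi> x\<bar> \<partial>lborel)"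
      proof (rule integral_mono)
        show "integrable lborel (\<lambda>x. norm (antideriv (gn n) x * deriv \<phi> x - antideriv g x * deriv \<phi> x))"
          by (intro integrable_norm Bochner_Integration.integrable_diff locally_integrable_test lA lAn d)
        show "integrable lborel (\<lambda>x. D n * \<bar>deriv \<phi> x\<bar>)" using id by (intro integrable_mult_right integrable_abs)
        fix x
        show "norm (antideriv (gn n) x * deriv \<phi> x - antideriv g x * deriv \<phi> x) \<le> D n * \<bar>deriv \<phi> x\<bar>"
        proof (cases "x \<in> {-N..N}")
          case True
          have "antideriv (gn n) x - antideriv g x = antideriv (\<lambda>x. gn n x - g x) x"
            unfolding antideriv_def
            using locally_integrable_integrable_on[OF g] locally_integrable_integrable_on[OF locally_bounded_locally_integrable[OF lgn[of n]]]
            by (simp add: Henstock_Kurzweil_Integration.integral_diff)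
          then have "\<bar>antideriv (gn n) x - antideriv g x\<bar> \<le> D n"
            unfolding D_def using antideriv_abs_bound[OF ld True, of n] by simp
          then show ?thesis by (simp add: left_diff_distrib[symmetric] abs_mult mult_right_mono)
        next
          case False
          then show ?thesis using N(2)[of x] by auto
        qed
      qed
      have 4: "(\<integral>x. D n * \<bar>deriv \<phi> x\<bar> \<partial>lborel) = D n * (\<integral>x. \<bar>deriv \<phi> x\<bar> \<partial>lborel)" by simp
      show ?thesis unfolding 1 4[symmetric] by (rule order_trans[OF 2 3])
    qed
    then show "\<forall>\<^sub>F n in sequentially. norm ((\<integral>x. antideriv (gn n) x * deriv \<phi> x \<partial>lborel) - (\<integral>x. antideriv g x * deriv \<phi> x \<partial>lborel)) \<le> D n * (\<integral>x. \<bar>deriv \<phi> x\<bar> \<partial>lborel)"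
      by simp
  qed
  then have lim2: "(\<lambda>n. \<integral>x. antideriv (gn n) x * deriv \<phi> x \<partial>lborel) \<longlonglongrightarrow> (\<integral>x. antideriv g x * deriv \<phi> x \<partial>lborel)"
    by (simp add: LIM_zero_iff)
  have "(\<lambda>n. - (\<integral>x. gn n x * \<phi> x \<partial>lborel)) \<longlonglongrightarrow> - (\<integral>x. g x * \<phi> x \<partial>lborel)"
    by (intro tendsto_intros lim1)
  from LIMSEQ_unique[OF lim2[unfolded parts] this] show ?thesis .
qed

lemma test_fun_antiderivative:
  assumes \<psi>: "test_fun \<psi>" and z: "(\<integral>x. \<psi> x \<partial>lborel) = 0"
  shows "\<exists>\<phi>. test_fun \<phi> \<and> deriv \<phi> = \<psi>"
proof -
  obtain N where N: "N > 0" "\<And>x. N \<le> \<bar>x\<bar> \<Longrightarrow> \<psi> x = 0"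
    using test_fun_zero_outside[OF \<psi>] by blast
  have l: "locally_bounded \<psi>" by (intro locally_bounded_continuous test_fun_continuous \<psi>)
  note p = primitive_antideriv[OF l]
  define \<phi> where "\<phi> x = antideriv \<psi> x - antideriv \<psi> (-N)" for x
  have diff: "antideriv \<psi> b - antideriv \<psi> a = integral {a..b} \<psi>" if "a \<le> b" for a b
    by (rule antideriv_diff[OF locally_bounded_integrable[OF l] that])
  have der: "(\<phi> has_real_derivative \<psi> x) (at x)" for x
  proof -
    define m where "m = x - 1"
    have "((\<lambda>y. integral {m..y} \<psi>) has_real_derivative \<psi> x) (at x within {m..x+1})"
      by (rule integral_has_real_derivative) (auto simp: m_def intro: test_fun_continuous \<psi>)
    then have "((\<lambda>y. integral {m..y} \<psi>) has_real_derivative \<psi> x) (at x)"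
      by (simp add: m_def at_within_Icc_at)
    then have "((\<lambda>y. integral {m..y} \<psi> + (antideriv \<psi> m - antideriv \<psi> (-N))) has_real_derivative \<psi> x) (at x)"
      by (auto intro!: derivative_eq_intros)
    then show ?thesis
    proof (rule has_field_derivative_transform_within_open[where S = "{m<..}"])
      fix y assume "y \<in> {m<..}"
      then show "integral {m..y} \<psi> + (antideriv \<psi> m - antideriv \<psi> (-N)) = \<phi> y"
        using diff[of m y] by (simp add: \<phi>_def)
    qed (auto simp: m_def)
  qed
  have I: "integral {-N..N} \<psi> = 0"
    using locally_integrable_compact_support(2)[OF locally_bounded_locally_integrable[OF l], of N] N(2) z by simp
  have zero: "\<phi> x = 0" if x: "N \<le> \<bar>x\<bar>" for x
  proof (cases "x \<le> 0")
    case True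
    have "antideriv \<psi> (-N) = antideriv \<psi> x"
      using x True N by (intro primitive_zero[OF p]) auto
    then show ?thesis by (simp add: \<phi>_def)
  next
    case False
    then have "antideriv \<psi> x = antideriv \<psi> N"
      using x N by (intro primitive_zero[OF p]) auto
    then show ?thesis using diff[of "-N" N] I N(1) by (simp add: \<phi>_def)
  qed
  have "ndiff n \<phi>" for n
  proof (cases n)
    case (Suc m)
    then show ?thesis using ndiff_SucI[of \<phi> \<psi> m, OF der] \<psi> by (auto simp: test_fun_def)
  qed simp
  then have "test_fun \<phi>" using zero by (auto simp: test_fun_def)
  moreover have "deriv \<phi> = \<psi>" using der by (auto intro!: DERIV_imp_deriv)
  ultimately show ?thesis by blast
qed

lemma test_fun_unit_mass: "\<exists>\<rho>. test_fun \<rho> \<and> (\<integral>x. \<rho> x \<partial>lborel) = 1"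
proof -
  have "\<exists>j. (\<integral>x. bump 0 1 j x \<partial>lborel) \<noteq> 0"
  proof (rule ccontr)
    assume "\<not> ?thesis"
    then have z: "(\<integral>x. bump 0 1 j x \<partial>lborel) = 0" for j by blast
    have "(\<lambda>j. \<integral>x. bump 0 1 j x \<partial>lborel) \<longlonglongrightarrow> (\<integral>x. indicator {0<..<1} x \<partial>(lborel::real measure))"
    proof (rule integral_dominated_convergence[where w = "\<lambda>x. indicator {0..1} x"])
      show "AE x in lborel. norm (bump 0 1 j x) \<le> indicator {0..1} x" for j
      proof (rule AE_I2)
        fix x :: real
        show "norm (bump 0 1 j x) \<le> indicator {0..1} x"
          using bump_bounds[of 0 1 j x] bump_zero[of x 0 1 j] by (auto simp: indicator_def)
      qed
      show "bump 0 1 j \<in> borel_measurable lborel" for j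
        using borel_measurable_continuous_onI[OF test_fun_continuous[OF test_fun_bump]] by auto
      show "AE x in lborel. (\<lambda>j. bump 0 1 j x) \<longlonglongrightarrow> indicator {0<..<1} x"
        by (intro AE_I2 bump_tendsto)
      show "integrable lborel (indicator {0..1} :: real \<Rightarrow> real)" by (intro integrable_real_indicator) auto
    qed auto
    then have "(\<lambda>j::nat. 0) \<longlonglongrightarrow> (1::real)" using z by simp
    then show False using LIMSEQ_unique[OF _ tendsto_const] by fastforce
  qed
  then obtain j where j: "(\<integral>x. bump 0 1 j x \<partial>lborel) \<noteq> 0" by blast
  have "test_fun (\<lambda>x. inverse (\<integral>x. bump 0 1 j x \<partial>lborel) * bump 0 1 j x)" by (intro test_fun_cmult test_fun_bump)
  then show ?thesis using j by (intro exI[of _ "\<lambda>x. inverse (\<integral>x. bump 0 1 j x \<partial>lborel) * bump 0 1 j x"]) simp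
qed

text \<open>The difference \<open>h\<close> of \<open>u\<close> and the primitive of \<open>g\<close> annihilates the derivatives of test functions. These are exactly the
test functions with integral zero, and subtracting a multiple of a fixed \<open>\<rho>\<close> of integral one gives every test
function this property. Hence \<open>h - c\<close> annihilates all test functions.\<close>
lemma du_Bois_Reymond:
  assumes u: "locally_integrable u" and g: "locally_integrable g"
    and w: "\<And>\<phi>. test_fun \<phi> \<Longrightarrow> (\<integral>x. u x * deriv \<phi> x \<partial>lborel) = - (\<integral>x. g x * \<phi> x \<partial>lborel)"
  shows "\<exists>c. AE x in lborel. u x = c + antideriv g x"
proof -
  have lA: "locally_integrable (antideriv g)" by (intro locally_bounded_locally_integrable locally_bounded_continuous antideriv_continuous g)
  define h where "h x = u x - antideriv g x" for x
  have h: "locally_integrable h" unfolding h_def[abs_def] by (intro locally_integrable_diff u lA)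
  have hd: "(\<integral>x. h x * deriv \<phi> x \<partial>lborel) = 0" if "test_fun \<phi>" for \<phi>
  proof -
    have "(\<integral>x. h x * deriv \<phi> x \<partial>lborel) = (\<integral>x. u x * deriv \<phi> x - antideriv g x * deriv \<phi> x \<partial>lborel)"
      by (simp add: h_def left_diff_distrib)
    also have "\<dots> = (\<integral>x. u x * deriv \<phi> x \<partial>lborel) - (\<integral>x. antideriv g x * deriv \<phi> x \<partial>lborel)"
      by (intro Bochner_Integration.integral_diff locally_integrable_test u lA test_fun_deriv that)
    finally show ?thesis using w[OF that] antideriv_parts[OF g that] by simp
  qed
  obtain \<rho> where \<rho>: "test_fun \<rho>" "(\<integral>x. \<rho> x \<partial>lborel) = 1" using test_fun_unit_mass by blast
  define c where "c = (\<integral>x. h x * \<rho> x \<partial>lborel)"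
  have l1: "locally_integrable (\<lambda>x. 1)" by (intro locally_bounded_locally_integrable locally_bounded_const)
  have "AE x in lborel. h x - c = 0"
  proof (rule fundamental_lemma)
    show "locally_integrable (\<lambda>x. h x - c)" by (intro locally_integrable_diff h locally_bounded_locally_integrable locally_bounded_const)
    fix \<psi> assume \<psi>: "test_fun \<psi>"
    define m where "m = (\<integral>x. \<psi> x \<partial>lborel)"
    have i: "integrable lborel \<psi>" "integrable lborel \<rho>" using locally_integrable_test(1)[OF l1] \<psi> \<rho> by auto
    have ih: "integrable lborel (\<lambda>x. h x * \<psi> x)" "integrable lborel (\<lambda>x. h x * \<rho> x)"
      by (intro locally_integrable_test h \<psi> \<rho>)+
    have t: "test_fun (\<lambda>x. \<psi> x + (-m) * \<rho> x)" by (intro test_fun_add test_fun_cmult \<psi> \<rho>)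
    have "(\<integral>x. \<psi> x + (-m) * \<rho> x \<partial>lborel) = 0"
      using i \<rho>(2) by (simp add: m_def)
    from test_fun_antiderivative[OF t this] obtain \<phi> where \<phi>: "test_fun \<phi>" "deriv \<phi> = (\<lambda>x. \<psi> x + (-m) * \<rho> x)" by blast
    have "0 = (\<integral>x. h x * \<psi> x - m * (h x * \<rho> x) \<partial>lborel)"
      using hd[OF \<phi>(1)] unfolding \<phi>(2) by (simp add: algebra_simps)
    also have "\<dots> = (\<integral>x. h x * \<psi> x \<partial>lborel) - m * c"
      unfolding c_def using ih by simp
    finally have "(\<integral>x. h x * \<psi> x \<partial>lborel) = m * c" by simp
    then show "(\<integral>x. (h x - c) * \<psi> x \<partial>lborel) = 0"
      using ih i by (simp add: left_diff_distrib m_def)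
  qed
  then have "AE x in lborel. u x = c + antideriv g x"
    by (rule AE_mp) (auto intro!: AE_I2 simp: h_def)
  then show ?thesis by blast
qed

section \<open>Weak eigenfunctions and classical solutions\<close>

text \<open>The set where continuous functions differ is open; open null sets are empty.\<close>
lemma continuous_AE_eq:
  fixes f g :: "real \<Rightarrow> real"
  assumes c: "continuous_on UNIV f" "continuous_on UNIV g" and ae: "AE x in lborel. f x = g x"
  shows "f x = g x"
proof -
  have "open {x. f x \<noteq> g x}" by (intro open_Collect_neq c)
  moreover have "{x. f x \<noteq> g x} \<in> null_sets lborel"
  proof -
    have "{x. f x \<noteq> g x} \<in> sets borel" using \<open>open {x. f x \<noteq> g x}\<close> by simp
    then show ?thesis using ae AE_iff_null_sets[of "{x. f x \<noteq> g x}" lborel] by simp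
  qed
  then have "negligible {x. f x \<noteq> g x}"
    by (simp add: negligible_iff_null_sets null_sets_completionI)
  ultimately have "{x. f x \<noteq> g x} = {}" using open_not_negligible by blast
  then show ?thesis by blast
qed

text \<open>The lemma of du Bois-Reymond gives a continuous representative \<open>p0\<close> of the weak derivative \<open>g\<close>, then a representative \<open>y\<close>
of \<open>u\<close> with derivative \<open>p0\<close>. Now the right hand side \<open>Q y\<close> is locally bounded, and a third application makes \<open>p0\<close> its
primitive.\<close>
lemma weak_solution_regularity:
  assumes u: "locally_integrable u" and g: "locally_integrable g" and Q: "locally_bounded Q"
    and w1: "\<And>\<phi>. test_fun \<phi> \<Longrightarrow> (\<integral>x. u x * deriv \<phi> x \<partial>lborel) = - (\<integral>x. g x * \<phi> x \<partial>lborel)"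
    and w2: "\<And>\<phi>. test_fun \<phi> \<Longrightarrow> (\<integral>x. g x * deriv \<phi> x \<partial>lborel) = - (\<integral>x. Q x * u x * \<phi> x \<partial>lborel)"
  shows "\<exists>y p. solves Q y p \<and> (AE x in lborel. u x = y x)"
proof -
  have lm: "locally_integrable f \<Longrightarrow> test_fun \<phi> \<Longrightarrow> (\<lambda>x. f x * \<phi> x) \<in> borel_measurable lborel" for f \<phi>
    using locally_integrable_test(1) by blast
  have Qu: "locally_integrable (\<lambda>x. Q x * u x)" using locally_integrable_mult_bounded[OF u Q] by (simp add: mult.commute)
  from du_Bois_Reymond[OF g Qu w2] obtain c0 where c0: "AE x in lborel. g x = c0 + antideriv (\<lambda>x. Q x * u x) x" by blast
  define p0 where "p0 x = c0 + antideriv (\<lambda>x. Q x * u x) x" for x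
  have p0c: "continuous_on UNIV p0" unfolding p0_def[abs_def] by (intro continuous_intros antideriv_continuous Qu)
  have p0l: "locally_integrable p0" by (intro locally_bounded_locally_integrable locally_bounded_continuous p0c)
  have gp: "AE x in lborel. g x = p0 x" using c0 by (simp add: p0_def)
  have w1': "(\<integral>x. u x * deriv \<phi> x \<partial>lborel) = - (\<integral>x. p0 x * \<phi> x \<partial>lborel)" if "test_fun \<phi>" for \<phi>
  proof -
    have "(\<integral>x. g x * \<phi> x \<partial>lborel) = (\<integral>x. p0 x * \<phi> x \<partial>lborel)"
      by (rule integral_cong_AE) (use gp lm[OF g that] lm[OF p0l that] in auto)
    then show ?thesis using w1[OF that] by simp
  qed
  from du_Bois_Reymond[OF u p0l w1'] obtain c1 where c1: "AE x in lborel. u x = c1 + antideriv p0 x" by blast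
  define y where "y x = c1 + antideriv p0 x" for x
  have py: "primitive p0 y"
    by (rule primitive_cong[OF primitive_add[OF primitive_const[of c1] primitive_antideriv[OF locally_bounded_continuous[OF p0c]]]]) (auto simp: y_def)
  have uy: "AE x in lborel. u x = y x" using c1 by (simp add: y_def)
  have lQy: "locally_bounded (\<lambda>x. Q x * y x)" by (intro locally_bounded_mult Q primitive_locally_bounded'[OF py])
  have w2': "(\<integral>x. p0 x * deriv \<phi> x \<partial>lborel) = - (\<integral>x. Q x * y x * \<phi> x \<partial>lborel)" if "test_fun \<phi>" for \<phi>
  proof -
    have "(\<integral>x. g x * deriv \<phi> x \<partial>lborel) = (\<integral>x. p0 x * deriv \<phi> x \<partial>lborel)"
      by (rule integral_cong_AE) (use gp lm[OF g test_fun_deriv(1)[OF that]] lm[OF p0l test_fun_deriv(1)[OF that]] in auto)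
    moreover have "(\<integral>x. Q x * u x * \<phi> x \<partial>lborel) = (\<integral>x. Q x * y x * \<phi> x \<partial>lborel)"
      by (rule integral_cong_AE) (use uy lm[OF Qu that] lm[OF locally_bounded_locally_integrable[OF lQy] that] in auto)
    ultimately show ?thesis using w2[OF that] by simp
  qed
  from du_Bois_Reymond[OF p0l locally_bounded_locally_integrable[OF lQy] w2'] obtain c2 where c2: "AE x in lborel. p0 x = c2 + antideriv (\<lambda>x. Q x * y x) x" by blast
  have pQ: "primitive (\<lambda>x. Q x * y x) (\<lambda>x. c2 + antideriv (\<lambda>x. Q x * y x) x)"
    by (rule primitive_cong[OF primitive_add[OF primitive_const[of c2] primitive_antideriv[OF lQy]]]) auto
  have "p0 x = c2 + antideriv (\<lambda>x. Q x * y x) x" for x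
    by (rule continuous_AE_eq[OF p0c primitive_continuous[OF pQ] c2])
  then have "primitive (\<lambda>x. Q x * y x) p0" by (intro primitive_cong[OF pQ]) auto
  then have "solves Q y p0" using py Q by (simp add: solves_def)
  then show ?thesis using uy by blast
qed

lemma L2D: "u \<in> L2 \<Longrightarrow> u \<in> borel_measurable borel" "u \<in> L2 \<Longrightarrow> integrable lborel (\<lambda>x. (cmod (u x))\<^sup>2)"
  by (auto simp: L2_def)

lemma L2_locally_integrable:
  assumes u: "u \<in> L2" and f: "f \<in> borel_measurable borel" "\<And>x. \<bar>f x\<bar> \<le> cmod (u x)"
  shows "locally_integrable f"
proof -
  have "set_integrable lborel {a..b} f" for a b
    unfolding set_integrable_def
  proof (rule Bochner_Integration.integrable_bound)
    show "integrable lborel (\<lambda>x. indicator {a..b} x + (cmod (u x))\<^sup>2)"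
      using L2D(2)[OF u] by (intro Bochner_Integration.integrable_add integrable_real_indicator) (auto simp: emeasure_lborel_Icc_eq)
    show "(\<lambda>x. indicator {a..b} x *\<^sub>R f x) \<in> borel_measurable lborel" using f(1) by auto
    show "AE x in lborel. norm (indicator {a..b} x *\<^sub>R f x) \<le> norm (indicator {a..b} x + (cmod (u x))\<^sup>2)"
    proof (rule AE_I2)
      fix x
      have "2 * cmod (u x) \<le> 1 + (cmod (u x))\<^sup>2" using sum_squares_bound[of 1 "cmod (u x)"] by simp
      then have "cmod (u x) \<le> 1 + (cmod (u x))\<^sup>2" using norm_ge_zero[of "u x"] by linarith
      then have "\<bar>f x\<bar> \<le> 1 + (cmod (u x))\<^sup>2" using f(2)[of x] by linarith
      then show "norm (indicator {a..b} x *\<^sub>R f x) \<le> norm (indicator {a..b} x + (cmod (u x))\<^sup>2)"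
        by (auto simp: indicator_def)
    qed
  qed
  then show ?thesis using f(1) by (simp add: locally_integrable_def)
qed

lemma L2_test_integrable:
  assumes u: "u \<in> L2" and \<phi>: "test_fun \<phi>"
  shows "integrable lborel (\<lambda>x. u x * complex_of_real (\<phi> x))"
proof (rule Bochner_Integration.integrable_bound)
  have m: "\<phi> \<in> borel_measurable borel" by (intro borel_measurable_continuous_onI test_fun_continuous \<phi>)
  have "locally_integrable (\<lambda>x. cmod (u x))" using L2D(1)[OF u] by (intro L2_locally_integrable[OF u]) auto
  then show "integrable lborel (\<lambda>x. cmod (u x) * \<phi> x)" using \<phi> by (rule locally_integrable_test)
  show "(\<lambda>x. u x * complex_of_real (\<phi> x)) \<in> borel_measurable lborel" using m L2D(1)[OF u] by auto
  show "AE x in lborel. norm (u x * complex_of_real (\<phi> x)) \<le> norm (cmod (u x) * \<phi> x)"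
    by (intro AE_I2) (simp add: norm_mult)
qed

lemma weak_deriv_parts:
  assumes u: "u \<in> L2" and g: "g \<in> L2" and w: "weak_deriv k u g" and \<phi>: "test_fun \<phi>" and d: "test_fun ((deriv ^^ k) \<phi>)"
  shows "(\<integral>x. Re (u x) * (deriv ^^ k) \<phi> x \<partial>lborel) = (-1) ^ k * (\<integral>x. Re (g x) * \<phi> x \<partial>lborel)"
    "(\<integral>x. Im (u x) * (deriv ^^ k) \<phi> x \<partial>lborel) = (-1) ^ k * (\<integral>x. Im (g x) * \<phi> x \<partial>lborel)"
proof -
  let ?U = "\<integral>x. u x * complex_of_real ((deriv ^^ k) \<phi> x) \<partial>lborel" and ?G = "\<integral>x. g x * complex_of_real (\<phi> x) \<partial>lborel"
  have e: "?U = (-1) ^ k * ?G" using w \<phi> by (simp add: weak_deriv_def test_functions_iff)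
  have s: "(-1) ^ k = complex_of_real ((-1) ^ k)" by simp
  have "Re ?U = (\<integral>x. Re (u x) * (deriv ^^ k) \<phi> x \<partial>lborel)" "Im ?U = (\<integral>x. Im (u x) * (deriv ^^ k) \<phi> x \<partial>lborel)"
    "Re ?G = (\<integral>x. Re (g x) * \<phi> x \<partial>lborel)" "Im ?G = (\<integral>x. Im (g x) * \<phi> x \<partial>lborel)"
    using integral_Re[OF L2_test_integrable[OF u d]] integral_Im[OF L2_test_integrable[OF u d]]
      integral_Re[OF L2_test_integrable[OF g \<phi>]] integral_Im[OF L2_test_integrable[OF g \<phi>]] by simp_all
  moreover have "Re ?U = (-1) ^ k * Re ?G" "Im ?U = (-1) ^ k * Im ?G" unfolding e s by (simp_all del: of_real_power)
  ultimately show "(\<integral>x. Re (u x) * (deriv ^^ k) \<phi> x \<partial>lborel) = (-1) ^ k * (\<integral>x. Re (g x) * \<phi> x \<partial>lborel)"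
    "(\<integral>x. Im (u x) * (deriv ^^ k) \<phi> x \<partial>lborel) = (-1) ^ k * (\<integral>x. Im (g x) * \<phi> x \<partial>lborel)" by simp_all
qed

text \<open>The energy and the potential are real, so the real and the imaginary part of an eigenfunction are weak solutions
themselves.\<close>
lemma eigenfunction_regularity:
  assumes e: "eigenfunction (schroedinger q) (complex_of_real z) w"
    and q: "q \<in> borel_measurable borel" "\<And>x. \<bar>q x\<bar> \<le> M"
  shows "\<exists>y1 p1 y2 p2. solves (\<lambda>x. q x - z) y1 p1 \<and> solves (\<lambda>x. q x - z) y2 p2 \<and>
     (AE x in lborel. w x = Complex (y1 x) (y2 x)) \<and>
     integrable lborel (\<lambda>x. (y1 x)\<^sup>2) \<and> integrable lborel (\<lambda>x. (y2 x)\<^sup>2)"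
proof -
  have w: "w \<in> L2" and s: "\<exists>g\<in>L2. weak_deriv (Suc 0) w g"
    using e by (auto simp: eigenfunction_def schroedinger_def sobolev_W2_def)
  obtain u2 where u2: "u2 \<in> L2" "weak_deriv 2 w u2" "AE x in lborel. complex_of_real z * w x = - u2 x + of_real (q x) * w x"
    using e by (auto simp: eigenfunction_def schroedinger_def)
  obtain g where g: "g \<in> L2" "weak_deriv (Suc 0) w g" using s by blast
  have u2': "AE x in lborel. u2 x = complex_of_real (q x - z) * w x"
    using u2(3) by (rule AE_mp) (auto intro!: AE_I2 simp: algebra_simps)
  have Q: "locally_bounded (\<lambda>x. q x - z)" by (intro locally_bounded_diff locally_bounded_const locally_bounded_bounded[OF q])
  note wm = L2D(1)[OF w] and gm = L2D(1)[OF g(1)] and um = L2D(1)[OF u2(1)]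
  have lw: "locally_integrable (\<lambda>x. Re (w x))" "locally_integrable (\<lambda>x. Im (w x))"
    using wm by (auto intro!: L2_locally_integrable[OF w] simp: abs_Re_le_cmod abs_Im_le_cmod)
  have lg: "locally_integrable (\<lambda>x. Re (g x))" "locally_integrable (\<lambda>x. Im (g x))"
    using gm by (auto intro!: L2_locally_integrable[OF g(1)] simp: abs_Re_le_cmod abs_Im_le_cmod)
  have d2: "(deriv ^^ 2) \<phi> = deriv (deriv \<phi>)" for \<phi> :: "real \<Rightarrow> real" by (simp add: numeral_2_eq_2)
  have 1: "(\<integral>x. Re (w x) * deriv \<phi> x \<partial>lborel) = - (\<integral>x. Re (g x) * \<phi> x \<partial>lborel)"
    "(\<integral>x. Im (w x) * deriv \<phi> x \<partial>lborel) = - (\<integral>x. Im (g x) * \<phi> x \<partial>lborel)" if "test_fun \<phi>" for \<phi>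
    using weak_deriv_parts[OF w g that] test_fun_deriv(1)[OF that] by simp_all
  have 2: "(\<integral>x. Re (g x) * deriv \<phi> x \<partial>lborel) = - (\<integral>x. (q x - z) * Re (w x) * \<phi> x \<partial>lborel)"
    "(\<integral>x. Im (g x) * deriv \<phi> x \<partial>lborel) = - (\<integral>x. (q x - z) * Im (w x) * \<phi> x \<partial>lborel)" if \<phi>: "test_fun \<phi>" for \<phi>
  proof -
    note d = test_fun_deriv(1)[OF \<phi>] and dd = test_fun_deriv(1)[OF test_fun_deriv(1)[OF \<phi>]]
    have m: "\<phi> \<in> borel_measurable borel" by (intro borel_measurable_continuous_onI test_fun_continuous \<phi>)
    have a: "(\<integral>x. Re (u2 x) * \<phi> x \<partial>lborel) = (\<integral>x. (q x - z) * Re (w x) * \<phi> x \<partial>lborel)"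
      "(\<integral>x. Im (u2 x) * \<phi> x \<partial>lborel) = (\<integral>x. (q x - z) * Im (w x) * \<phi> x \<partial>lborel)"
      by (rule integral_cong_AE; (use m um wm q(1) in measurable)?; rule AE_mp[OF u2']; auto intro!: AE_I2)+
    show "(\<integral>x. Re (g x) * deriv \<phi> x \<partial>lborel) = - (\<integral>x. (q x - z) * Re (w x) * \<phi> x \<partial>lborel)"
      "(\<integral>x. Im (g x) * deriv \<phi> x \<partial>lborel) = - (\<integral>x. (q x - z) * Im (w x) * \<phi> x \<partial>lborel)"
      using weak_deriv_parts[OF w u2(1,2) \<phi>, unfolded d2, OF dd] 1[OF d] a by simp_all
  qed
  obtain y1 p1 where y1: "solves (\<lambda>x. q x - z) y1 p1" "AE x in lborel. Re (w x) = y1 x"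
    using weak_solution_regularity[OF lw(1) lg(1) Q 1(1) 2(1)] by blast
  obtain y2 p2 where y2: "solves (\<lambda>x. q x - z) y2 p2" "AE x in lborel. Im (w x) = y2 x"
    using weak_solution_regularity[OF lw(2) lg(2) Q 1(2) 2(2)] by blast
  have ae: "AE x in lborel. w x = Complex (y1 x) (y2 x)"
    using y1(2) y2(2) by eventually_elim (simp add: complex_eq_iff)
  have "integrable lborel (\<lambda>x. (y1 x)\<^sup>2)" "integrable lborel (\<lambda>x. (y2 x)\<^sup>2)"
  proof -
    have m: "y1 \<in> borel_measurable borel" "y2 \<in> borel_measurable borel"
      using solvesD(4)[OF y1(1)] solvesD(4)[OF y2(1)] by (auto intro: borel_measurable_continuous_onI)
    have "AE x in lborel. norm ((y1 x)\<^sup>2) \<le> norm ((cmod (w x))\<^sup>2)" "AE x in lborel. norm ((y2 x)\<^sup>2) \<le> norm ((cmod (w x))\<^sup>2)"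
      using ae by (eventually_elim, simp add: cmod_power2)+
    then show "integrable lborel (\<lambda>x. (y1 x)\<^sup>2)" "integrable lborel (\<lambda>x. (y2 x)\<^sup>2)"
      using m L2D(2)[OF w] by (auto intro: Bochner_Integration.integrable_bound[OF L2D(2)[OF w]])
  qed
  then show ?thesis using y1(1) y2(1) ae by blast
qed

lemma weak_deriv_of_prim:
  assumes "primitive f F" shows "weak_deriv (Suc 0) (\<lambda>x. complex_of_real (F x)) (\<lambda>x. complex_of_real (f x))"
  unfolding weak_deriv_def test_functions_iff
  using primitive_parts[OF assms] by (simp add: test_functions_iff flip: of_real_mult of_real_minus)

text \<open>For classical solutions the weak derivatives of order one and two are \<open>p\<close> and \<open>(q - z) y\<close>, by integration by parts.\<close>
lemma eigenfunctionI:
  assumes s: "solves (\<lambda>x. q x - z) y p" and q: "q \<in> borel_measurable borel" "\<And>x. \<bar>q x\<bar> \<le> M"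
    and y: "integrable lborel (\<lambda>x. (y x)\<^sup>2)" and p: "integrable lborel (\<lambda>x. (p x)\<^sup>2)" and nz: "y x0 \<noteq> 0"
  shows "eigenfunction (schroedinger q) (complex_of_real z) (\<lambda>x. complex_of_real (y x))"
proof -
  have m: "y \<in> borel_measurable borel" "p \<in> borel_measurable borel"
    using solvesD(4)[OF s] solvesD(5)[OF s] by (auto intro: borel_measurable_continuous_onI)
  have L: "(\<lambda>x. complex_of_real (f x)) \<in> L2" if "f \<in> borel_measurable borel" "integrable lborel (\<lambda>x. (f x)\<^sup>2)" for f
    using that by (simp add: L2_def)
  have Ly: "(\<lambda>x. complex_of_real (y x)) \<in> L2" and Lp: "(\<lambda>x. complex_of_real (p x)) \<in> L2" using L m y p by auto
  define Q where "Q x = (q x - z) * y x" for x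
  have Qm: "Q \<in> borel_measurable borel" unfolding Q_def[abs_def] using q(1) m by measurable
  have Qi: "integrable lborel (\<lambda>x. (Q x)\<^sup>2)"
  proof (rule Bochner_Integration.integrable_bound)
    show "integrable lborel (\<lambda>x. (M + \<bar>z\<bar>)\<^sup>2 * (y x)\<^sup>2)" using y by simp
    show "(\<lambda>x. (Q x)\<^sup>2) \<in> borel_measurable lborel" using Qm by simp
    show "AE x in lborel. norm ((Q x)\<^sup>2) \<le> norm ((M + \<bar>z\<bar>)\<^sup>2 * (y x)\<^sup>2)"
    proof (rule AE_I2)
      fix x
      have "\<bar>q x - z\<bar> \<le> M + \<bar>z\<bar>" using q(2)[of x] by linarith
      then have "\<bar>q x - z\<bar>\<^sup>2 \<le> (M + \<bar>z\<bar>)\<^sup>2" by (intro power_mono) auto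
      then show "norm ((Q x)\<^sup>2) \<le> norm ((M + \<bar>z\<bar>)\<^sup>2 * (y x)\<^sup>2)"
        by (simp add: Q_def power_mult_distrib mult_right_mono)
    qed
  qed
  have LQ: "(\<lambda>x. complex_of_real (Q x)) \<in> L2" using L Qm Qi by auto
  have pyp: "primitive p y" "primitive Q p" using solvesD(2,3)[OF s] by (auto simp: Q_def[abs_def])
  have w0: "weak_deriv 0 (\<lambda>x. complex_of_real (y x)) (\<lambda>x. complex_of_real (y x))" by (simp add: weak_deriv_def)
  have w1: "weak_deriv (Suc 0) (\<lambda>x. complex_of_real (y x)) (\<lambda>x. complex_of_real (p x))" by (rule weak_deriv_of_prim[OF pyp(1)])
  have w2: "weak_deriv 2 (\<lambda>x. complex_of_real (y x)) (\<lambda>x. complex_of_real (Q x))"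
    unfolding weak_deriv_def test_functions_iff
  proof
    fix \<phi> assume "\<phi> \<in> test_functions"
    then have \<phi>: "test_fun \<phi>" by (simp add: test_functions_iff)
    have "(\<integral>x. y x * deriv (deriv \<phi>) x \<partial>lborel) = (\<integral>x. Q x * \<phi> x \<partial>lborel)"
      using primitive_parts[OF pyp(1) test_fun_deriv(1)[OF \<phi>]] primitive_parts[OF pyp(2) \<phi>] by simp
    then show "(\<integral>x. complex_of_real (y x) * complex_of_real ((deriv ^^ 2) \<phi> x) \<partial>lborel) =
       (- 1) ^ 2 * (\<integral>x. complex_of_real (Q x) * complex_of_real (\<phi> x) \<partial>lborel)"
      by (simp add: numeral_2_eq_2 flip: of_real_mult)
  qed
  have sob: "(\<lambda>x. complex_of_real (y x)) \<in> sobolev_W2 2"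
    unfolding sobolev_W2_def
  proof (intro CollectI conjI Ly allI impI)
    fix k :: nat assume "k \<le> 2"
    then consider "k = 0" | "k = Suc 0" | "k = 2" by linarith
    then show "\<exists>g\<in>L2. weak_deriv k (\<lambda>x. complex_of_real (y x)) g"
      using w0 w1 w2 Ly Lp LQ by cases auto
  qed
  have "(\<lambda>x. complex_of_real z * complex_of_real (y x)) \<in> L2"
    using L[of "\<lambda>x. z * y x"] m y by (simp add: power_mult_distrib)
  then have "schroedinger q (\<lambda>x. complex_of_real (y x)) (\<lambda>x. complex_of_real z * complex_of_real (y x))"
    unfolding schroedinger_def using sob LQ w2
    by (auto intro!: bexI[of _ "\<lambda>x. complex_of_real (Q x)"] AE_I2 simp: Q_def algebra_simps)
  moreover have "\<not> (AE x in lborel. complex_of_real (y x) = 0)"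
  proof
    assume "AE x in lborel. complex_of_real (y x) = 0"
    then have "AE x in lborel. y x = (\<lambda>x. 0) x" by simp
    from continuous_AE_eq[OF solvesD(4)[OF s] _ this, of x0] nz show False by simp
  qed
  ultimately show ?thesis by (simp add: eigenfunction_def)
qed

section \<open>Norm and decay of bound states\<close>

text \<open>On the tails \<open>y\<^sup>2\<close> is the derivative of \<open>y\<^sup>2 / (2 k)\<close> and of \<open>- y\<^sup>2 / (2 k)\<close>, respectively. So the integrals over \<open>[-i, i]\<close> are
explicit and converge, and monotone convergence yields integrability together with the value.\<close>
lemma evans_zero_norm:
  assumes w: "well q R S M \<eta>" and k: "0 < k" and e: "evans q S k = 0"
  shows "has_bochner_integral lborel (\<lambda>x. (left_sol q S k x)\<^sup>2) (integral {-S..S} (\<lambda>x. left_sol q S k x * left_sol q S k x) + (1 + (left_sol q S k S)\<^sup>2) / (2 * k))"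
proof -
  note l = left_sol_pair[OF w, of k]
  let ?y = "left_sol q S k" and ?p = "left_deriv q S k"
  have S: "S > 0" using wellD(3,4)[OF w] by simp
  have ly: "locally_bounded (\<lambda>x. ?y x * ?y x)" by (intro locally_bounded_mult solvesD(6)[OF l(1)])
  define A where "A = antideriv (\<lambda>x. ?y x * ?y x)"
  have pA: "primitive (\<lambda>x. ?y x * ?y x) A" unfolding A_def by (rule primitive_antideriv[OF ly])
  have pyy: "primitive (\<lambda>x. ?p x * ?y x + ?y x * ?p x) (\<lambda>x. ?y x * ?y x)" by (rule primitive_mult[OF solvesD(2)[OF l(1)] solvesD(2)[OF l(1)]])
  have left: "A (-S) - A x = (1 - ?y x * ?y x) / (2 * k)" if x: "x \<le> -S" for x
  proof -
    have "A (-S) - 1 / (2 * k) * (?y (-S) * ?y (-S)) = A x - 1 / (2 * k) * (?y x * ?y x)"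
    proof (rule primitive_zero[OF primitive_diff[OF pA primitive_cmult[OF pyy]] x])
      fix t assume "t \<in> {x..-S}"
      then have "?p t = k * ?y t" using evans_zero_decay(1)[OF w e, of t] by simp
      then show "?y t * ?y t - 1 / (2 * k) * (?p t * ?y t + ?y t * ?p t) = 0" using k by (simp add: field_simps)
    qed
    then show ?thesis using l(2) k by (simp add: field_simps)
  qed
  have right: "A x - A S = (?y S * ?y S - ?y x * ?y x) / (2 * k)" if x: "S \<le> x" for x
  proof -
    have "A x - (- 1 / (2 * k)) * (?y x * ?y x) = A S - (- 1 / (2 * k)) * (?y S * ?y S)"
    proof (rule primitive_zero[OF primitive_diff[OF pA primitive_cmult[OF pyy]] x])
      fix t assume "t \<in> {S..x}"
      then have "?p t = - k * ?y t" using evans_zero_decay(3)[OF w e, of t] by simp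
      then show "?y t * ?y t - (- 1 / (2 * k)) * (?p t * ?y t + ?y t * ?p t) = 0" using k by (simp add: field_simps)
    qed
    then show ?thesis using k by (simp add: field_simps)
  qed
  have mid: "A S - A (-S) = integral {-S..S} (\<lambda>x. ?y x * ?y x)"
    unfolding A_def using S by (intro antideriv_diff locally_bounded_integrable ly) auto
  have yl0: "(\<lambda>i. ?y (- real i)) \<longlonglongrightarrow> 0"
  proof -
    have "(\<lambda>i. exp (- k * real i) * exp (k * S)) \<longlonglongrightarrow> 0 * exp (k * S)"
    proof (intro tendsto_mult tendsto_const)
      have "filterlim (\<lambda>i. - k * real i) at_bot sequentially"
        using k by (intro filterlim_tendsto_neg_mult_at_bot[OF tendsto_const _ filterlim_real_sequentially]) auto
      then show "(\<lambda>i. exp (- k * real i)) \<longlonglongrightarrow> 0" by (rule filterlim_compose[OF exp_at_bot])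
    qed
    moreover have "\<forall>\<^sub>F i in sequentially. exp (- k * real i) * exp (k * S) = ?y (- real i)"
    proof -
      obtain m :: nat where m: "S \<le> real m" using real_arch_simple by blast
      have "exp (- k * real i) * exp (k * S) = ?y (- real i)" if "m \<le> i" for i
        using evans_zero_decay(2)[OF w e, of "- real i"] m that by (simp add: exp_add[symmetric] algebra_simps)
      then show ?thesis by (auto simp: eventually_sequentially)
    qed
    ultimately have "(\<lambda>i. ?y (- real i)) \<longlonglongrightarrow> 0 * exp (k * S)" by (rule Lim_transform_eventually)
    then show ?thesis by simp
  qed
  have yr0: "(\<lambda>i. ?y (real i)) \<longlonglongrightarrow> 0"
  proof -
    have "(\<lambda>i. exp (- k * real i) * (?y S * exp (k * S))) \<longlonglongrightarrow> 0 * (?y S * exp (k * S))"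
    proof (intro tendsto_mult tendsto_const)
      have "filterlim (\<lambda>i. - k * real i) at_bot sequentially"
        using k by (intro filterlim_tendsto_neg_mult_at_bot[OF tendsto_const _ filterlim_real_sequentially]) auto
      then show "(\<lambda>i. exp (- k * real i)) \<longlonglongrightarrow> 0" by (rule filterlim_compose[OF exp_at_bot])
    qed
    moreover have "\<forall>\<^sub>F i in sequentially. exp (- k * real i) * (?y S * exp (k * S)) = ?y (real i)"
    proof -
      obtain m :: nat where m: "S \<le> real m" using real_arch_simple by blast
      have "exp (- k * real i) * (?y S * exp (k * S)) = ?y (real i)" if "m \<le> i" for i
      proof -
        have "?y (real i) = ?y S * exp (- k * (real i - S))" using evans_zero_decay(4)[OF w e, of "real i"] m that by simp
        also have "exp (- k * (real i - S)) = exp (- k * real i) * exp (k * S)" by (simp add: exp_add[symmetric] algebra_simps)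
        finally show ?thesis by simp
      qed
      then show ?thesis by (auto simp: eventually_sequentially)
    qed
    ultimately have "(\<lambda>i. ?y (real i)) \<longlonglongrightarrow> 0 * (?y S * exp (k * S))" by (rule Lim_transform_eventually)
    then show ?thesis by simp
  qed
  define f where "f i x = indicator {- real i..real i} x *\<^sub>R (?y x * ?y x)" for i :: nat and x
  have si: "set_integrable lborel {-real i..real i} (\<lambda>x. ?y x * ?y x)" for i :: nat
    by (rule locally_integrableD(2)[OF locally_bounded_locally_integrable[OF ly]])
  have fi: "integrable lborel (f i)" for i using si by (simp add: f_def[abs_def] set_integrable_def)
  have fI: "integral\<^sup>L lborel (f i) = A (real i) - A (- real i)" for i
    using set_borel_integral_eq_integral(2)[OF si[of i]] antideriv_diff[OF locally_bounded_integrable[OF ly], of "- real i" "real i"]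
    by (simp add: f_def[abs_def] set_lebesgue_integral_def A_def)
  have "has_bochner_integral lborel (\<lambda>x. ?y x * ?y x) (integral {-S..S} (\<lambda>x. ?y x * ?y x) + (1 + (?y S)\<^sup>2) / (2 * k))"
  proof (rule has_bochner_integral_monotone_convergence[OF fi])
    show "AE x in lborel. mono (\<lambda>i. f i x)"
      by (intro AE_I2 monoI) (auto simp: f_def indicator_def)
    show "AE x in lborel. (\<lambda>i. f i x) \<longlonglongrightarrow> ?y x * ?y x"
    proof (rule AE_I2, rule tendsto_eventually)
      fix x
      obtain m :: nat where m: "\<bar>x\<bar> \<le> real m" using real_arch_simple by blast
      have "f i x = ?y x * ?y x" if "m \<le> i" for i using m that by (auto simp: f_def indicator_def)
      then show "\<forall>\<^sub>F i in sequentially. f i x = ?y x * ?y x" by (auto simp: eventually_sequentially)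
    qed
    show "(\<lambda>x. ?y x * ?y x) \<in> borel_measurable lborel" using ly by (simp add: locally_bounded_def)
    show "(\<lambda>i. integral\<^sup>L lborel (f i)) \<longlonglongrightarrow> integral {-S..S} (\<lambda>x. ?y x * ?y x) + (1 + (?y S)\<^sup>2) / (2 * k)"
    proof (rule Lim_transform_eventually)
      show "(\<lambda>i. integral {-S..S} (\<lambda>x. ?y x * ?y x) + (1 - ?y (- real i) * ?y (- real i)) / (2 * k) + (?y S * ?y S - ?y (real i) * ?y (real i)) / (2 * k))
        \<longlonglongrightarrow> integral {-S..S} (\<lambda>x. ?y x * ?y x) + (1 + (?y S)\<^sup>2) / (2 * k)"
        using k by (auto intro!: tendsto_eq_intros yl0 yr0 simp: field_simps power2_eq_square)
      obtain m :: nat where m: "S \<le> real m" using real_arch_simple by blast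
      have "integral {-S..S} (\<lambda>x. ?y x * ?y x) + (1 - ?y (- real i) * ?y (- real i)) / (2 * k) + (?y S * ?y S - ?y (real i) * ?y (real i)) / (2 * k) = integral\<^sup>L lborel (f i)" if "m \<le> i" for i
        using left[of "- real i"] right[of "real i"] mid m that unfolding fI by simp
      then show "\<forall>\<^sub>F i in sequentially. integral {-S..S} (\<lambda>x. ?y x * ?y x) + (1 - ?y (- real i) * ?y (- real i)) / (2 * k) + (?y S * ?y S - ?y (real i) * ?y (real i)) / (2 * k) = integral\<^sup>L lborel (f i)"
        by (auto simp: eventually_sequentially)
    qed
  qed
  then show ?thesis by (simp add: power2_eq_square)
qed

lemma evans_zero_square_integrable:
  assumes w: "well q R S M \<eta>" and k: "0 < k" and e: "evans q S k = 0"
  shows "integrable lborel (\<lambda>x. (left_sol q S k x)\<^sup>2)" "integrable lborel (\<lambda>x. (left_deriv q S k x)\<^sup>2)"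
proof -
  note l = left_sol_pair[OF w, of k]
  show y: "integrable lborel (\<lambda>x. (left_sol q S k x)\<^sup>2)" using evans_zero_norm[OF assms] by (simp add: has_bochner_integral_iff)
  obtain B where B: "\<forall>x\<in>{-S..S}. \<bar>left_deriv q S k x\<bar> \<le> B" using locally_bounded_bound[OF solvesD(7)[OF l(1)]] by meson
  show "integrable lborel (\<lambda>x. (left_deriv q S k x)\<^sup>2)"
  proof (rule Bochner_Integration.integrable_bound)
    show "integrable lborel (\<lambda>x. k\<^sup>2 * (left_sol q S k x)\<^sup>2 + B\<^sup>2 * indicator {-S..S} x)"
      using y by (intro Bochner_Integration.integrable_add integrable_mult_right integrable_real_indicator) (auto simp: emeasure_lborel_Icc_eq)
    show "(\<lambda>x. (left_deriv q S k x)\<^sup>2) \<in> borel_measurable lborel"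
      using borel_measurable_continuous_onI[OF solvesD(5)[OF l(1)]] by simp
    show "AE x in lborel. norm ((left_deriv q S k x)\<^sup>2) \<le> norm (k\<^sup>2 * (left_sol q S k x)\<^sup>2 + B\<^sup>2 * indicator {-S..S} x)"
    proof (rule AE_I2)
      fix x
      consider "x \<le> -S" | "x \<ge> S" | "x \<in> {-S..S}" by force
      then show "norm ((left_deriv q S k x)\<^sup>2) \<le> norm (k\<^sup>2 * (left_sol q S k x)\<^sup>2 + B\<^sup>2 * indicator {-S..S} x)"
      proof cases
        case 1
        then show ?thesis using evans_zero_decay(1)[OF w e 1] by (simp add: power_mult_distrib)
      next
        case 2
        then show ?thesis using evans_zero_decay(3)[OF w e 2] by (simp add: power_mult_distrib)
      next
        case 3
        then have "\<bar>left_deriv q S k x\<bar>\<^sup>2 \<le> B\<^sup>2" using B by (intro power_mono) auto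
        then show ?thesis using 3 by (simp add: add_increasing)
      qed
    qed
  qed
qed

text \<open>The dictionary between operators and shooting, for the potential stretched by \<open>a\<close>. The second part also shows that
the negative eigenvalues are simple.\<close>
lemma scaled_eigenfunction_iff_evans_zero:
  assumes w: "well q R S M \<eta>" and k: "0 < k" and a: "0 < a"
  defines "H \<equiv> schroedinger (\<lambda>x. q (x / a) / a\<^sup>2)"
  shows "evans q S k = 0 \<Longrightarrow> eigenfunction H (complex_of_real (- (k / a)\<^sup>2)) (\<lambda>x. complex_of_real (left_sol q S k (x / a)))"
    "eigenfunction H (complex_of_real (- (k / a)\<^sup>2)) f \<Longrightarrow> evans q S k = 0 \<and> (\<exists>c. AE x in lborel. f x = c * complex_of_real (left_sol q S k (x / a)))"
proof -
  note l = left_sol_pair[OF w, of k]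
  have m: "(\<lambda>x. q (x / a) / a\<^sup>2) \<in> borel_measurable borel" using wellD(1)[OF w] by measurable
  have b: "\<bar>q (x / a) / a\<^sup>2\<bar> \<le> M / a\<^sup>2" for x
    using wellD(2)[OF w, of "x / a"] a by (simp add: abs_divide divide_right_mono)
  show "eigenfunction H (complex_of_real (- (k / a)\<^sup>2)) (\<lambda>x. complex_of_real (left_sol q S k (x / a)))" if e: "evans q S k = 0"
    unfolding H_def
  proof (rule eigenfunctionI[OF _ m b])
    show "solves (\<lambda>x. q (x / a) / a\<^sup>2 - - (k / a)\<^sup>2) (\<lambda>x. left_sol q S k (x / a)) (\<lambda>x. 1 / a * left_deriv q S k (x / a))"
      using solves_affine[OF l(1), of "1 / a" 0] by (simp add: power_divide add_divide_distrib)
    show "left_sol q S k (- S * a / a) \<noteq> 0" using l(2) a by simp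
    have c: "1 / a \<noteq> 0" using a by simp
    show "integrable lborel (\<lambda>x. (left_sol q S k (x / a))\<^sup>2)"
      using lborel_integrable_real_affine[OF evans_zero_square_integrable(1)[OF w k e] c, of 0] by simp
    show "integrable lborel (\<lambda>x. (1 / a * left_deriv q S k (x / a))\<^sup>2)"
      unfolding power_mult_distrib
      using lborel_integrable_real_affine[OF evans_zero_square_integrable(2)[OF w k e] c, of 0]
      by (intro integrable_mult_right) simp
  qed
  assume ef: "eigenfunction H (complex_of_real (- (k / a)\<^sup>2)) f"
  obtain y1 p1 y2 p2 where s: "solves (\<lambda>x. q (x / a) / a\<^sup>2 - - (k / a)\<^sup>2) y1 p1" "solves (\<lambda>x. q (x / a) / a\<^sup>2 - - (k / a)\<^sup>2) y2 p2"
     and ae: "AE x in lborel. f x = Complex (y1 x) (y2 x)"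
     and i: "integrable lborel (\<lambda>x. (y1 x)\<^sup>2)" "integrable lborel (\<lambda>x. (y2 x)\<^sup>2)"
    using eigenfunction_regularity[OF ef[unfolded H_def] m b] by blast
  have sc: "solves (\<lambda>x. q x + k\<^sup>2) (\<lambda>x. y (a * x)) (\<lambda>x. a * p (a * x))"
    if "solves (\<lambda>x. q (x / a) / a\<^sup>2 - - (k / a)\<^sup>2) y p" for y p
    using solves_affine[OF that, of a 0] a by (simp add: distrib_left power_divide)
  have ic: "integrable lborel (\<lambda>x. (y (a * x))\<^sup>2)" if "integrable lborel (\<lambda>x. (y x)\<^sup>2)" for y :: "real \<Rightarrow> real"
    using lborel_integrable_real_affine[OF that, of a 0] a by simp
  have rep: "y (a * x) = y (a * (-S)) * left_sol q S k x"
    if s: "solves (\<lambda>x. q (x / a) / a\<^sup>2 - - (k / a)\<^sup>2) y p" and i: "integrable lborel (\<lambda>x. (y x)\<^sup>2)" for y p x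
  proof (cases "\<exists>x. y (a * x) \<noteq> 0")
    case True
    show ?thesis by (rule evans_zero_of_square_integrable(3)[OF w sc[OF s] k ic[OF i] True])
  next
    case False
    then have z: "y (a * t) = 0" for t by blast
    show ?thesis using z[of x] z[of "-S"] by simp
  qed
  have "\<exists>x. y1 x \<noteq> 0 \<or> y2 x \<noteq> 0"
  proof (rule ccontr)
    assume "\<not> ?thesis"
    then have "AE x in lborel. f x = 0" using ae by (auto simp: complex_eq_iff)
    then show False using ef by (simp add: eigenfunction_def)
  qed
  then obtain x where "y1 x \<noteq> 0 \<or> y2 x \<noteq> 0" by blast
  then have "y1 (a * (x / a)) \<noteq> 0 \<or> y2 (a * (x / a)) \<noteq> 0" using a by simp
  then have "evans q S k = 0"
    using evans_zero_of_square_integrable(1)[OF w sc[OF s(1)] k ic[OF i(1)]]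
      evans_zero_of_square_integrable(1)[OF w sc[OF s(2)] k ic[OF i(2)]] by blast
  moreover have "AE x in lborel. f x = Complex (y1 (a * (-S))) (y2 (a * (-S))) * complex_of_real (left_sol q S k (x / a))"
    using ae
  proof eventually_elim
    case (elim x)
    have "y1 x = y1 (a * (-S)) * left_sol q S k (x / a)" "y2 x = y2 (a * (-S)) * left_sol q S k (x / a)"
      using rep[OF s(1) i(1), of "x / a"] rep[OF s(2) i(2), of "x / a"] a by simp_all
    then show ?case using elim by (simp add: complex_eq_iff)
  qed
  ultimately show "evans q S k = 0 \<and> (\<exists>c. AE x in lborel. f x = c * complex_of_real (left_sol q S k (x / a)))" by blast
qed

text \<open>Where the logarithmic slope is at most \<open>- k\<close>, the function \<open>y\<^sup>2 exp (2 k x)\<close> decreases; this covers the outer potential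
as well as the region beyond it.\<close>
lemma bound_state_exponential_decay:
  assumes w: "well q R S M \<eta>" and k: "0 < k" and e: "evans q S k = 0" and L: "0 \<le> L"
  shows "R \<le> x \<Longrightarrow> (left_sol q S k (x + L))\<^sup>2 \<le> exp (- 2 * k * L) * (left_sol q S k x)\<^sup>2"
    "x \<le> -R \<Longrightarrow> (left_sol q S k (x - L))\<^sup>2 \<le> exp (- 2 * k * L) * (left_sol q S k x)\<^sup>2"
proof -
  note l = left_sol_pair[OF w, of k]
  let ?y = "left_sol q S k" and ?p = "left_deriv q S k"
  have pr: "primitive (\<lambda>x. 2 * (?y x * ?p x + c * (?y x)\<^sup>2) * exp (2 * c * x)) (\<lambda>x. (?y x)\<^sup>2 * exp (2 * c * x))" for c
    by (rule primitive_cong[OF primitive_mult[OF primitive_mult[OF solvesD(2)[OF l(1)] solvesD(2)[OF l(1)]] primitive_exp[of "2 * c"]]])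
      (auto simp: algebra_simps power2_eq_square)
  show "(?y (x + L))\<^sup>2 \<le> exp (- 2 * k * L) * (?y x)\<^sup>2" if x: "R \<le> x"
  proof -
    have "(?y (x + L))\<^sup>2 * exp (2 * k * (x + L)) \<le> (?y x)\<^sup>2 * exp (2 * k * x)"
    proof (rule primitive_antimono[OF pr[of k]])
      fix t assume "t \<in> {x..x + L}"
      then show "2 * (?y t * ?p t + k * (?y t)\<^sup>2) * exp (2 * k * t) \<le> 0"
        using evans_zero_right(2)[OF w k e, of t] x by (simp add: mult_le_0_iff)
    qed (use L in auto)
    then have "(?y (x + L))\<^sup>2 * exp (2 * k * (x + L)) * exp (- 2 * k * (x + L)) \<le> (?y x)\<^sup>2 * exp (2 * k * x) * exp (- 2 * k * (x + L))"
      by (rule mult_right_mono) auto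
    then show ?thesis by (simp add: mult.assoc exp_add[symmetric]) (simp add: algebra_simps)
  qed
  show "(?y (x - L))\<^sup>2 \<le> exp (- 2 * k * L) * (?y x)\<^sup>2" if x: "x \<le> -R"
  proof -
    have "(?y (x - L))\<^sup>2 * exp (2 * (-k) * (x - L)) \<le> (?y x)\<^sup>2 * exp (2 * (-k) * x)"
    proof (rule primitive_mono[OF pr[of "-k"]])
      fix t assume "t \<in> {x - L..x}"
      then have "t \<le> -R" using x by simp
      from left_sol_positive(1,2)[OF w k this] have "k * ?y t * ?y t \<le> ?y t * ?p t" by (simp add: mult.commute mult_left_mono)
      then show "0 \<le> 2 * (?y t * ?p t + (-k) * (?y t)\<^sup>2) * exp (2 * (-k) * t)" by (simp add: power2_eq_square mult.assoc)
    qed (use L in auto)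
    then have "(?y (x - L))\<^sup>2 * exp (2 * (-k) * (x - L)) * exp (2 * k * (x - L)) \<le> (?y x)\<^sup>2 * exp (2 * (-k) * x) * exp (2 * k * (x - L))"
      by (rule mult_right_mono) auto
    then show ?thesis by (simp add: mult.assoc exp_add[symmetric]) (simp add: algebra_simps)
  qed
qed

text \<open>Shifting the tail by \<open>L\<close> compares it with the whole integral.\<close>
lemma tail_integral_bound:
  fixes f :: "real \<Rightarrow> real"
  assumes f: "integrable lborel f" "\<And>x. 0 \<le> f x" and d: "\<And>x. a \<le> x \<Longrightarrow> f (x + L) \<le> \<theta> * f x" and \<theta>: "0 \<le> \<theta>"
  shows "(\<integral>x. indicator {a + L<..} x * f x \<partial>lborel) \<le> \<theta> * (\<integral>x. f x \<partial>lborel)"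
proof -
  have fm: "f \<in> borel_measurable borel" using borel_measurable_integrable[OF f(1)] by simp
  have "(\<integral>x. indicator {a + L<..} x * f x \<partial>lborel) = (\<integral>x. indicator {a + L<..} (L + x) * f (L + x) \<partial>lborel)"
    using lborel_integral_real_affine[of 1 "\<lambda>x. indicator {a + L<..} x * f x" L] by simp
  also have "\<dots> \<le> (\<integral>x. \<theta> * f x \<partial>lborel)"
  proof (rule integral_mono)
    have "integrable lborel (\<lambda>x. indicator {a + L<..} x * f x)"
      using integrable_mult_indicator[OF _ f(1), of "{a + L<..}"] by simp
    from lborel_integrable_real_affine[OF this, of 1 L]
    show "integrable lborel (\<lambda>x. indicator {a + L<..} (L + x) * f (L + x))" by simp
    show "integrable lborel (\<lambda>x. \<theta> * f x)" using f(1) by simp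
    fix x show "indicator {a + L<..} (L + x) * f (L + x) \<le> \<theta> * f x"
      using d[of x] f(2)[of x] \<theta> by (auto simp: indicator_def add.commute)
  qed
  finally show ?thesis by simp
qed

lemma tail_integral_bound_both:
  fixes f :: "real \<Rightarrow> real"
  assumes f: "integrable lborel f" "\<And>x. 0 \<le> f x" and d: "\<And>x. a \<le> x \<Longrightarrow> f (x + L) \<le> \<theta> * f x"
    and d': "\<And>x. x \<le> -a \<Longrightarrow> f (x - L) \<le> \<theta> * f x" and \<theta>: "0 \<le> \<theta>" and aL: "0 \<le> a + L"
  shows "(\<integral>x. indicator {x. a + L < \<bar>x\<bar>} x * f x \<partial>lborel) \<le> 2 * \<theta> * (\<integral>x. f x \<partial>lborel)"
proof -
  have r: "integrable lborel (\<lambda>x. f (- x))" using lborel_integrable_real_affine[OF f(1), of "-1" 0] by simp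
  have I: "integrable lborel (\<lambda>x. indicator A x * f x)" if "A \<in> sets borel" for A
    using integrable_mult_indicator[OF _ f(1), of A] that by simp
  have "(\<integral>x. indicator {x. a + L < \<bar>x\<bar>} x * f x \<partial>lborel) = (\<integral>x. indicator {a + L<..} x * f x + indicator {..<-(a + L)} x * f x \<partial>lborel)"
    using aL by (intro Bochner_Integration.integral_cong) (auto simp: indicator_def abs_if)
  also have "\<dots> = (\<integral>x. indicator {a + L<..} x * f x \<partial>lborel) + (\<integral>x. indicator {..<-(a + L)} x * f x \<partial>lborel)"
    by (intro Bochner_Integration.integral_add I) auto
  also have "(\<integral>x. indicator {..<-(a + L)} x * f x \<partial>lborel) = (\<integral>x. indicator {a + L<..} x * f (- x) \<partial>lborel)"
  proof -
    have eq: "(\<lambda>x. indicator {..<-(a + L)} (0 + (-1) * x) * f (0 + (-1) * x)) = (\<lambda>x. indicator {a + L<..} x * f (- x))"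
      by (auto simp: indicator_def fun_eq_iff)
    show ?thesis
      using lborel_integral_real_affine[of "-1" "\<lambda>x. indicator {..<-(a + L)} x * f x" 0] unfolding eq by simp
  qed
  also have "\<dots> \<le> \<theta> * (\<integral>x. f (- x) \<partial>lborel)"
    by (rule tail_integral_bound[OF r]) (use f(2) d'[of "- _"] \<theta> in auto)
  also have "(\<integral>x. f (- x) \<partial>lborel) = (\<integral>x. f x \<partial>lborel)"
    using lborel_integral_real_affine[of "-1" f 0] by simp
  also have "(\<integral>x. indicator {a + L<..} x * f x \<partial>lborel) \<le> \<theta> * (\<integral>x. f x \<partial>lborel)"
    by (rule tail_integral_bound[OF f d \<theta>])
  finally show ?thesis by simp
qed

section \<open>Concentration and weak convergence\<close>

text \<open>Split \<open>\<integral> w h\<close> at \<open>\<bar>x\<bar> = \<delta>\<close>. Young's inequality with a small weight bounds the inner part by the mass of \<open>h\<close> near \<open>0\<close>, which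
is small for small \<open>\<delta>\<close>, and the outer part by the mass of \<open>w\<close> there.\<close>
lemma concentrating_weak_limit:
  fixes w :: "'i \<Rightarrow> real \<Rightarrow> complex"
  assumes w: "\<forall>\<^sub>F i in F. w i \<in> L2 \<and> l2_norm (w i) = 1"
    and tail: "\<And>\<delta>. 0 < \<delta> \<Longrightarrow> ((\<lambda>i. \<integral>x. indicator {x. \<delta> < \<bar>x\<bar>} x * (cmod (w i x))\<^sup>2 \<partial>lborel) \<longlongrightarrow> 0) F"
  shows "l2_weak_tendsto w (\<lambda>_. 0) F"
  unfolding l2_weak_tendsto_def
proof
  fix h assume h: "h \<in> L2"
  define H where "H = (\<integral>x. (cmod (h x))\<^sup>2 \<partial>lborel)"
  have H0: "0 \<le> H" unfolding H_def by (intro integral_nonneg_AE AE_I2) auto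
  note hi = L2D(2)[OF h] and hm = L2D(1)[OF h]
  have core: "(\<lambda>n. \<integral>x. indicator {x. \<bar>x\<bar> \<le> inverse (real (Suc n))} x * (cmod (h x))\<^sup>2 \<partial>lborel) \<longlonglongrightarrow> 0"
  proof -
    have "(\<lambda>n. \<integral>x. indicator {x. \<bar>x\<bar> \<le> inverse (real (Suc n))} x * (cmod (h x))\<^sup>2 \<partial>lborel) \<longlonglongrightarrow> (\<integral>x. 0 \<partial>(lborel :: real measure))"
    proof (rule integral_dominated_convergence[OF _ _ hi])
      show "AE x in lborel. (\<lambda>n. indicator {x. \<bar>x\<bar> \<le> inverse (real (Suc n))} x * (cmod (h x))\<^sup>2) \<longlonglongrightarrow> 0"
        using AE_lborel_singleton[of 0]
      proof eventually_elim
        case (elim x)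
        then have ev: "\<forall>\<^sub>F n in sequentially. inverse (real (Suc n)) < \<bar>x\<bar>"
          using order_tendstoD(2)[OF LIMSEQ_inverse_real_of_nat, of "\<bar>x\<bar>"] by simp
        show ?case
          by (rule tendsto_eventually, rule eventually_mono[OF ev]) (simp add: indicator_def del: of_nat_Suc)
      qed
      show "AE x in lborel. norm (indicator {x. \<bar>x\<bar> \<le> inverse (real (Suc n))} x * (cmod (h x))\<^sup>2) \<le> (cmod (h x))\<^sup>2" for n
        by (intro AE_I2) (auto simp: indicator_def)
      show "(\<lambda>x. indicator {x. \<bar>x\<bar> \<le> inverse (real (Suc n))} x * (cmod (h x))\<^sup>2) \<in> borel_measurable lborel" for n
        using hm by (auto simp del: of_nat_Suc)
    qed auto
    then show ?thesis by simp
  qed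
  have "((\<lambda>i. l2_inner (w i) h) \<longlongrightarrow> 0) F"
    unfolding tendsto_iff
  proof (intro allI impI)
    fix r :: real assume r: "0 < r"
    (* the weight in Young's inequality: it leaves r/4 for the two full norms and r/2 for the two partial masses *)
    define \<eta> where "\<eta> = r / (2 * (1 + H))"
    have \<eta>: "0 < \<eta>" using r H0 by (simp add: \<eta>_def)
    have e1: "\<eta> / 2 * (1 + H) = r / 4" using H0 by (simp add: \<eta>_def field_simps)
    have "0 < \<eta> * r / 2" using \<eta> r by simp
    from order_tendstoD(2)[OF core this]
    obtain n where n: "(\<integral>x. indicator {x. \<bar>x\<bar> \<le> inverse (real (Suc n))} x * (cmod (h x))\<^sup>2 \<partial>lborel) < \<eta> * r / 2"
      using eventually_happens by (metis (no_types, lifting) sequentially_bot)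
    define \<delta> where "\<delta> = inverse (real (Suc n))"
    have \<delta>: "0 < \<delta>" by (simp add: \<delta>_def)
    define Hd where "Hd = (\<integral>x. indicator {x. \<bar>x\<bar> \<le> \<delta>} x * (cmod (h x))\<^sup>2 \<partial>lborel)"
    have Hd: "Hd < \<eta> * r / 2" using n by (simp add: Hd_def \<delta>_def)
    show "\<forall>\<^sub>F i in F. dist (l2_inner (w i) h) 0 < r"
      using w order_tendstoD(2)[OF tail[OF \<delta>] \<open>0 < \<eta> * r / 2\<close>]
    proof eventually_elim
      case (elim i)
      then have wL: "w i \<in> L2" and w1: "l2_norm (w i) = 1" by auto
      note wi = L2D(2)[OF wL] and wm = L2D(1)[OF wL]
      define T where "T = (\<integral>x. indicator {x. \<delta> < \<bar>x\<bar>} x * (cmod (w i x))\<^sup>2 \<partial>lborel)"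
      have T: "T < \<eta> * r / 2" using elim by (simp add: T_def)
      have I1: "(\<integral>x. (cmod (w i x))\<^sup>2 \<partial>lborel) = 1" using w1 by (simp add: l2_norm_def)
      have iT: "integrable lborel (\<lambda>x. indicator {x. \<delta> < \<bar>x\<bar>} x * (cmod (w i x))\<^sup>2)"
        using integrable_mult_indicator[OF _ wi, of "{x. \<delta> < \<bar>x\<bar>}"] by simp
      have iH: "integrable lborel (\<lambda>x. indicator {x. \<bar>x\<bar> \<le> \<delta>} x * (cmod (h x))\<^sup>2)"
        using integrable_mult_indicator[OF _ hi, of "{x. \<bar>x\<bar> \<le> \<delta>}"] by simp
      define g where "g x = \<eta> / 2 * ((cmod (w i x))\<^sup>2 + (cmod (h x))\<^sup>2) + 1 / (2 * \<eta>) * (indicator {x. \<bar>x\<bar> \<le> \<delta>} x * (cmod (h x))\<^sup>2 + indicator {x. \<delta> < \<bar>x\<bar>} x * (cmod (w i x))\<^sup>2)" for x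
      have ig: "integrable lborel g"
        unfolding g_def[abs_def] using wi hi iT iH by (intro Bochner_Integration.integrable_add integrable_mult_right)
      have Ig: "integral\<^sup>L lborel g = \<eta> / 2 * (1 + H) + 1 / (2 * \<eta>) * (Hd + T)"
        unfolding g_def[abs_def] using wi hi iT iH I1 by (simp add: H_def Hd_def T_def)
      have young: "a * b \<le> \<eta> / 2 * a\<^sup>2 + 1 / (2 * \<eta>) * b\<^sup>2" for a b :: real
      proof -
        have "0 \<le> (\<eta> * a - b)\<^sup>2" by simp
        then have "2 * \<eta> * (a * b) \<le> \<eta>\<^sup>2 * a\<^sup>2 + b\<^sup>2" by (simp add: power2_diff power_mult_distrib mult.assoc)
        then have "(2 * \<eta> * (a * b)) / (2 * \<eta>) \<le> (\<eta>\<^sup>2 * a\<^sup>2 + b\<^sup>2) / (2 * \<eta>)" using \<eta> by (intro divide_right_mono) auto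
        then show ?thesis using \<eta> by (simp add: add_divide_distrib power2_eq_square)
      qed
      have gle: "norm (w i x * cnj (h x)) \<le> g x" for x
      proof (cases "\<bar>x\<bar> \<le> \<delta>")
        case True
        have "0 \<le> \<eta> / 2 * (cmod (h x))\<^sup>2" using \<eta> by simp
        then show ?thesis using young[of "cmod (w i x)" "cmod (h x)"] True by (simp add: g_def norm_mult distrib_left)
      next
        case False
        have "0 \<le> \<eta> / 2 * (cmod (w i x))\<^sup>2" using \<eta> by simp
        then show ?thesis using young[of "cmod (h x)" "cmod (w i x)"] False by (simp add: g_def norm_mult distrib_left mult.commute)
      qed
      have "norm (l2_inner (w i) h) \<le> (\<integral>x. norm (w i x * cnj (h x)) \<partial>lborel)"
        unfolding l2_inner_def by (rule integral_norm_bound)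
      moreover have "(\<integral>x. norm (w i x * cnj (h x)) \<partial>lborel) \<le> integral\<^sup>L lborel g"
        by (rule integral_mono'[OF ig]) (use gle order_trans[OF norm_ge_zero gle] in auto)
      moreover have "1 / (2 * \<eta>) * (Hd + T) < r / 2"
      proof -
        have "1 / (2 * \<eta>) * (Hd + T) < 1 / (2 * \<eta>) * (\<eta> * r)" using Hd T \<eta> by (intro mult_strict_left_mono) auto
        then show ?thesis using \<eta> by simp
      qed
      ultimately have "norm (l2_inner (w i) h) < r" unfolding Ig e1 using r by linarith
      then show ?case by simp
    qed
  qed
  then show "((\<lambda>i. l2_inner (w i) h) \<longlongrightarrow> l2_inner (\<lambda>_. 0) h) F" by (simp add: l2_inner_def)
qed

lemma compactly_supported_representative:
  assumes "f \<in> Linfty" "compactly_supported f"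
  shows "\<exists>f' R C. f' \<in> borel_measurable borel \<and> (\<forall>x. \<bar>f' x\<bar> \<le> C) \<and> (\<forall>x. R \<le> \<bar>x\<bar> \<longrightarrow> f' x = 0) \<and> (AE x in lborel. f x = f' x)"
proof -
  obtain C where fm: "f \<in> borel_measurable borel" and C: "AE x in lborel. \<bar>f x\<bar> \<le> C" using assms(1) by (auto simp: Linfty_def)
  obtain K where K: "compact K" "AE x in lborel. x \<notin> K \<longrightarrow> f x = 0" using assms(2) by (auto simp: compactly_supported_def)
  obtain R where R: "\<And>x. x \<in> K \<Longrightarrow> \<bar>x\<bar> \<le> R" using compact_imp_bounded[OF K(1)] unfolding bounded_iff by auto
  define f' where "f' x = (if \<bar>f x\<bar> \<le> \<bar>C\<bar> \<and> \<bar>x\<bar> < R + 1 then f x else 0)" for x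
  have "f' \<in> borel_measurable borel" unfolding f'_def[abs_def] using fm by measurable
  moreover have "AE x in lborel. f x = f' x"
    using C K(2)
  proof eventually_elim
    case (elim x)
    then show ?case using R[of x] by (cases "x \<in> K") (auto simp: f'_def)
  qed
  ultimately show ?thesis
    by (intro exI[of _ f'] exI[of _ "R + 1"] exI[of _ "\<bar>C\<bar>"]) (auto simp: f'_def)
qed

lemma schroedinger_cong_AE:
  assumes "AE x in lborel. q x = q' x"
  shows "schroedinger q = schroedinger q'"
proof -
  have "(AE x in lborel. f x = - u2 x + of_real (q x) * u x) = (AE x in lborel. f x = - u2 x + of_real (q' x) * u x)" for f u2 u :: "real \<Rightarrow> complex"
    by (intro AE_cong_simp refl iffI; rule AE_mp[OF _ AE_mp[OF assms]]; auto)
  then show ?thesis by (auto simp: schroedinger_def fun_eq_iff)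
qed

lemma AE_rescale:
  fixes f g :: "real \<Rightarrow> real"
  assumes "f \<in> borel_measurable borel" "g \<in> borel_measurable borel" "c \<noteq> 0" "AE x in lborel. f x = g x"
  shows "AE x in lborel. f (c * x) = g (c * x)"
proof -
  have "Measurable.pred borel (\<lambda>x. f x = g x)" using assms(1,2) by measurable
  from AE_borel_affine[OF assms(3) this assms(4), of 0] show ?thesis by simp
qed

lemma hamiltonian_cong_AE:
  assumes m: "U \<in> borel_measurable borel" "U' \<in> borel_measurable borel" "V \<in> borel_measurable borel" "V' \<in> borel_measurable borel"
    and ae: "AE x in lborel. U x = U' x" "AE x in lborel. V x = V' x" "AE x in lborel. W x = W' x" and e: "e \<noteq> 0"
  shows "hamiltonian U V W e = hamiltonian U' V' W' e"
  unfolding hamiltonian_def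
proof (rule schroedinger_cong_AE)
  have i: "inverse e \<noteq> 0" using e by simp
  show "AE x in lborel. W x + inverse e * U (inverse e * x) + inverse (e\<^sup>2) * V (inverse e * x) =
     W' x + inverse e * U' (inverse e * x) + inverse (e\<^sup>2) * V' (inverse e * x)"
    using ae(3) AE_rescale[OF m(1,2) i ae(1)] AE_rescale[OF m(3,4) i ae(2)] by eventually_elim simp
qed

context scaled_wells begin

lemma hamiltonian_scaled:
  assumes "0 < e" shows "hamiltonian U V W e = schroedinger (\<lambda>x. scaled_potential e (x / e) / e\<^sup>2)"
proof -
  have "W x + inverse e * U (inverse e * x) + inverse (e\<^sup>2) * V (inverse e * x) = scaled_potential e (x / e) / e\<^sup>2" for x
    using assms by (simp add: scaled_potential_def field_simps power2_eq_square)
  then show ?thesis by (simp add: hamiltonian_def)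
qed

text \<open>In the original variable the decay sets in at \<open>R e\<close>, the end of the stretched well, and has rate \<open>k / e\<close>. The distance from
there to \<open>\<delta>\<close> gives the exponent.\<close>
lemma eigenfunction_tail:
  assumes e: "0 < e" "e \<le> 1" and k: "0 < k" and n: "N e k = 0" and d: "R * e \<le> \<delta>"
    and f: "f \<in> L2" "l2_norm f = 1" and ae: "AE x in lborel. f x = c * complex_of_real (left_sol (scaled_potential e) (R / e) k (x / e))"
  shows "(\<integral>x. indicator {x. \<delta> < \<bar>x\<bar>} x * (cmod (f x))\<^sup>2 \<partial>lborel) \<le> 2 * exp (- 2 * k * (\<delta> / e - R))"
proof -
  let ?y = "left_sol (scaled_potential e) (R / e) k"
  define g where "g x = (cmod c)\<^sup>2 * (?y (x / e))\<^sup>2" for x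
  note w = well_scaled_potential[OF e]
  have m: "?y \<in> borel_measurable borel" using solvesD(4)[OF left_sol_pair(1)[OF w]] by (rule borel_measurable_continuous_onI)
  have gm: "g \<in> borel_measurable borel" unfolding g_def[abs_def] using m by measurable
  have fg: "AE x in lborel. (cmod (f x))\<^sup>2 = g x" using ae by eventually_elim (simp add: g_def norm_mult power_mult_distrib)
  have gi: "integrable lborel g" using integrable_cong_AE[of "\<lambda>x. (cmod (f x))\<^sup>2" lborel g] fg L2D[OF f(1)] gm by simp
  have gI: "integral\<^sup>L lborel g = 1"
    using integral_cong_AE[of "\<lambda>x. (cmod (f x))\<^sup>2" lborel g] fg L2D[OF f(1)] gm f(2) by (simp add: l2_norm_def)
  define L where "L = \<delta> - R * e"
  have L: "0 \<le> L" "0 \<le> L / e" using d e by (auto simp: L_def)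
  have aL: "R * e + L = \<delta>" by (simp add: L_def)
  have R0: "0 \<le> R * e" using R e by simp
  have th: "exp (- 2 * k * (L / e)) = exp (- 2 * k * (\<delta> / e - R))" using e by (simp add: L_def diff_divide_distrib)
  have "(\<integral>x. indicator {x. R * e + L < \<bar>x\<bar>} x * g x \<partial>lborel) \<le> 2 * exp (- 2 * k * (L / e)) * (\<integral>x. g x \<partial>lborel)"
  proof (rule tail_integral_bound_both[OF gi])
    show "0 \<le> g x" for x by (simp add: g_def)
    show "g (x + L) \<le> exp (- 2 * k * (L / e)) * g x" if "R * e \<le> x" for x
    proof -
      have "R \<le> x / e" using that e by (simp add: pos_le_divide_eq)
      from bound_state_exponential_decay(1)[OF w k n L(2) this]
      have "(?y (x / e + L / e))\<^sup>2 \<le> exp (- 2 * k * (L / e)) * (?y (x / e))\<^sup>2" .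
      then have "(cmod c)\<^sup>2 * (?y (x / e + L / e))\<^sup>2 \<le> (cmod c)\<^sup>2 * (exp (- 2 * k * (L / e)) * (?y (x / e))\<^sup>2)" by (intro mult_left_mono) auto
      then show ?thesis by (simp add: g_def add_divide_distrib mult.left_commute)
    qed
    show "g (x - L) \<le> exp (- 2 * k * (L / e)) * g x" if "x \<le> - (R * e)" for x
    proof -
      have "x / e \<le> - R" using that e by (simp add: pos_divide_le_eq)
      from bound_state_exponential_decay(2)[OF w k n L(2) this]
      have "(?y (x / e - L / e))\<^sup>2 \<le> exp (- 2 * k * (L / e)) * (?y (x / e))\<^sup>2" .
      then have "(cmod c)\<^sup>2 * (?y (x / e - L / e))\<^sup>2 \<le> (cmod c)\<^sup>2 * (exp (- 2 * k * (L / e)) * (?y (x / e))\<^sup>2)" by (intro mult_left_mono) auto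
      then show ?thesis by (simp add: g_def diff_divide_distrib mult.left_commute)
    qed
    show "0 \<le> R * e + L" using R0 L by simp
  qed simp
  moreover have "(\<integral>x. indicator {x. \<delta> < \<bar>x\<bar>} x * (cmod (f x))\<^sup>2 \<partial>lborel) = (\<integral>x. indicator {x. \<delta> < \<bar>x\<bar>} x * g x \<partial>lborel)"
    by (rule integral_cong_AE) (use L2D[OF f(1)] gm fg in auto)
  ultimately show ?thesis unfolding aL th gI by simp
qed

lemma eigenfunctions_concentrate:
  assumes k0: "0 < k0"
    and ev: "\<forall>\<^sub>F e in at_right 0. N e (\<kappa> e) = 0 \<and> k0 / 2 \<le> \<kappa> e \<and> f e \<in> L2 \<and> l2_norm (f e) = 1 \<and>
       (\<exists>c. AE x in lborel. f e x = c * complex_of_real (left_sol (scaled_potential e) (R / e) (\<kappa> e) (x / e)))"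
  shows "l2_weak_tendsto f (\<lambda>_. 0) (at_right 0)"
proof (rule concentrating_weak_limit)
  show "\<forall>\<^sub>F e in at_right 0. f e \<in> L2 \<and> l2_norm (f e) = 1" using ev by (rule eventually_mono) auto
  fix \<delta> :: real assume \<delta>: "0 < \<delta>"
  have pos: "\<forall>\<^sub>F e::real in at_right 0. 0 < e" by (simp add: eventually_at_right_less)
  have t: "((\<lambda>e::real. e) \<longlongrightarrow> 0) (at_right 0)" by (auto intro!: tendsto_eq_intros)
  have sm: "\<forall>\<^sub>F e::real in at_right 0. e < 1" "\<forall>\<^sub>F e::real in at_right 0. e < \<delta> / R"
    using order_tendstoD(2)[OF t] \<delta> R by auto
  show "((\<lambda>e. \<integral>x. indicator {x. \<delta> < \<bar>x\<bar>} x * (cmod (f e x))\<^sup>2 \<partial>lborel) \<longlongrightarrow> 0) (at_right 0)"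
  proof (rule Lim_null_comparison)
    show "\<forall>\<^sub>F e in at_right 0. norm (\<integral>x. indicator {x. \<delta> < \<bar>x\<bar>} x * (cmod (f e x))\<^sup>2 \<partial>lborel) \<le> 2 * exp (- k0 * (\<delta> * inverse e - R))"
      using ev pos sm
    proof eventually_elim
      case (elim e)
      then obtain c where c: "AE x in lborel. f e x = c * complex_of_real (left_sol (scaled_potential e) (R / e) (\<kappa> e) (x / e))" by blast
      have d: "R * e \<le> \<delta>" using elim R by (simp add: pos_less_divide_eq mult.commute)
      have e: "0 < e" "e \<le> 1" "0 < \<kappa> e" using elim k0 by auto
      have "0 \<le> \<delta> / e - R" using d e by (simp add: pos_le_divide_eq)
      then have "k0 * (\<delta> / e - R) \<le> 2 * \<kappa> e * (\<delta> / e - R)" using elim by (intro mult_right_mono) auto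
      then have "exp (- 2 * \<kappa> e * (\<delta> / e - R)) \<le> exp (- k0 * (\<delta> * inverse e - R))" by (simp add: divide_inverse)
      moreover have "(\<integral>x. indicator {x. \<delta> < \<bar>x\<bar>} x * (cmod (f e x))\<^sup>2 \<partial>lborel) \<le> 2 * exp (- 2 * \<kappa> e * (\<delta> / e - R))"
        by (rule eigenfunction_tail[OF e(1,2,3) _ d _ _ c]) (use elim in auto)
      moreover have "0 \<le> (\<integral>x. indicator {x. \<delta> < \<bar>x\<bar>} x * (cmod (f e x))\<^sup>2 \<partial>lborel)" by (intro integral_nonneg_AE AE_I2) auto
      ultimately show ?case unfolding real_norm_def by linarith
    qed
    have "filterlim (\<lambda>e. - k0 * (\<delta> * inverse e - R)) at_bot (at_right 0)"
    proof (rule filterlim_tendsto_neg_mult_at_bot[OF tendsto_const])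
      have "filterlim (\<lambda>e. - R + \<delta> * inverse e) at_top (at_right 0)"
        by (intro filterlim_tendsto_add_at_top[OF tendsto_const] filterlim_tendsto_pos_mult_at_top[OF tendsto_const \<delta>] filterlim_inverse_at_top_right)
      then show "filterlim (\<lambda>e. \<delta> * inverse e - R) at_top (at_right 0)" by simp
    qed (use k0 in auto)
    from tendsto_mult[OF tendsto_const filterlim_compose[OF exp_at_bot this], of 2]
    show "((\<lambda>e. 2 * exp (- k0 * (\<delta> * inverse e - R))) \<longlongrightarrow> 0) (at_right 0)" by simp
  qed
qed

text \<open>The eigenfunction is a multiple of \<open>v k0\<close>, and the factor cancels in the quotient.\<close>
lemma first_order_coefficient:
  assumes k0: "0 < k0" and d: "D0 k0 = 0" and U1: "U1 \<in> borel_measurable borel" "AE x in lborel. U1 x = U x"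
    and f: "f \<in> L2" and ae: "AE x in lborel. f x = c * complex_of_real (v k0 x)" and nz: "\<not> (AE x in lborel. f x = 0)"
  shows "(\<integral>x. U1 x * (cmod (f x))\<^sup>2 \<partial>lborel) / (2 * k0 * (l2_norm f)\<^sup>2) = coupling k0 / root_slope k0"
proof -
  have c: "c \<noteq> 0" using ae nz by auto
  have m: "v k0 \<in> borel_measurable borel" using solvesD(4)[OF v(1)] by (rule borel_measurable_continuous_onI)
  note fm = L2D(1)[OF f]
  have sq: "AE x in lborel. (cmod (f x))\<^sup>2 = (cmod c)\<^sup>2 * (v k0 x)\<^sup>2"
    using ae by eventually_elim (simp add: norm_mult power_mult_distrib)
  have "(\<integral>x. U1 x * (cmod (f x))\<^sup>2 \<partial>lborel) = (\<integral>x. (cmod c)\<^sup>2 * (U x * (v k0 x * v k0 x)) \<partial>lborel)"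
  proof (rule integral_cong_AE)
    show "AE x in lborel. U1 x * (cmod (f x))\<^sup>2 = (cmod c)\<^sup>2 * (U x * (v k0 x * v k0 x))"
      using sq U1(2) by eventually_elim (simp add: power2_eq_square)
  qed (use U1 fm m meas in auto)
  also have "\<dots> = (cmod c)\<^sup>2 * (\<integral>x. U x * (v k0 x * v k0 x) \<partial>lborel)" by simp
  also have "(\<integral>x. U x * (v k0 x * v k0 x) \<partial>lborel) = coupling k0"
    unfolding coupling_def using supp(1)
    by (intro locally_integrable_compact_support(2) locally_bounded_locally_integrable locally_bounded_mult locally_bounded_U locally_bounded_v) auto
  finally have 1: "(\<integral>x. U1 x * (cmod (f x))\<^sup>2 \<partial>lborel) = (cmod c)\<^sup>2 * coupling k0" .
  have "(l2_norm f)\<^sup>2 = (\<integral>x. (cmod (f x))\<^sup>2 \<partial>lborel)" by (simp add: l2_norm_def)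
  also have "\<dots> = (\<integral>x. (cmod c)\<^sup>2 * (v k0 x)\<^sup>2 \<partial>lborel)" by (rule integral_cong_AE) (use sq fm m in auto)
  also have "\<dots> = (cmod c)\<^sup>2 * (core_mass k0 + (1 + (v k0 R)\<^sup>2) / (2 * k0))"
    using evans_zero_norm[OF well_V k0 d] by (simp add: has_bochner_integral_iff core_mass_def)
  also have "core_mass k0 + (1 + (v k0 R)\<^sup>2) / (2 * k0) = root_slope k0 / (2 * k0)" using k0 by (simp add: root_slope_def field_simps)
  finally have "(l2_norm f)\<^sup>2 = (cmod c)\<^sup>2 * (root_slope k0 / (2 * k0))" .
  then show ?thesis using 1 c k0 root_slope_ge[of k0] by simp
qed

end

section \<open>The low-lying eigenvalues\<close>

text \<open>With \<open>s = w - e a / b\<close> the difference is \<open>(s - k) (k + s) / e\<^sup>2\<close>, and \<open>k - s = O(e\<^sup>2)\<close>.\<close>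
lemma eigenvalue_asymptotics:
  fixes e k w a A b :: real
  assumes e: "0 < e" "e \<le> 1" and A: "0 \<le> A" and b: "1 \<le> b" and w: "0 < w"
    and k1: "\<bar>k - w\<bar> \<le> A * e" and k2: "\<bar>(k - w) * b + e * a\<bar> \<le> A * e\<^sup>2"
  shows "\<bar>- (k / e)\<^sup>2 - (- inverse (e\<^sup>2) * (w - e * (a / b))\<^sup>2)\<bar> \<le> A * (2 * w + A + \<bar>a\<bar>)"
proof -
  define s where "s = w - e * (a / b)"
  have "(k - w) * b + e * a = (k - s) * b" using b by (simp add: s_def field_simps)
  then have "\<bar>k - s\<bar> * b \<le> A * e\<^sup>2" using k2 b by (simp add: abs_mult)
  moreover have "\<bar>k - s\<bar> \<le> \<bar>k - s\<bar> * b" using mult_left_mono[OF b, of "\<bar>k - s\<bar>"] by simp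
  ultimately have 1: "\<bar>k - s\<bar> \<le> A * e\<^sup>2" by (rule order_trans[rotated])
  have "A * e \<le> A" using A e by (simp add: mult_left_le)
  moreover have "\<bar>e * (a / b)\<bar> \<le> \<bar>a\<bar>"
  proof -
    have "\<bar>a\<bar> / b \<le> \<bar>a\<bar> / 1" using b by (intro divide_left_mono) auto
    then have "e * (\<bar>a\<bar> / b) \<le> 1 * \<bar>a\<bar>" using e b by (intro mult_mono) auto
    then show ?thesis using e b by (simp add: abs_mult abs_divide)
  qed
  ultimately have 2: "\<bar>k + s\<bar> \<le> 2 * w + A + \<bar>a\<bar>" using k1 w unfolding s_def by linarith
  have "- (k / e)\<^sup>2 - (- inverse (e\<^sup>2) * s\<^sup>2) = inverse (e\<^sup>2) * ((s - k) * (k + s))"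
    by (simp add: power_divide divide_inverse power2_eq_square algebra_simps)
  then have "\<bar>- (k / e)\<^sup>2 - (- inverse (e\<^sup>2) * s\<^sup>2)\<bar> = inverse (e\<^sup>2) * (\<bar>k - s\<bar> * \<bar>k + s\<bar>)"
    by (simp add: abs_mult abs_minus_commute)
  also have "\<dots> \<le> inverse (e\<^sup>2) * ((A * e\<^sup>2) * (2 * w + A + \<bar>a\<bar>))"
    using 1 2 A by (intro mult_left_mono mult_mono) auto
  also have "\<dots> = A * (2 * w + A + \<bar>a\<bar>)" using e by simp
  finally show ?thesis by (simp add: s_def)
qed

theorem theorem3:
  fixes U V W :: "real \<Rightarrow> real"
    and n :: nat
    and \<omega> :: "nat \<Rightarrow> real"
    and v :: "nat \<Rightarrow> real \<Rightarrow> complex"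
  assumes "U \<in> Linfty" "V \<in> Linfty" "W \<in> Linfty"
    and "compactly_supported U" "compactly_supported V" "compactly_supported W"
    and "AE x in lborel. W x \<ge> 0"
    and "\<And>k. k \<in> {1..n} \<Longrightarrow> \<omega> k > 0"
    and "strict_mono_on {1..n} (\<lambda>k. - (\<omega> k)\<^sup>2)"
    and "eigenvalues (schroedinger V) = (\<lambda>k. complex_of_real (- (\<omega> k)\<^sup>2)) ` {1..n}"
    and "\<And>k. k \<in> {1..n} \<Longrightarrow> eigenfunction (schroedinger V) (complex_of_real (- (\<omega> k)\<^sup>2)) (v k)"
  shows "\<exists>lam :: nat \<Rightarrow> real \<Rightarrow> real.
    (\<forall>k\<in>{1..n}. low_lying_eigenvalue (hamiltonian U V W) (lam k)) \<and>
    (\<forall>\<^sub>F \<epsilon> in at_right 0. strict_mono_on {1..n} (\<lambda>k. lam k \<epsilon>)) \<and>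
    (\<forall>\<mu>. low_lying_eigenvalue (hamiltonian U V W) \<mu> \<longrightarrow>
       (\<forall>\<^sub>F \<epsilon> in at_right 0. \<exists>k\<in>{1..n}. \<mu> \<epsilon> = lam k \<epsilon>)) \<and>
    (\<forall>k\<in>{1..n}.
       (\<lambda>\<epsilon>. lam k \<epsilon> -
          (- inverse (\<epsilon>\<^sup>2) *
             (\<omega> k - \<epsilon> * ((\<integral>x. U x * (cmod (v k x))\<^sup>2 \<partial>lborel) /
                           (2 * \<omega> k * (l2_norm (v k))\<^sup>2)))\<^sup>2))
       \<in> O[at_right 0](\<lambda>_. 1)) \<and>
    (\<forall>k\<in>{1..n}. \<forall>w :: real \<Rightarrow> real \<Rightarrow> complex.
       (\<forall>\<^sub>F \<epsilon> in at_right 0.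
          eigenfunction (hamiltonian U V W \<epsilon>) (complex_of_real (lam k \<epsilon>)) (w \<epsilon>) \<and>
          l2_norm (w \<epsilon>) = 1) \<longrightarrow>
       l2_weak_tendsto w (\<lambda>_. 0) (at_right 0))"
proof -
  note asm = assms
  have om: "\<And>k. k \<in> {1..n} \<Longrightarrow> \<omega> k > 0" by fact
  obtain U' RU CU where U': "U' \<in> borel_measurable borel" "\<And>x. \<bar>U' x\<bar> \<le> CU" "\<And>x. RU \<le> \<bar>x\<bar> \<Longrightarrow> U' x = 0" "AE x in lborel. U x = U' x"
    using compactly_supported_representative[OF asm(1,4)] by blast
  obtain V' RV CV where V': "V' \<in> borel_measurable borel" "\<And>x. \<bar>V' x\<bar> \<le> CV" "\<And>x. RV \<le> \<bar>x\<bar> \<Longrightarrow> V' x = 0" "AE x in lborel. V x = V' x"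
    using compactly_supported_representative[OF asm(2,5)] by blast
  obtain W1 RW CW where W1: "W1 \<in> borel_measurable borel" "\<And>x. \<bar>W1 x\<bar> \<le> CW" "\<And>x. RW \<le> \<bar>x\<bar> \<Longrightarrow> W1 x = 0" "AE x in lborel. W x = W1 x"
    using compactly_supported_representative[OF asm(3,6)] by blast
  define W' where "W' x = max 0 (W1 x)" for x
  have W'm: "W' \<in> borel_measurable borel" unfolding W'_def[abs_def] using W1(1) by measurable
  have W'ae: "AE x in lborel. W x = W' x" using W1(4) asm(7) by eventually_elim (simp add: W'_def)
  define R where "R = 1 + \<bar>RU\<bar> + \<bar>RV\<bar> + \<bar>RW\<bar>"
  define M where "M = 1 + \<bar>CU\<bar> + \<bar>CV\<bar> + \<bar>CW\<bar>"
  interpret scaled_wells U' V' W' R M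
  proof
    fix x
    show "\<bar>U' x\<bar> \<le> M" using U'(2)[of x] by (simp add: M_def)
    show "\<bar>V' x\<bar> \<le> M" using V'(2)[of x] by (simp add: M_def)
    show "0 \<le> W' x" by (simp add: W'_def)
    show "W' x \<le> M" using W1(2)[of x] by (simp add: M_def W'_def)
    show "R \<le> \<bar>x\<bar> \<Longrightarrow> U' x = 0" using U'(3)[of x] by (simp add: R_def)
    show "R \<le> \<bar>x\<bar> \<Longrightarrow> V' x = 0" using V'(3)[of x] by (simp add: R_def)
    show "R \<le> \<bar>x\<bar> \<Longrightarrow> W' x = 0" using W1(3)[of x] by (simp add: R_def W'_def)
  qed (use U'(1) V'(1) W'm in \<open>simp_all add: R_def M_def\<close>)
  have Um: "U \<in> borel_measurable borel" "V \<in> borel_measurable borel" using asm(1,2) by (auto simp: Linfty_def)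
  have Ham: "hamiltonian U V W e = schroedinger (\<lambda>x. scaled_potential e (x / e) / e\<^sup>2)" if "0 < e" for e
    using hamiltonian_cong_AE[OF Um(1) U'(1) Um(2) V'(1) U'(4) V'(4) W'ae, of e] hamiltonian_scaled[OF that] that by simp
  have SV: "schroedinger V = schroedinger (\<lambda>x. V' (x / 1) / 1\<^sup>2)"
    using schroedinger_cong_AE[OF V'(4)] by simp
  define \<Omega> where "\<Omega> = \<omega> ` {1..n}"
  have zeros: "D0 k = 0 \<longleftrightarrow> k \<in> \<Omega>" if k: "0 < k" for k
  proof
    assume "D0 k = 0"
    from scaled_eigenfunction_iff_evans_zero(1)[OF well_V k zero_less_one this]
    have "complex_of_real (- k\<^sup>2) \<in> eigenvalues (schroedinger V)"
      unfolding SV eigenvalues_def by auto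
    then obtain j where j: "j \<in> {1..n}" "complex_of_real (- k\<^sup>2) = complex_of_real (- (\<omega> j)\<^sup>2)"
      unfolding asm(10) by blast
    have "k = \<omega> j"
    proof -
      have "k\<^sup>2 = (\<omega> j)\<^sup>2" using j(2) by (simp only: of_real_eq_iff neg_equal_iff_equal)
      then show ?thesis using k om[OF j(1)] by (simp add: power2_eq_iff)
    qed
    then show "k \<in> \<Omega>" using j(1) by (simp add: \<Omega>_def)
  next
    assume "k \<in> \<Omega>"
    then obtain j where j: "j \<in> {1..n}" "k = \<omega> j" by (auto simp: \<Omega>_def)
    have "eigenfunction (schroedinger (\<lambda>x. V' (x / 1) / 1\<^sup>2)) (complex_of_real (- (k / 1)\<^sup>2)) (v j)"
      using asm(11)[OF j(1)] unfolding SV[symmetric] by (simp add: j(2))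
    then show "D0 k = 0" using scaled_eigenfunction_iff_evans_zero(2)[OF well_V k zero_less_one] by blast
  qed
  have fin: "finite \<Omega>" by (simp add: \<Omega>_def)
  have Opos: "\<And>k. k \<in> \<Omega> \<Longrightarrow> 0 < k" using om by (auto simp: \<Omega>_def)
  obtain A e0 \<kappa> where A: "0 \<le> A" and e0: "0 < e0" "e0 \<le> 1" and
    main: "\<And>e. 0 < e \<Longrightarrow> e < e0 \<Longrightarrow>
    (\<forall>k0\<in>\<Omega>. 0 < \<kappa> k0 e \<and> N e (\<kappa> k0 e) = 0 \<and> \<bar>\<kappa> k0 e - k0\<bar> \<le> A * e \<and>
        \<bar>(\<kappa> k0 e - k0) * root_slope k0 + e * coupling k0\<bar> \<le> A * e\<^sup>2) \<and>
    (\<forall>k>0. N e k = 0 \<longrightarrow> k \<le> A * e \<or> (\<exists>k0\<in>\<Omega>. k = \<kappa> k0 e))"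
    using evans_roots[OF fin Opos zeros] by blast
  define lam where "lam k e = - (\<kappa> (\<omega> k) e / e)\<^sup>2" for k e
  have Om: "\<omega> k \<in> \<Omega>" if "k \<in> {1..n}" for k using that by (simp add: \<Omega>_def)
  have pos: "\<forall>\<^sub>F e::real in at_right 0. 0 < e" by (simp add: eventually_at_right_less)
  have t0: "((\<lambda>e::real. e) \<longlongrightarrow> 0) (at_right 0)" by (auto intro!: tendsto_eq_intros)
  have tA: "((\<lambda>e::real. A * e) \<longlongrightarrow> 0) (at_right 0)" by (auto intro!: tendsto_eq_intros)
  have small: "\<forall>\<^sub>F e in at_right 0. 0 < e \<and> e < e0"
    using pos order_tendstoD(2)[OF t0 e0(1)] by eventually_elim auto
  have near: "0 < \<kappa> (\<omega> k) e" "N e (\<kappa> (\<omega> k) e) = 0" "\<bar>\<kappa> (\<omega> k) e - \<omega> k\<bar> \<le> A * e"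
     "\<bar>(\<kappa> (\<omega> k) e - \<omega> k) * root_slope (\<omega> k) + e * coupling (\<omega> k)\<bar> \<le> A * e\<^sup>2" if "k \<in> {1..n}" "0 < e" "e < e0" for k e
    using main[OF that(2,3)] Om[OF that(1)] by blast+
  have ev_small: "\<forall>\<^sub>F e in at_right 0. A * e < r" if "0 < r" for r
    using order_tendstoD(2)[OF tA that] .
  have low: "low_lying_eigenvalue (hamiltonian U V W) (lam k)" if k: "k \<in> {1..n}" for k
    unfolding low_lying_eigenvalue_def
  proof
    show "\<forall>\<^sub>F e in at_right 0. complex_of_real (lam k e) \<in> eigenvalues (hamiltonian U V W e)"
      using small
    proof eventually_elim
      case (elim e)
      then have e: "0 < e" "e \<le> 1" "e < e0" using e0 by auto
      from scaled_eigenfunction_iff_evans_zero(1)[OF well_scaled_potential[OF e(1,2)] near(1)[OF k e(1,3)] e(1) near(2)[OF k e(1,3)]]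
      show ?case unfolding Ham[OF e(1)] eigenvalues_def lam_def by blast
    qed
    have "((\<lambda>e. \<kappa> (\<omega> k) e - \<omega> k) \<longlongrightarrow> 0) (at_right 0)"
      by (rule Lim_null_comparison[OF eventually_mono[OF small] tA]) (use near(3)[OF k] in auto)
    then have "(\<kappa> (\<omega> k) \<longlongrightarrow> \<omega> k) (at_right 0)" by (simp add: LIM_zero_iff)
    then have "filterlim (\<lambda>e. \<kappa> (\<omega> k) e * inverse e) at_top (at_right 0)"
      using om[OF k] by (rule filterlim_tendsto_pos_mult_at_top[OF _ _ filterlim_inverse_at_top_right])
    then have "filterlim (\<lambda>e. (\<kappa> (\<omega> k) e * inverse e)\<^sup>2) at_top (at_right 0)"
      by (intro filterlim_pow_at_top) auto
    then show "filterlim (lam k) at_bot (at_right 0)"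
      unfolding filterlim_uminus_at_top by (simp add: lam_def[abs_def] divide_inverse)
  qed
  have om_less: "\<omega> j < \<omega> i" if "i \<in> {1..n}" "j \<in> {1..n}" "i < j" for i j
  proof -
    have "- (\<omega> i)\<^sup>2 < - (\<omega> j)\<^sup>2" by (rule strict_mono_onD[OF asm(9) that])
    then have "(\<omega> j)\<^sup>2 < (\<omega> i)\<^sup>2" by simp
    then show ?thesis by (rule power2_less_imp_less) (rule less_imp_le[OF om[OF that(1)]])
  qed
  have sm: "\<forall>\<^sub>F e in at_right 0. strict_mono_on {1..n} (\<lambda>k. lam k e)"
  proof -
    have "\<forall>\<^sub>F e in at_right 0. \<forall>p\<in>{1..n} \<times> {1..n}. fst p < snd p \<longrightarrow> 2 * (A * e) < \<omega> (fst p) - \<omega> (snd p)"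
    proof (rule eventually_ball_finite)
      show "\<forall>p\<in>{1..n} \<times> {1..n}. \<forall>\<^sub>F e in at_right 0. fst p < snd p \<longrightarrow> 2 * (A * e) < \<omega> (fst p) - \<omega> (snd p)"
      proof
        fix p assume p: "p \<in> {1..n} \<times> {1..n}"
        show "\<forall>\<^sub>F e in at_right 0. fst p < snd p \<longrightarrow> 2 * (A * e) < \<omega> (fst p) - \<omega> (snd p)"
        proof (cases "fst p < snd p")
          case True
          then have "0 < (\<omega> (fst p) - \<omega> (snd p)) / 2" using om_less[of "fst p" "snd p"] p by auto
          from ev_small[OF this] show ?thesis by eventually_elim simp
        qed simp
      qed
    qed simp
    then show ?thesis using small
    proof eventually_elim
      case (elim e)
      show ?case
      proof (rule strict_mono_onI)
        fix i j assume ij: "i \<in> {1..n}" "j \<in> {1..n}" "i < j"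
        have "2 * (A * e) < \<omega> i - \<omega> j" using elim(1)[rule_format, of "(i, j)"] ij by simp
        moreover have "\<bar>\<kappa> (\<omega> i) e - \<omega> i\<bar> \<le> A * e" "\<bar>\<kappa> (\<omega> j) e - \<omega> j\<bar> \<le> A * e"
          using near(3) ij(1,2) elim(2) by blast+
        ultimately have "\<kappa> (\<omega> j) e < \<kappa> (\<omega> i) e" by linarith
        then have "\<kappa> (\<omega> j) e / e < \<kappa> (\<omega> i) e / e" using elim(2) by (simp add: divide_strict_right_mono)
        moreover have "0 \<le> \<kappa> (\<omega> j) e / e" using near(1)[of j e] ij elim(2) by simp
        ultimately have "(\<kappa> (\<omega> j) e / e)\<^sup>2 < (\<kappa> (\<omega> i) e / e)\<^sup>2" by (intro power_strict_mono) auto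
        then show "lam i e < lam j e" by (simp add: lam_def)
      qed
    qed
  qed
  have complete: "\<forall>\<^sub>F e in at_right 0. \<exists>k\<in>{1..n}. \<mu> e = lam k e" if \<mu>: "low_lying_eigenvalue (hamiltonian U V W) \<mu>" for \<mu>
  proof -
    (* below this level the roots of size O(e), whose eigenvalues are at least -A^2, are excluded *)
    have "\<forall>\<^sub>F e in at_right 0. \<mu> e < - A\<^sup>2"
      using \<mu> unfolding low_lying_eigenvalue_def filterlim_at_bot_dense by blast
    moreover have "\<forall>\<^sub>F e in at_right 0. complex_of_real (\<mu> e) \<in> eigenvalues (hamiltonian U V W e)"
      using \<mu> unfolding low_lying_eigenvalue_def by blast
    ultimately show ?thesis using small
    proof eventually_elim
      case (elim e)
      then have e: "0 < e" "e \<le> 1" "e < e0" using e0 by auto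
      define k where "k = e * sqrt (- \<mu> e)"
      have \<mu>0: "\<mu> e < 0" using elim(1) zero_le_power2[of A] by linarith
      have k: "0 < k" using e \<mu>0 by (simp add: k_def)
      have mk: "\<mu> e = - (k / e)\<^sup>2" using e \<mu>0 by (simp add: k_def)
      obtain f where "eigenfunction (hamiltonian U V W e) (complex_of_real (- (k / e)\<^sup>2)) f"
        using elim(2) unfolding mk eigenvalues_def by blast
      then have "N e k = 0"
        using scaled_eigenfunction_iff_evans_zero(2)[OF well_scaled_potential[OF e(1,2)] k e(1)] unfolding Ham[OF e(1)] by blast
      then consider "k \<le> A * e" | k0 where "k0 \<in> \<Omega>" "k = \<kappa> k0 e" using main[OF e(1,3)] k by blast
      then show ?case
      proof cases
        case 1
        then have "sqrt (- \<mu> e) \<le> A" using e by (simp add: k_def mult.commute)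
        then have "(sqrt (- \<mu> e))\<^sup>2 \<le> A\<^sup>2" using \<mu>0 by (intro power_mono) auto
        then show ?thesis using elim(1) \<mu>0 by simp
      next
        case 2
        then show ?thesis unfolding mk lam_def by (auto simp: \<Omega>_def)
      qed
    qed
  qed
  have asym: "(\<lambda>e. lam k e - (- inverse (e\<^sup>2) * (\<omega> k - e * ((\<integral>x. U x * (cmod (v k x))\<^sup>2 \<partial>lborel) /
        (2 * \<omega> k * (l2_norm (v k))\<^sup>2)))\<^sup>2)) \<in> O[at_right 0](\<lambda>_. 1)" if k: "k \<in> {1..n}" for k
  proof -
    have d: "D0 (\<omega> k) = 0" using zeros[OF om[OF k]] Om[OF k] by simp
    have ef: "eigenfunction (schroedinger (\<lambda>x. V' (x / 1) / 1\<^sup>2)) (complex_of_real (- (\<omega> k / 1)\<^sup>2)) (v k)"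
      using asm(11)[OF k] unfolding SV[symmetric] by simp
    obtain c where c: "AE x in lborel. v k x = c * complex_of_real (left_sol V' R (\<omega> k) (x / 1))"
      using scaled_eigenfunction_iff_evans_zero(2)[OF well_V om[OF k] zero_less_one ef] by blast
    have vL: "v k \<in> L2" and nz: "\<not> (AE x in lborel. v k x = 0)"
      using ef by (auto simp: eigenfunction_def schroedinger_def sobolev_W2_def)
    have co: "(\<integral>x. U x * (cmod (v k x))\<^sup>2 \<partial>lborel) / (2 * \<omega> k * (l2_norm (v k))\<^sup>2) = coupling (\<omega> k) / root_slope (\<omega> k)"
      using first_order_coefficient[OF om[OF k] d Um(1) U'(4) vL _ nz, of c] c by simp
    show ?thesis
      unfolding co
    proof (rule bigoI)
      show "\<forall>\<^sub>F e in at_right 0. norm (lam k e - (- inverse (e\<^sup>2) * (\<omega> k - e * (coupling (\<omega> k) / root_slope (\<omega> k)))\<^sup>2))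
        \<le> A * (2 * \<omega> k + A + \<bar>coupling (\<omega> k)\<bar>) * norm (1::real)"
        using small
      proof eventually_elim
        case (elim e)
        then have e: "0 < e" "e \<le> 1" "e < e0" using e0 by auto
        have "1 \<le> root_slope (\<omega> k)" using root_slope_ge om[OF k] by simp
        from eigenvalue_asymptotics[OF e(1,2) A this om[OF k] near(3,4)[OF k e(1,3)]]
        show ?case by (simp add: lam_def)
      qed
    qed
  qed
  have weak: "l2_weak_tendsto w (\<lambda>_. 0) (at_right 0)" if k: "k \<in> {1..n}" and
    w: "\<forall>\<^sub>F e in at_right 0. eigenfunction (hamiltonian U V W e) (complex_of_real (lam k e)) (w e) \<and> l2_norm (w e) = 1" for k w
  proof (rule eigenfunctions_concentrate[OF om[OF k]])
    have "0 < \<omega> k / 2" using om[OF k] by simp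
    show "\<forall>\<^sub>F e in at_right 0. N e (\<kappa> (\<omega> k) e) = 0 \<and> \<omega> k / 2 \<le> \<kappa> (\<omega> k) e \<and> w e \<in> L2 \<and> l2_norm (w e) = 1 \<and>
       (\<exists>c. AE x in lborel. w e x = c * complex_of_real (left_sol (scaled_potential e) (R / e) (\<kappa> (\<omega> k) e) (x / e)))"
      using w small ev_small[OF \<open>0 < \<omega> k / 2\<close>]
    proof eventually_elim
      case (elim e)
      then have e: "0 < e" "e \<le> 1" "e < e0" using e0 by auto
      note nr = near[OF k e(1,3)]
      have ef: "eigenfunction (schroedinger (\<lambda>x. scaled_potential e (x / e) / e\<^sup>2)) (complex_of_real (- (\<kappa> (\<omega> k) e / e)\<^sup>2)) (w e)"
        using elim(1) unfolding Ham[OF e(1)] lam_def by blast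
      have "\<exists>c. AE x in lborel. w e x = c * complex_of_real (left_sol (scaled_potential e) (R / e) (\<kappa> (\<omega> k) e) (x / e))"
        using scaled_eigenfunction_iff_evans_zero(2)[OF well_scaled_potential[OF e(1,2)] nr(1) e(1) ef] by blast
      moreover have "w e \<in> L2" using ef by (auto simp: eigenfunction_def schroedinger_def sobolev_W2_def)
      moreover have "\<omega> k / 2 \<le> \<kappa> (\<omega> k) e" using nr(3) elim(3) by linarith
      ultimately show ?case using nr(2) elim(1) by blast
    qed
  qed
  show ?thesis using low sm complete asym weak by (intro exI[of _ lam]) blast
qed

end
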